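(* Let $\mathbf f=(f_0,\dots,f_m)$ be a symmetric tensor packet of degree at most $m$ on a real separable Hilbert space $H$, with canvas process $\mathcal Z_{\mathbf f}$. For $r\ge1$ and $x\in E_r$ put $M_{\mathbf f,r}(x)=\mathbb E\prod_{a=1}^r\mathcal Z_{\mathbf f}(x_a)$. Then $$M_{\mathbf f,r}(x)=\sum_{N\in\mathcal A_{r,m}}C_{\mathbf f}(N)\chi_N(x),$$ where, writing $q_a=\sum_{b\ne a}N_{ab}$, $$C_{\mathbf f}(N)=\frac{\prod_{a=1}^rq_a!}{\prod_{a<b}N_{ab}!}\operatorname{Contr}_N(f_{q_1},\dots,f_{q_r}),$$ an isolated vertex ($q_a=0$) being interpreted as the factor $f_0$. Moreover, define the matrix and vector indexed by $\mathcal A_{r,m}$ $$G_{N,N'}=\int_{E_r}\chi_N\chi_{N'}\,d\gamma_r^\circ,\qquad b_{\mathbf f,r}(N')=\int_{E_r}M_{\mathbf f,r}\,\chi_{N'}\,d\gamma_r^\circ .$$ Then $G_{N,N'}=\det_{E_r}(I+L_N+L_{N'})^{-1/2}$, the matrix $G$ is positive definite, and $$\bigl(C_{\mathbf f}(N)\bigr)_{N\in\mathcal A_{r,m}}=G^{-1}\bigl(b_{\mathbf f,r}(N)\bigr)_{N\in\mathcal A_{r,m}}.$$ Consequently, the $C(\mathbb R)$-valued law of the single process $\mathcal Z_{\mathbf f}$ determines $f_0$ and all loop-free contractions $\operatorname{Contr}_N(f_{q_1},\dots,f_{q_r})$, where $r\ge1$ and $N$ ranges over symmetric zero-diagonal nonnegative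 integer $r\times r$ arrays with all row sums $q_a\in\{1,\dots,m\}$.
   Context: $H^{\odot q}$ is the closed subspace of symmetric tensors in the Hilbert tensor power $H^{\otimes q}$; a packet of degree at most $m$ is $(f_0,\dots,f_m)$ with $f_0\in\mathbb R$, $f_q\in H^{\odot q}$. The Gaussian canvas over $H$ is a jointly Gaussian centered family with $\mathbb E[\mathbb W_u(h)\mathbb W_v(k)]=e^{-(u-v)^2}\langle h,k\rangle_H$, $u,v\in\mathbb R$; $I_q^{\mathbb W_u}$ is the $q$th multiple Wiener integral with $\mathbb E[I_q(f)^2]=q!\|f\|^2$; the canvas process is $\mathcal Z_{\mathbf f}(u)=f_0+\sum_{q=1}^mI_q^{\mathbb W_u}(f_q)$ (smooth modification; law on $C(\mathbb R)$ with locally uniform topology). $E_r=\{x\in\mathbb R^r:\sum_ax_a=0\}$ ($E_1=\{0\}$), with normalized Gaussian measure $d\gamma_r^\circ(x)=\pi^{-(r-1)/2}e^{-|x|^2}dx$, $dx$ being the induced Euclidean Lebesgue measure. $\mathcal A_{r,m}$ is the finite set of symmetric zero-diagonal $r\times r$ arrays $N=(N_{ab})$ of nonnegative integers with all row sums at most $m$. $L_N$ is the graph Laplacian: $(L_N)_{aa}=\sum_{b\ne a}N_{ab}$, $(L_N)_{ab}=-N_{ab}$ for $a\ne b$. $\chi_N(x)=\exp(-x^{\mathsf T}L_Nx)=\exp(-\sum_{a<b}N_{ab}(x_a-x_b)^2)$. $\det_{E_r}$ is the determinant of the restriction to $E_r$. $\operatorname{Contr}_N(f_{q_1},\dots,f_{q_r})$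 is the scalar obtained by placing $f_{q_a}$ at vertex $a$ and contracting exactly $N_{ab}$ tensor legs between vertices $a$ and $b$ for all $a<b$ (well defined by symmetry of the tensors). *)

theory Defs
  imports
    "HOL-Probability.Probability"
    "Jordan_Normal_Form.Determinant"
begin

section \<open>Hilbert tensor powers and contractions\<close>

text \<open>
  A real separable Hilbert space is a type of class \<open>real_inner\<close> and \<open>polish_space\<close> (complete and
  second countable for the norm topology).

  The Hilbert tensor power of order \<open>q\<close> is realised as the space of Hilbert--Schmidt
  \<open>q\<close>-linear functionals: the elementary tensor of \<open>k\<^sub>1, \<dots>, k\<^sub>q\<close> is the functional sending
  \<open>[h\<^sub>1, \<dots>, h\<^sub>q]\<close> to the product of the inner products of \<open>k\<^sub>i\<close> and \<open>h\<^sub>i\<close>, so the value of a tensor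
  at a list is its inner product with the elementary tensor of that list.
  Functionals take lists as arguments and vanish on lists of the wrong length, so that they are
  equal as functions iff they are equal as tensors. A tensor \<open>T\<close> of order 0 is the scalar \<open>T []\<close>.
\<close>

type_synonym 'h tensor = "'h list \<Rightarrow> real"

definition orthonormal_set :: "'h::real_inner set \<Rightarrow> bool" where
  "orthonormal_set F \<longleftrightarrow> (\<forall>a\<in>F. \<forall>b\<in>F. inner a b = (if a = b then 1 else 0))"

definition orthonormal_basis :: "'h::real_inner set \<Rightarrow> bool" where
  "orthonormal_basis B \<longleftrightarrow> orthonormal_set B \<and> closure (span B) = UNIV"

definition multilinear_form :: "nat \<Rightarrow> 'h::real_inner tensor \<Rightarrow> bool" where
  "multilinear_form q T \<longleftrightarrow>
     (\<forall>hs. length hs \<noteq> q \<longrightarrow> T hs = 0) \<and>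
     (\<forall>hs i. length hs = q \<and> i < q \<longrightarrow> linear (\<lambda>h. T (hs[i := h])))"

definition square_sum :: "nat \<Rightarrow> 'h::real_inner tensor \<Rightarrow> 'h set \<Rightarrow> real" where
  "square_sum q T F = (\<Sum>bs | set bs \<subseteq> F \<and> length bs = q. (T bs)\<^sup>2)"

text \<open>
  The Hilbert--Schmidt norm is written as a supremum over finite orthonormal systems, which agrees
  with the square sum over any orthonormal basis and needs no choice of a basis. Finiteness of the
  supremum also forces boundedness of the multilinear form.
\<close>

definition tensor_power_space :: "nat \<Rightarrow> 'h::real_inner tensor set" where
  "tensor_power_space q =
     {T. multilinear_form q T \<and> bdd_above (square_sum q T ` {F. finite F \<and> orthonormal_set F})}"

definition tensor_norm :: "nat \<Rightarrow> 'h::real_inner tensor \<Rightarrow> real" where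
  "tensor_norm q T = sqrt (SUP F\<in>{F. finite F \<and> orthonormal_set F}. square_sum q T F)"

definition symmetric_tensors :: "nat \<Rightarrow> 'h::real_inner tensor set" where
  "symmetric_tensors q =
     {T \<in> tensor_power_space q. \<forall>hs ks. mset hs = mset ks \<longrightarrow> T hs = T ks}"

definition pure_power :: "nat \<Rightarrow> 'h::real_inner \<Rightarrow> 'h tensor" where
  "pure_power q h = (\<lambda>ks. if length ks = q then \<Prod>i<q. inner h (ks ! i) else 0)"

text \<open>The component \<open>f\<^sub>0\<close> of a packet is the scalar \<open>f 0 []\<close>.\<close>

type_synonym 'h packet = "nat \<Rightarrow> 'h tensor"

definition symmetric_packet :: "nat \<Rightarrow> 'h::real_inner packet \<Rightarrow> bool" where
  "symmetric_packet m f \<longleftrightarrow> (\<forall>q\<le>m. f q \<in> symmetric_tensors q)"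

text \<open>
  Vertices and coordinates are numbered \<open>0, \<dots>, r - 1\<close>. Arrays are functions vanishing outside that
  range, so that the set of arrays is finite.
\<close>

type_synonym array = "nat \<Rightarrow> nat \<Rightarrow> nat"

definition row_sum :: "nat \<Rightarrow> array \<Rightarrow> nat \<Rightarrow> nat" where
  "row_sum r N a = (\<Sum>b\<in>{..<r} - {a}. N a b)"

definition arrays :: "nat \<Rightarrow> nat \<Rightarrow> array set" where
  "arrays r m =
     {N. (\<forall>a b. N a b = N b a) \<and> (\<forall>a. N a a = 0) \<and> (\<forall>a b. r \<le> a \<longrightarrow> N a b = 0) \<and>
         (\<forall>a<r. row_sum r N a \<le> m)}"

text \<open>
  The \<open>N a b\<close> parallel edges joining \<open>a < b\<close> are the triples \<open>(a, b, j)\<close> with \<open>j < N a b\<close>. Every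
  vertex has one tensor leg per incident edge. A contraction labels all edges by vectors of an
  orthonormal basis, evaluates each tensor at the labels of its legs, and sums over the labellings.
\<close>

definition edges :: "nat \<Rightarrow> array \<Rightarrow> (nat \<times> nat \<times> nat) set" where
  "edges r N = {(a, b, j). a < b \<and> b < r \<and> j < N a b}"

definition legs :: "nat \<Rightarrow> array \<Rightarrow> (nat \<times> nat \<times> nat \<Rightarrow> 'h) \<Rightarrow> nat \<Rightarrow> 'h list" where
  "legs r N i a = concat (map (\<lambda>b. map (\<lambda>j. i (min a b, max a b, j)) [0..<N a b]) [0..<r])"

definition contr :: "'h::real_inner set \<Rightarrow> nat \<Rightarrow> array \<Rightarrow> (nat \<Rightarrow> 'h tensor) \<Rightarrow> real" where
  "contr B r N t = (\<Sum>\<^sub>\<infinity>i\<in>(edges r N \<rightarrow>\<^sub>E B). \<Prod>a<r. t a (legs r N i a))"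

definition contr_coeff :: "'h::real_inner set \<Rightarrow> 'h packet \<Rightarrow> nat \<Rightarrow> array \<Rightarrow> real" where
  "contr_coeff B f r N =
     (\<Prod>a<r. fact (row_sum r N a)) / (\<Prod>(a, b)\<in>{(a, b). a < b \<and> b < r}. fact (N a b))
     * contr B r N (\<lambda>a. f (row_sum r N a))"


section \<open>Gaussian canvas, multiple Wiener integrals and canvas processes\<close>

definition centered_gaussian_rv :: "'w measure \<Rightarrow> ('w \<Rightarrow> real) \<Rightarrow> bool" where
  "centered_gaussian_rv M X \<longleftrightarrow>
     X \<in> borel_measurable M \<and>
     ((AE w in M. X w = 0) \<or> (\<exists>\<sigma>>0. distributed M lborel X (normal_density 0 \<sigma>)))"

definition gaussian_canvas :: "'w measure \<Rightarrow> (real \<Rightarrow> 'h::real_inner \<Rightarrow> 'w \<Rightarrow> real) \<Rightarrow> bool" where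
  "gaussian_canvas M W \<longleftrightarrow>
     prob_space M \<and>
     (\<forall>S c. finite S \<longrightarrow> centered_gaussian_rv M (\<lambda>w. \<Sum>(u, h)\<in>S. c (u, h) * W u h w)) \<and>
     (\<forall>u v h k. (\<integral>w. W u h w * W v k w \<partial>M) = exp (- (u - v)\<^sup>2) * inner h k)"

text \<open>Probabilists' Hermite polynomials (leading coefficient 1, orthogonal for the standard normal law).\<close>

fun hermite :: "nat \<Rightarrow> real \<Rightarrow> real" where
  "hermite 0 x = 1"
| "hermite (Suc 0) x = x"
| "hermite (Suc (Suc n)) x = x * hermite (Suc n) x - real (Suc n) * hermite n x"

text \<open>
  For an isonormal process \<open>V\<close>, the \<open>q\<close>th multiple Wiener integral is the continuous linear map from
  symmetric tensors to square-integrable random variables that sends the \<open>q\<close>th tensor power of a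
  unit vector \<open>h\<close> to \<open>hermite q (V h)\<close>. The following predicate says that \<open>X\<close> is a version of the
  integral of \<open>T\<close>: the pair \<open>(T, X)\<close> is a limit, in tensor norm and in mean square, of pairs given by
  finite linear combinations of powers of unit vectors.
\<close>

definition multiple_wiener_integral ::
    "'w measure \<Rightarrow> ('h::real_inner \<Rightarrow> 'w \<Rightarrow> real) \<Rightarrow> nat \<Rightarrow> 'h tensor \<Rightarrow> ('w \<Rightarrow> real) \<Rightarrow> bool" where
  "multiple_wiener_integral M V q T X \<longleftrightarrow>
     X \<in> borel_measurable M \<and> integrable M (\<lambda>w. (X w)\<^sup>2) \<and>
     (\<exists>(S :: nat \<Rightarrow> 'h set) (c :: nat \<Rightarrow> 'h \<Rightarrow> real).
        (\<forall>n. finite (S n) \<and> (\<forall>h\<in>S n. norm h = 1)) \<and>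
        (\<lambda>n. tensor_norm q (\<lambda>ks. T ks - (\<Sum>h\<in>S n. c n h * pure_power q h ks))) \<longlonglongrightarrow> 0 \<and>
        (\<lambda>n. \<integral>w. (X w - (\<Sum>h\<in>S n. c n h * hermite q (V h w)))\<^sup>2 \<partial>M) \<longlonglongrightarrow> 0)"

definition smooth_path :: "(real \<Rightarrow> real) \<Rightarrow> bool" where
  "smooth_path p \<longleftrightarrow> (\<forall>n u. (deriv ^^ n) p differentiable (at u))"

definition canvas_process ::
    "'w measure \<Rightarrow> (real \<Rightarrow> 'h::real_inner \<Rightarrow> 'w \<Rightarrow> real) \<Rightarrow> nat \<Rightarrow> 'h packet
       \<Rightarrow> ('w \<Rightarrow> real \<Rightarrow> real) \<Rightarrow> bool" where
  "canvas_process M W m f Z \<longleftrightarrow>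
     gaussian_canvas M W \<and> symmetric_packet m f \<and>
     (\<forall>u. (\<lambda>w. Z w u) \<in> borel_measurable M) \<and>
     (\<forall>w\<in>space M. smooth_path (Z w)) \<and>
     (\<forall>u. \<exists>X. (\<forall>q\<in>{1..m}. multiple_wiener_integral M (W u) q (f q) (X q)) \<and>
              (AE w in M. Z w u = f 0 [] + (\<Sum>q=1..m. X q w)))"

definition continuous_paths :: "(real \<Rightarrow> real) set" where
  "continuous_paths = {p. continuous_on UNIV p}"

definition locally_uniform_topology :: "(real \<Rightarrow> real) topology" where
  "locally_uniform_topology =
     topology_generated_by
       {{p \<in> continuous_paths. \<forall>t\<in>{-k..k}. \<bar>p t - p0 t\<bar> < e} | p0 k e.
          p0 \<in> continuous_paths \<and> 0 < e}"

definition path_borel :: "(real \<Rightarrow> real) measure" where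
  "path_borel = sigma continuous_paths {U. openin locally_uniform_topology U}"

definition path_law :: "'w measure \<Rightarrow> ('w \<Rightarrow> real \<Rightarrow> real) \<Rightarrow> (real \<Rightarrow> real) measure" where
  "path_law M Z = distr M path_borel Z"

definition moment :: "'w measure \<Rightarrow> ('w \<Rightarrow> real \<Rightarrow> real) \<Rightarrow> nat \<Rightarrow> (nat \<Rightarrow> real) \<Rightarrow> real" where
  "moment M Z r x = (\<integral>w. (\<Prod>a<r. Z w (x a)) \<partial>M)"


section \<open>The centered hyperplane, Laplacians and the Gram matrix\<close>

definition centered_space :: "nat \<Rightarrow> (nat \<Rightarrow> real) set" where
  "centered_space r = {x \<in> extensional {..<r}. (\<Sum>a<r. x a) = 0}"

text \<open>
  The Helmert vectors with indices \<open>k < r - 1\<close> form an orthonormal basis of the centered space. They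
  provide the isometry from \<open>(r-1)\<close>-dimensional Euclidean space that transports Lebesgue measure
  to the centered space, and the basis in which determinants on the centered space are computed;
  neither object depends on the choice of the orthonormal basis.
\<close>

definition helmert :: "nat \<Rightarrow> nat \<Rightarrow> real" where
  "helmert k a =
     (if a \<le> k then 1 else if a = Suc k then - real (Suc k) else 0)
       / sqrt (real (Suc k) * real (Suc (Suc k)))"

lemma helmert_sum_upto:
  assumes "n \<ge> k + 2"
  shows "(\<Sum>a<n. helmert k a) = 0"
proof -
  have low: "(\<Sum>a<Suc k. helmert k a) = real (Suc k) / sqrt (real (Suc k) * real (Suc (Suc k)))"
    by (simp add: helmert_def del: sum.lessThan_Suc of_nat_Suc)
  have "(\<Sum>a<n. helmert k a) = (\<Sum>a<Suc (Suc k). helmert k a)"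
    by (rule sum.mono_neutral_right) (use assms in \<open>auto simp: helmert_def\<close>)
  also have "\<dots> = 0"
    unfolding sum.lessThan_Suc[of _ "Suc k"] low
    by (simp add: helmert_def add_divide_distrib[symmetric])
  finally show ?thesis .
qed

lemma helmert_orthonormal:
  assumes "k < r - 1" "l < r - 1"
  shows "(\<Sum>a<r. helmert k a * helmert l a) = (if k = l then 1 else 0)"
proof -
  have less: "(\<Sum>a<r. helmert k a * helmert l a) = 0" if "k < l" "l < r - 1" for k l
  proof -
    let ?c = "1 / sqrt (real (Suc l) * real (Suc (Suc l)))"
    have "(\<Sum>a<r. helmert k a * helmert l a) = (\<Sum>a<r. helmert k a * ?c)"
      by (rule sum.cong) (use that in \<open>auto simp: helmert_def\<close>)
    also have "\<dots> = (\<Sum>a<r. helmert k a) * ?c"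
      by (rule sum_distrib_right[symmetric])
    also have "\<dots> = 0"
      using helmert_sum_upto[of k r] that by simp
    finally show ?thesis .
  qed
  have eq: "(\<Sum>a<r. helmert k a * helmert k a) = 1" if "k < r - 1"
  proof -
    let ?s = "real (Suc k) * real (Suc (Suc k))"
    have "(\<Sum>a<Suc k. helmert k a * helmert k a) = (\<Sum>a<Suc k. 1 / ?s)"
      by (rule sum.cong) (auto simp: helmert_def)
    hence low: "(\<Sum>a<Suc k. helmert k a * helmert k a) = real (Suc k) / ?s"
      by (simp del: sum.lessThan_Suc of_nat_Suc)
    have top: "helmert k (Suc k) * helmert k (Suc k) = (real (Suc k))\<^sup>2 / ?s"
      by (simp add: helmert_def power2_eq_square del: of_nat_Suc)
    have "(\<Sum>a<r. helmert k a * helmert k a) = (\<Sum>a<Suc (Suc k). helmert k a * helmert k a)"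
      by (rule sum.mono_neutral_right) (use that in \<open>auto simp: helmert_def\<close>)
    also have "\<dots> = real (Suc k) / ?s + (real (Suc k))\<^sup>2 / ?s"
      unfolding sum.lessThan_Suc[of _ "Suc k"] low top ..
    also have "\<dots> = (real (Suc k) + (real (Suc k))\<^sup>2) / ?s"
      by (rule add_divide_distrib[symmetric])
    also have "real (Suc k) + (real (Suc k))\<^sup>2 = ?s"
      by (simp add: power2_eq_square algebra_simps)
    also have "?s / ?s = 1"
      by (rule divide_self) (simp del: of_nat_Suc)
    finally show ?thesis .
  qed
  show ?thesis
    using less[of k l] less[of l k] eq assms
    by (cases k l rule: linorder_cases) (auto simp: mult.commute)
qed

definition centered_lebesgue :: "nat \<Rightarrow> (nat \<Rightarrow> real) measure" where
  "centered_lebesgue r =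
     distr (PiM {..<r - 1} (\<lambda>_. lborel))
       (restrict_space (PiM {..<r} (\<lambda>_. borel)) (centered_space r))
       (\<lambda>z. \<lambda>a\<in>{..<r}. \<Sum>k<r - 1. z k * helmert k a)"

definition centered_gauss :: "nat \<Rightarrow> (nat \<Rightarrow> real) measure" where
  "centered_gauss r =
     density (centered_lebesgue r)
       (\<lambda>x. ennreal (pi powr (- (real r - 1) / 2) * exp (- (\<Sum>a<r. (x a)\<^sup>2))))"

definition centered_det :: "nat \<Rightarrow> (nat \<Rightarrow> nat \<Rightarrow> real) \<Rightarrow> real" where
  "centered_det r A =
     Determinant.det (Matrix.mat (r - 1) (r - 1)
       (\<lambda>(k, l). \<Sum>a<r. \<Sum>b<r. helmert k a * A a b * helmert l b))"

definition laplacian :: "nat \<Rightarrow> array \<Rightarrow> nat \<Rightarrow> nat \<Rightarrow> real" where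
  "laplacian r N a b = (if a = b then real (row_sum r N a) else - real (N a b))"

definition chi :: "nat \<Rightarrow> array \<Rightarrow> (nat \<Rightarrow> real) \<Rightarrow> real" where
  "chi r N x = exp (- (\<Sum>a<r. \<Sum>b<r. x a * laplacian r N a b * x b))"

definition gram :: "nat \<Rightarrow> array \<Rightarrow> array \<Rightarrow> real" where
  "gram r N N' = (\<integral>x. chi r N x * chi r N' x \<partial>centered_gauss r)"

definition moment_vec ::
    "'w measure \<Rightarrow> ('w \<Rightarrow> real \<Rightarrow> real) \<Rightarrow> nat \<Rightarrow> array \<Rightarrow> real" where
  "moment_vec M Z r N' = (\<integral>x. moment M Z r x * chi r N' x \<partial>centered_gauss r)"

text \<open>Real square matrices indexed by a finite set.\<close>

definition pos_def_on :: "'i set \<Rightarrow> ('i \<Rightarrow> 'i \<Rightarrow> real) \<Rightarrow> bool" where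
  "pos_def_on I G \<longleftrightarrow>
     (\<forall>i\<in>I. \<forall>j\<in>I. G i j = G j i) \<and>
     (\<forall>v. (\<exists>i\<in>I. v i \<noteq> 0) \<longrightarrow> 0 < (\<Sum>i\<in>I. \<Sum>j\<in>I. v i * G i j * v j))"

definition inverse_matrix_on :: "'i set \<Rightarrow> ('i \<Rightarrow> 'i \<Rightarrow> real) \<Rightarrow> ('i \<Rightarrow> 'i \<Rightarrow> real) \<Rightarrow> bool" where
  "inverse_matrix_on I G H \<longleftrightarrow>
     (\<forall>i\<in>I. \<forall>j\<in>I. (\<Sum>k\<in>I. G i k * H k j) = (if i = j then 1 else 0) \<and>
                   (\<Sum>k\<in>I. H i k * G k j) = (if i = j then 1 else 0))"

end

theory Submission
  imports Defs
begin

text \<open>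
  For finite linear combinations of powers of unit vectors the moment expansion is the diagram
  formula for products of Hermite polynomials of jointly Gaussian variables, obtained from Gaussian
  integration by parts; on the tensor side, Parseval's identity turns contractions of powers into
  products of inner products. Cauchy--Schwarz along the edges bounds a contraction by the product of
  the tensor norms, so both sides pass to the limit: the diagram formula with every vertex doubled
  bounds the second moments of the approximating products, which is the uniform integrability
  needed for convergence of the expectations.

  The functions \<open>chi r N\<close> are exponentials of distinct quadratic forms. Along a ray through a point
  that separates the forms they are exponentials with distinct rates, hence linearly independent, so
  their Gram matrix is positive definite and the coefficients are recovered from the moments. The
  moments are integrals of products of evaluations, which are Borel on path space.
\<close>

section \<open>Contractions of tensors\<close>

text \<open>Joint Gaussianity is given through finite linear combinations only, so the whole
  Gaussian input is the one-dimensional moment formula: the moments of \<open>L + e * Y\<close> are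
  polynomials in \<open>e\<close>, and their derivatives at 0 yield integration by parts.
  Mean-square convergence of the factors does not carry over to expectations of products of
  \<open>r\<close> factors; this is why second moments of entire products have to be bounded, and
  the bound is drawn from the convergence of the doubled diagram sum on the tensor side.
  Contractions are infinite sums over a basis. The estimates run over finite orthonormal systems
  with a uniform bound, which provides absolute convergence and continuity at once. Positive
  definiteness concerns a measure on the centered space, whereas polarization uses coordinate
  vectors, which are not centered. Continuity removes null sets, and translation invariance of
  \<open>chi\<close> connects the two spaces. Equal laws give equal integrals once the processes are
  measurable into path space, which rests on the second countability of that space.\<close>

lemma has_sum_sum:
  fixes f :: "'x \<Rightarrow> 'a \<Rightarrow> real"
  assumes "\<And>x. x \<in> X \<Longrightarrow> (f x has_sum s x) A"
  shows "((\<lambda>i. \<Sum>x\<in>X. f x i) has_sum (\<Sum>x\<in>X. s x)) A"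
  using assms by (induction X rule: infinite_finite_induct) (auto intro: has_sum_add)

lemma sum_PiE_insert:
  fixes g :: "('e \<Rightarrow> 'h) \<Rightarrow> real"
  assumes "e \<notin> E"
  shows "(\<Sum>i\<in>PiE (insert e E) (\<lambda>_. F). g i) = (\<Sum>i\<in>PiE E (\<lambda>_. F). \<Sum>x\<in>F. g (i(e := x)))"
proof -
  have eq: "PiE (insert e E) (\<lambda>_. F) = (\<lambda>(i, x). i(e := x)) ` (PiE E (\<lambda>_. F) \<times> F)"
    unfolding PiE_insert_eq by (subst swap_product [symmetric]) (simp add: image_image case_prod_unfold)
  have inj: "inj_on (\<lambda>(i, x). i(e := x)) (PiE E (\<lambda>_. F) \<times> F)"
    using assms by (rule inj_combinator')
  show ?thesis
    unfolding eq sum.reindex[OF inj] by (simp add: sum.cartesian_product case_prod_unfold)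
qed

text \<open>Cauchy--Schwarz is applied to one edge at a time.\<close>

lemma graph_cauchy_schwarz:
  fixes G :: "'v \<Rightarrow> ('e \<Rightarrow> 'h) \<Rightarrow> real"
  assumes "finite E" "finite V" "finite F"
    and "\<And>e. e \<in> E \<Longrightarrow> s e \<in> V \<and> t e \<in> V \<and> s e \<noteq> t e"
    and "\<And>a i. a \<in> V \<Longrightarrow> 0 \<le> G a i"
    and "\<And>a i j. a \<in> V \<Longrightarrow> (\<And>e. e \<in> E \<Longrightarrow> a \<in> {s e, t e} \<Longrightarrow> i e = j e) \<Longrightarrow> G a i = G a j"
  shows "(\<Sum>i\<in>PiE E (\<lambda>_. F). \<Prod>a\<in>V. G a i)
    \<le> (\<Prod>a\<in>V. sqrt (\<Sum>i\<in>PiE {e \<in> E. a \<in> {s e, t e}} (\<lambda>_. F). (G a i)\<^sup>2))"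
  using assms(1,4-6)
proof (induction E arbitrary: G rule: finite_induct)
  case empty
  have "(\<Prod>a\<in>V. G a (\<lambda>_. undefined)) = (\<Prod>a\<in>V. sqrt ((G a (\<lambda>_. undefined))\<^sup>2))"
    by (rule prod.cong) (use empty(2) in auto)
  then show ?case by simp
next
  case (insert e E)
  define p q where "p = s e" and "q = t e"
  have pq: "p \<in> V" "q \<in> V" "p \<noteq> q"
    using insert.prems(1)[of e] by (auto simp: p_def q_def)
  \<comment> \<open>The label of \<open>e\<close> is summed out in the L2 sense at its two ends
    \<open>p\<close> and \<open>q\<close>; no other vertex sees it. The new family lives on the
    graph without \<open>e\<close>, which is why the induction keeps \<open>G\<close>
    arbitrary.\<close>
  define H where "H a i = (if a \<in> {p, q} then sqrt (\<Sum>x\<in>F. (G a (i(e := x)))\<^sup>2) else G a i)" for a i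
  have nonneg: "0 \<le> G a i" if "a \<in> V" for a i
    using insert.prems(2) that by blast
  have away: "G a (i(e := x)) = G a i" if "a \<in> V" "a \<notin> {p, q}" for a i x
    by (rule insert.prems(3)) (use that in \<open>auto simp: p_def q_def\<close>)
  have split: "(\<Prod>a\<in>V. K a) = K p * K q * (\<Prod>a\<in>V - {p, q}. K a)" for K :: "'v \<Rightarrow> real"
    using pq \<open>finite V\<close> prod.subset_diff[of "{p, q}" V K] by (auto simp: mult.commute)
  have step: "(\<Sum>x\<in>F. \<Prod>a\<in>V. G a (i(e := x))) \<le> (\<Prod>a\<in>V. H a i)" for i
  proof -
    have "(\<Sum>x\<in>F. \<Prod>a\<in>V. G a (i(e := x)))
        = (\<Sum>x\<in>F. G p (i(e := x)) * G q (i(e := x)) * (\<Prod>a\<in>V - {p, q}. G a i))"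
      unfolding split by (intro sum.cong refl arg_cong2[where f = "(*)"] prod.cong) (auto intro: away)
    also have "\<dots> = (\<Sum>x\<in>F. \<bar>G p (i(e := x))\<bar> * \<bar>G q (i(e := x))\<bar>) * (\<Prod>a\<in>V - {p, q}. G a i)"
      using pq by (simp add: sum_distrib_right nonneg)
    also have "\<dots> \<le> (L2_set (\<lambda>x. G p (i(e := x))) F * L2_set (\<lambda>x. G q (i(e := x))) F)
        * (\<Prod>a\<in>V - {p, q}. G a i)"
      by (intro mult_right_mono L2_set_mult_ineq prod_nonneg) (auto intro: nonneg)
    also have "\<dots> = (\<Prod>a\<in>V. H a i)"
      unfolding split using pq by (auto simp: H_def L2_set_def intro!: prod.cong)
    finally show ?thesis .
  qed
  have inc: "{d \<in> insert e E. a \<in> {s d, t d}} = insert e {d \<in> E. a \<in> {s d, t d}}" if "a \<in> {p, q}" for a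
    using that by (auto simp: p_def q_def)
  have "(\<Sum>i\<in>PiE (insert e E) (\<lambda>_. F). \<Prod>a\<in>V. G a i)
      = (\<Sum>i\<in>PiE E (\<lambda>_. F). \<Sum>x\<in>F. \<Prod>a\<in>V. G a (i(e := x)))"
    using insert.hyps(2) by (rule sum_PiE_insert)
  also have "\<dots> \<le> (\<Sum>i\<in>PiE E (\<lambda>_. F). \<Prod>a\<in>V. H a i)"
    by (intro sum_mono step)
  also have "\<dots> \<le> (\<Prod>a\<in>V. sqrt (\<Sum>i\<in>PiE {d \<in> E. a \<in> {s d, t d}} (\<lambda>_. F). (H a i)\<^sup>2))"
  proof (rule insert.IH)
    show "H a i = H a j" if "a \<in> V" and "\<And>d. d \<in> E \<Longrightarrow> a \<in> {s d, t d} \<Longrightarrow> i d = j d" for a i j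
    proof (cases "a \<in> {p, q}")
      case True
      have "G a (i(e := x)) = G a (j(e := x))" for x
        by (rule insert.prems(3)) (use that in auto)
      then show ?thesis using True by (auto simp: H_def)
    next
      case False
      have "G a i = G a j"
        by (rule insert.prems(3)) (use that False in \<open>auto simp: p_def q_def\<close>)
      then show ?thesis using False by (auto simp: H_def)
    qed
  qed (use insert.prems(1) in \<open>auto simp: H_def nonneg sum_nonneg\<close>)
  also have "\<dots> = (\<Prod>a\<in>V. sqrt (\<Sum>i\<in>PiE {d \<in> insert e E. a \<in> {s d, t d}} (\<lambda>_. F). (G a i)\<^sup>2))"
  proof (rule prod.cong[OF refl])
    fix a assume "a \<in> V"
    show "sqrt (\<Sum>i\<in>PiE {d \<in> E. a \<in> {s d, t d}} (\<lambda>_. F). (H a i)\<^sup>2)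
      = sqrt (\<Sum>i\<in>PiE {d \<in> insert e E. a \<in> {s d, t d}} (\<lambda>_. F). (G a i)\<^sup>2)"
    proof (cases "a \<in> {p, q}")
      case True
      show ?thesis
        unfolding inc[OF True]
        by (subst sum_PiE_insert) (use True insert.hyps in \<open>auto simp: H_def sum_nonneg\<close>)
    next
      case False
      then have "{d \<in> insert e E. a \<in> {s d, t d}} = {d \<in> E. a \<in> {s d, t d}}"
        by (auto simp: p_def q_def)
      then show ?thesis using False by (simp add: H_def)
    qed
  qed
  finally show ?case .
qed

definition loopfree :: "nat \<Rightarrow> array \<Rightarrow> bool" where
  "loopfree r N \<longleftrightarrow> (\<forall>a b. N a b = N b a) \<and> (\<forall>a. N a a = 0) \<and> (\<forall>a b. r \<le> a \<longrightarrow> N a b = 0)"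

text \<open>The unlabelled form of \<open>legs\<close>: a labelling then acts by \<open>map\<close>,
  and questions about legs become questions about a distinct list of edges.\<close>

definition leg_list :: "nat \<Rightarrow> array \<Rightarrow> nat \<Rightarrow> (nat \<times> nat \<times> nat) list" where
  "leg_list r N a = concat (map (\<lambda>b. map (\<lambda>j. (min a b, max a b, j)) [0..<N a b]) [0..<r])"

lemma legs_eq: "legs r N i a = map i (leg_list r N a)"
  by (simp add: legs_def leg_list_def map_concat comp_def)

lemma length_leg_list:
  assumes "loopfree r N" "a < r"
  shows "length (leg_list r N a) = row_sum r N a"
proof -
  have "length (leg_list r N a) = (\<Sum>b<r. N a b)"
    by (simp add: leg_list_def length_concat comp_def interv_sum_list_conv_sum_set_nat lessThan_atLeast0)
  also have "\<dots> = row_sum r N a"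
    unfolding row_sum_def by (rule sum.mono_neutral_right) (use assms in \<open>auto simp: loopfree_def\<close>)
  finally show ?thesis .
qed

lemma set_leg_list:
  assumes "loopfree r N" "a < r"
  shows "set (leg_list r N a) = {e \<in> edges r N. a \<in> {fst e, fst (snd e)}}"
proof -
  have sym: "N x y = N y x" "N x x = 0" for x y
    using assms by (auto simp: loopfree_def)
  show ?thesis
  proof (intro equalityI subsetI)
    fix e assume "e \<in> set (leg_list r N a)"
    then obtain b j where *: "e = (min a b, max a b, j)" "b < r" "j < N a b"
      by (auto simp: leg_list_def)
    then have "a \<noteq> b" using sym by (metis less_nat_zero_code)
    then show "e \<in> {e \<in> edges r N. a \<in> {fst e, fst (snd e)}}"
      using * assms sym by (auto simp: edges_def min_def max_def)
  next
    fix e assume e: "e \<in> {e \<in> edges r N. a \<in> {fst e, fst (snd e)}}"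
    obtain x y j where [simp]: "e = (x, y, j)" by (cases e)
    from e have "x < y" "y < r" "j < N x y" "a = x \<or> a = y"
      by (auto simp: edges_def)
    then show "e \<in> set (leg_list r N a)"
      unfolding leg_list_def
      by (auto simp: sym(1)[of y x] intro!: bexI[of _ "if a = x then y else x"])
  qed
qed

lemma distinct_leg_list: "distinct (leg_list r N a)"
proof -
  have "distinct (concat (map (\<lambda>b. map (\<lambda>j. (min a b, max a b, j)) [0..<N a b]) bs))" if "distinct bs" for bs
    using that
  proof (induction bs)
    case (Cons b bs)
    have "set (map (\<lambda>j. (min a b, max a b, j)) [0..<N a b]) \<inter>
        set (concat (map (\<lambda>b. map (\<lambda>j. (min a b, max a b, j)) [0..<N a b]) bs)) = {}"
      using Cons.prems by (auto simp: min_def max_def split: if_splits)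
    then show ?case
      using Cons by (auto simp: distinct_map inj_on_def)
  qed simp
  then show ?thesis unfolding leg_list_def by simp
qed

lemma finite_edges: "finite (edges r N)"
proof (rule finite_subset)
  show "edges r N \<subseteq> (\<Union>a<r. \<Union>b<r. (\<lambda>j. (a, b, j)) ` {..<N a b})"
  proof
    fix e assume "e \<in> edges r N"
    then obtain a b j where "e = (a, b, j)" "a < r" "b < r" "j < N a b"
      by (auto simp: edges_def)
    then show "e \<in> (\<Union>a<r. \<Union>b<r. (\<lambda>j. (a, b, j)) ` {..<N a b})" by blast
  qed
qed auto

text \<open>The finiteness half of \<open>tensor_power_space\<close>, stated alone because it passes
  to sums, multiples and differences by pointwise estimates.\<close>

definition hs_bounded :: "nat \<Rightarrow> 'h::real_inner tensor \<Rightarrow> bool" where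
  "hs_bounded q T \<longleftrightarrow> bdd_above (square_sum q T ` {F. finite F \<and> orthonormal_set F})"

lemma orthonormal_set_empty: "orthonormal_set {}"
  by (simp add: orthonormal_set_def)

lemma sqrt_square_sum_le:
  assumes "hs_bounded q T" "finite F" "orthonormal_set F"
  shows "sqrt (square_sum q T F) \<le> tensor_norm q T"
  unfolding tensor_norm_def
  by (rule real_sqrt_le_mono, rule cSUP_upper) (use assms in \<open>auto simp: hs_bounded_def\<close>)

lemma finite_bounded_lists: "finite F \<Longrightarrow> finite {bs. set bs \<subseteq> F \<and> length bs = q}"
  by (rule finite_lists_length_eq)

lemma hs_bounded_add:
  assumes "hs_bounded q S" "hs_bounded q T"
  shows "hs_bounded q (\<lambda>ks. S ks + T ks)"
proof -
  obtain c d where c: "\<And>F. finite F \<Longrightarrow> orthonormal_set F \<Longrightarrow> square_sum q S F \<le> c"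
    and d: "\<And>F. finite F \<Longrightarrow> orthonormal_set F \<Longrightarrow> square_sum q T F \<le> d"
    using assms by (auto simp: hs_bounded_def bdd_above_def)
  have *: "(x + y)\<^sup>2 \<le> 2 * x\<^sup>2 + 2 * y\<^sup>2" for x y :: real
    using sum_squares_bound[of x y] by (simp add: power2_sum)
  have "square_sum q (\<lambda>ks. S ks + T ks) F \<le> 2 * c + 2 * d" if "finite F" "orthonormal_set F" for F
  proof -
    have "square_sum q (\<lambda>ks. S ks + T ks) F \<le> 2 * square_sum q S F + 2 * square_sum q T F"
      unfolding square_sum_def sum_distrib_left sum.distrib[symmetric] by (intro sum_mono *)
    then show ?thesis using c[OF that] d[OF that] by linarith
  qed
  then show ?thesis unfolding hs_bounded_def by (intro bdd_aboveI) auto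
qed

lemma square_sum_scale: "square_sum q (\<lambda>ks. c * T ks) F = c\<^sup>2 * square_sum q T F"
  by (simp add: square_sum_def sum_distrib_left power_mult_distrib)

lemma hs_bounded_scale:
  assumes "hs_bounded q T"
  shows "hs_bounded q (\<lambda>ks. c * T ks)"
proof -
  obtain d where d: "\<And>F. finite F \<Longrightarrow> orthonormal_set F \<Longrightarrow> square_sum q T F \<le> d"
    using assms by (auto simp: hs_bounded_def bdd_above_def)
  have "square_sum q (\<lambda>ks. c * T ks) F \<le> c\<^sup>2 * d" if "finite F" "orthonormal_set F" for F
    unfolding square_sum_scale using d[OF that] by (simp add: mult_left_mono)
  then show ?thesis unfolding hs_bounded_def by (intro bdd_aboveI) auto
qed

lemma hs_bounded_sum:
  assumes "\<And>h. h \<in> S \<Longrightarrow> hs_bounded q (T h)"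
  shows "hs_bounded q (\<lambda>ks. \<Sum>h\<in>S. T h ks)"
proof -
  have zero: "hs_bounded q (\<lambda>ks. 0)"
    by (auto simp: hs_bounded_def square_sum_def intro!: bdd_aboveI)
  show ?thesis
  proof (cases "finite S")
    case True
    then show ?thesis using assms
      by (induction S rule: finite_induct) (auto intro: zero hs_bounded_add)
  qed (simp add: zero)
qed

text \<open>The legs at a vertex exhaust its incident edges, so reading a labelling of these edges
  as a list is injective; the sum on the left runs over some of the lists counted by
  \<open>square_sum\<close>.\<close>

lemma sum_legs_le:
  assumes "loopfree r N" "a < r" "finite F"
  shows "(\<Sum>i\<in>PiE {e \<in> edges r N. a \<in> {fst e, fst (snd e)}} (\<lambda>_. F). (T (legs r N i a))\<^sup>2)
    \<le> square_sum (row_sum r N a) T F"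
proof -
  let ?E = "{e \<in> edges r N. a \<in> {fst e, fst (snd e)}}"
  let ?m = "\<lambda>i. map i (leg_list r N a)"
  have inj: "inj_on ?m (PiE ?E (\<lambda>_. F))"
  proof (rule inj_onI)
    fix i j assume *: "i \<in> PiE ?E (\<lambda>_. F)" "j \<in> PiE ?E (\<lambda>_. F)" "?m i = ?m j"
    show "i = j"
      by (rule PiE_ext[OF *(1,2)]) (use *(3) set_leg_list[OF assms(1,2)] in auto)
  qed
  have "(\<Sum>i\<in>PiE ?E (\<lambda>_. F). (T (legs r N i a))\<^sup>2) = (\<Sum>bs\<in>?m ` PiE ?E (\<lambda>_. F). (T bs)\<^sup>2)"
    unfolding sum.reindex[OF inj] by (simp add: legs_eq)
  also have "\<dots> \<le> square_sum (row_sum r N a) T F"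
    unfolding square_sum_def
  proof (rule sum_mono2)
    show "?m ` PiE ?E (\<lambda>_. F) \<subseteq> {bs. set bs \<subseteq> F \<and> length bs = row_sum r N a}"
      using set_leg_list[OF assms(1,2)] length_leg_list[OF assms(1,2)] by fastforce
  qed (auto intro: finite_bounded_lists assms)
  finally show ?thesis .
qed

text \<open>Graph Cauchy--Schwarz with the tensors at the vertices. The bound does not depend on
  \<open>F\<close>, which later allows labels from an infinite basis.\<close>

lemma sum_labellings_le:
  assumes N: "loopfree r N" and F: "finite F" "orthonormal_set F"
    and bdd: "\<And>a. a < r \<Longrightarrow> hs_bounded (row_sum r N a) (t a)"
  shows "(\<Sum>i\<in>PiE (edges r N) (\<lambda>_. F). \<bar>\<Prod>a<r. t a (legs r N i a)\<bar>)
    \<le> (\<Prod>a<r. tensor_norm (row_sum r N a) (t a))"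
proof -
  have "(\<Sum>i\<in>PiE (edges r N) (\<lambda>_. F). \<bar>\<Prod>a<r. t a (legs r N i a)\<bar>)
      = (\<Sum>i\<in>PiE (edges r N) (\<lambda>_. F). \<Prod>a<r. \<bar>t a (legs r N i a)\<bar>)"
    by (simp add: abs_prod)
  also have "\<dots> \<le> (\<Prod>a<r. sqrt (\<Sum>i\<in>PiE {e \<in> edges r N. a \<in> {fst e, fst (snd e)}} (\<lambda>_. F).
      \<bar>t a (legs r N i a)\<bar>\<^sup>2))"
  proof (rule graph_cauchy_schwarz)
    fix a and i j :: "nat \<times> nat \<times> nat \<Rightarrow> 'a"
    assume a: "a \<in> {..<r}" and "\<And>e. e \<in> edges r N \<Longrightarrow> a \<in> {fst e, fst (snd e)} \<Longrightarrow> i e = j e"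
    then have "legs r N i a = legs r N j a"
      unfolding legs_eq by (intro map_cong refl) (use set_leg_list[OF N, of a] in auto)
    then show "\<bar>t a (legs r N i a)\<bar> = \<bar>t a (legs r N j a)\<bar>" by simp
  qed (use F finite_edges in \<open>auto simp: edges_def\<close>)
  also have "\<dots> \<le> (\<Prod>a<r. tensor_norm (row_sum r N a) (t a))"
  proof (intro prod_mono conjI)
    fix a assume "a \<in> {..<r}"
    then have a: "a < r" by simp
    have "sqrt (\<Sum>i\<in>PiE {e \<in> edges r N. a \<in> {fst e, fst (snd e)}} (\<lambda>_. F). \<bar>t a (legs r N i a)\<bar>\<^sup>2)
        \<le> sqrt (square_sum (row_sum r N a) (t a) F)"
      unfolding power2_abs by (intro real_sqrt_le_mono sum_legs_le N a F)
    also have "\<dots> \<le> tensor_norm (row_sum r N a) (t a)"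
      by (intro sqrt_square_sum_le bdd a F)
    finally show "sqrt (\<Sum>i\<in>PiE {e \<in> edges r N. a \<in> {fst e, fst (snd e)}} (\<lambda>_. F). \<bar>t a (legs r N i a)\<bar>\<^sup>2)
      \<le> tensor_norm (row_sum r N a) (t a)" .
  qed (auto intro: sum_nonneg)
  finally show ?thesis .
qed

lemma orthonormal_set_subset: "orthonormal_set B \<Longrightarrow> F \<subseteq> B \<Longrightarrow> orthonormal_set F"
  unfolding orthonormal_set_def by (meson subsetD)

context
  fixes B :: "'h::real_inner set" and r :: nat and N :: array
  assumes B: "orthonormal_set B" and N: "loopfree r N"
begin

lemma finite_labellings_bound:
  assumes bdd: "\<And>a. a < r \<Longrightarrow> hs_bounded (row_sum r N a) (t a)"
    and P: "finite P" "P \<subseteq> PiE (edges r N) (\<lambda>_. B)"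
  shows "(\<Sum>i\<in>P. \<bar>\<Prod>a<r. t a (legs r N i a)\<bar>) \<le> (\<Prod>a<r. tensor_norm (row_sum r N a) (t a))"
proof -
  \<comment> \<open>Finitely many labellings of finitely many edges use finitely many basis vectors,
    so they lie among all labellings by one finite orthonormal system.\<close>
  define F where "F = (\<Union>i\<in>P. i ` edges r N)"
  have F: "finite F" "F \<subseteq> B"
    using P by (auto simp: F_def finite_edges)
  have sub: "P \<subseteq> PiE (edges r N) (\<lambda>_. F)"
  proof
    fix i assume "i \<in> P"
    then have "i \<in> extensional (edges r N)" "i ` edges r N \<subseteq> F"
      using P(2) by (auto simp: F_def PiE_def)
    then show "i \<in> PiE (edges r N) (\<lambda>_. F)"
      unfolding PiE_def Pi_def by blast
  qed
  have "(\<Sum>i\<in>P. \<bar>\<Prod>a<r. t a (legs r N i a)\<bar>)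
      \<le> (\<Sum>i\<in>PiE (edges r N) (\<lambda>_. F). \<bar>\<Prod>a<r. t a (legs r N i a)\<bar>)"
    by (rule sum_mono2) (use sub F in \<open>auto simp: finite_edges intro!: finite_PiE\<close>)
  also have "\<dots> \<le> (\<Prod>a<r. tensor_norm (row_sum r N a) (t a))"
    by (rule sum_labellings_le) (use F B N bdd in \<open>auto intro: orthonormal_set_subset\<close>)
  finally show ?thesis .
qed

lemma contr_summable:
  assumes "\<And>a. a < r \<Longrightarrow> hs_bounded (row_sum r N a) (t a)"
  shows "(\<lambda>i. norm (\<Prod>a<r. t a (legs r N i a))) summable_on PiE (edges r N) (\<lambda>_. B)"
  by (rule nonneg_bdd_above_summable_on)
    (use finite_labellings_bound[OF assms] in \<open>auto intro!: bdd_aboveI\<close>)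

lemma abs_contr_le:
  assumes "\<And>a. a < r \<Longrightarrow> hs_bounded (row_sum r N a) (t a)"
  shows "\<bar>contr B r N t\<bar> \<le> (\<Prod>a<r. tensor_norm (row_sum r N a) (t a))"
proof -
  have "\<bar>contr B r N t\<bar> \<le> (\<Sum>\<^sub>\<infinity>i\<in>PiE (edges r N) (\<lambda>_. B). \<bar>\<Prod>a<r. t a (legs r N i a)\<bar>)"
    unfolding contr_def using norm_infsum_bound[OF contr_summable[of t]] assms by simp
  also have "\<dots> \<le> (\<Prod>a<r. tensor_norm (row_sum r N a) (t a))"
    by (rule infsum_le_finite_sums)
      (use contr_summable[of t] assms finite_labellings_bound[OF assms] in auto)
  finally show ?thesis .
qed

text \<open>Exchanging the finite sum with the sum over labellings requires each term to be
  summable, which the norm bound supplies. The expansion is assumed labelling by labelling, so that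
  any expansion of the product over the vertices can be fed in.\<close>

lemma contr_sum:
  assumes "\<And>x a. x \<in> X \<Longrightarrow> a < r \<Longrightarrow> hs_bounded (row_sum r N a) (T x a)"
    and "\<And>i. i \<in> PiE (edges r N) (\<lambda>_. B) \<Longrightarrow>
      (\<Prod>a<r. t a (legs r N i a)) = (\<Sum>x\<in>X. c x * (\<Prod>a<r. T x a (legs r N i a)))"
  shows "contr B r N t = (\<Sum>x\<in>X. c x * contr B r N (T x))"
proof -
  have s: "(\<lambda>i. \<Prod>a<r. T x a (legs r N i a)) summable_on PiE (edges r N) (\<lambda>_. B)" if "x \<in> X" for x
    by (rule abs_summable_summable) (use contr_summable[of "T x"] assms(1)[OF that] in blast)
  have "contr B r N t = (\<Sum>\<^sub>\<infinity>i\<in>PiE (edges r N) (\<lambda>_. B). \<Sum>x\<in>X. c x * (\<Prod>a<r. T x a (legs r N i a)))"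
    unfolding contr_def by (rule infsum_cong) (rule assms(2))
  also have "\<dots> = (\<Sum>x\<in>X. \<Sum>\<^sub>\<infinity>i\<in>PiE (edges r N) (\<lambda>_. B). c x * (\<Prod>a<r. T x a (legs r N i a)))"
  proof (rule infsumI, rule has_sum_sum)
    show "((\<lambda>i. c x * (\<Prod>a<r. T x a (legs r N i a))) has_sum
        (\<Sum>\<^sub>\<infinity>i\<in>PiE (edges r N) (\<lambda>_. B). c x * (\<Prod>a<r. T x a (legs r N i a))))
        (PiE (edges r N) (\<lambda>_. B))" if "x \<in> X" for x
      by (intro has_sum_infsum summable_on_cmult_right s that)
  qed
  also have "\<dots> = (\<Sum>x\<in>X. c x * contr B r N (T x))"
    unfolding contr_def by (intro sum.cong refl infsum_cmult_right s)
  finally show ?thesis .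
qed

lemma contr_multilinear:
  assumes "\<And>a. a < r \<Longrightarrow> finite (S a)"
    and "\<And>a h. a < r \<Longrightarrow> h \<in> S a \<Longrightarrow> hs_bounded (row_sum r N a) (P a h)"
  shows "contr B r N (\<lambda>a ks. \<Sum>h\<in>S a. c a h * P a h ks)
    = (\<Sum>\<eta>\<in>PiE {..<r} S. (\<Prod>a<r. c a (\<eta> a)) * contr B r N (\<lambda>a. P a (\<eta> a)))"
proof (rule contr_sum)
  fix i
  have "(\<Prod>a<r. \<Sum>h\<in>S a. c a h * P a h (legs r N i a))
      = (\<Sum>\<eta>\<in>PiE {..<r} S. \<Prod>a<r. c a (\<eta> a) * P a (\<eta> a) (legs r N i a))"
    by (rule prod_sum_PiE) (use assms in auto)
  then show "(\<Prod>a<r. \<Sum>h\<in>S a. c a h * P a h (legs r N i a))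
      = (\<Sum>\<eta>\<in>PiE {..<r} S. (\<Prod>a<r. c a (\<eta> a)) * (\<Prod>a<r. P a (\<eta> a) (legs r N i a)))"
    by (simp add: prod.distrib)
qed (use assms(2) in \<open>auto simp: PiE_iff\<close>)

text \<open>A multilinear map bounded by the product of the norms is jointly continuous: write each
  \<open>s n a\<close> as \<open>t a\<close> plus an error and expand over the set \<open>A\<close>
  of vertices that keep \<open>t\<close>; every term with an error factor tends to 0.\<close>

lemma contr_tendsto:
  assumes t: "\<And>a. a < r \<Longrightarrow> hs_bounded (row_sum r N a) (t a)"
    and s: "\<And>n a. a < r \<Longrightarrow> hs_bounded (row_sum r N a) (s n a)"
    and lim: "\<And>a. a < r \<Longrightarrow> (\<lambda>n. tensor_norm (row_sum r N a) (\<lambda>ks. t a ks - s n a ks)) \<longlonglongrightarrow> 0"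
  shows "(\<lambda>n. contr B r N (s n)) \<longlonglongrightarrow> contr B r N t"
proof -
  \<comment> \<open>The error \<open>s n a - t a\<close>, written as a multiple by -1 so that its
    norm is visibly that of the difference in \<open>lim\<close>.\<close>
  define d where "d n a ks = - 1 * (t a ks - s n a ks)" for n a ks
  have diff: "hs_bounded (row_sum r N a) (\<lambda>ks. t a ks - s n a ks)" if "a < r" for a n
    using hs_bounded_add[OF t[OF that] hs_bounded_scale[OF s[OF that], of "-1"]] by simp
  have d: "hs_bounded (row_sum r N a) (d n a)" if "a < r" for a n
    unfolding d_def by (intro hs_bounded_scale diff that)
  have norm_d: "tensor_norm q (d n a) = tensor_norm q (\<lambda>ks. t a ks - s n a ks)" for q n a
    unfolding d_def tensor_norm_def square_sum_scale by simp
  define mix where "mix n A a = (if a \<in> A then t a else d n a)" for n A a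
  have mix: "hs_bounded (row_sum r N a) (mix n A a)" if "a < r" for n A a
    using that by (simp add: mix_def t d)
  have expand: "contr B r N (s n) = (\<Sum>A\<in>Pow {..<r}. 1 * contr B r N (mix n A))" for n
  proof (rule contr_sum)
    fix i
    have "(\<Prod>a<r. s n a (legs r N i a)) = (\<Prod>a<r. t a (legs r N i a) + d n a (legs r N i a))"
      by (simp add: d_def)
    also have "\<dots> = (\<Sum>A\<in>Pow {..<r}. (\<Prod>a\<in>A. t a (legs r N i a)) * (\<Prod>a\<in>{..<r} - A. d n a (legs r N i a)))"
      by (rule prod_add) simp
    also have "\<dots> = (\<Sum>A\<in>Pow {..<r}. 1 * (\<Prod>a<r. mix n A a (legs r N i a)))"
    proof (rule sum.cong[OF refl])
      fix A assume "A \<in> Pow {..<r}"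
      then have "(\<Prod>a<r. mix n A a (legs r N i a))
          = (\<Prod>a\<in>A. mix n A a (legs r N i a)) * (\<Prod>a\<in>{..<r} - A. mix n A a (legs r N i a))"
        by (subst mult.commute, intro prod.subset_diff) auto
      then show "(\<Prod>a\<in>A. t a (legs r N i a)) * (\<Prod>a\<in>{..<r} - A. d n a (legs r N i a))
          = 1 * (\<Prod>a<r. mix n A a (legs r N i a))"
        by (simp add: mix_def)
    qed
    finally show "(\<Prod>a<r. s n a (legs r N i a)) = (\<Sum>A\<in>Pow {..<r}. 1 * (\<Prod>a<r. mix n A a (legs r N i a)))" .
  qed (use mix in auto)
  have summand: "(\<lambda>n. contr B r N (mix n A)) \<longlonglongrightarrow> (if A = {..<r} then contr B r N t else 0)"
    if A: "A \<in> Pow {..<r}" for A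
  proof (cases "A = {..<r}")
    case True
    have "contr B r N (mix n A) = contr B r N t" for n
      by (simp add: contr_def mix_def True)
    then show ?thesis using True by simp
  next
    case False
    then obtain a0 where a0: "a0 < r" "a0 \<notin> A" using A by auto
    have "(\<lambda>n. \<Prod>a<r. tensor_norm (row_sum r N a) (mix n A a))
        \<longlonglongrightarrow> (\<Prod>a<r. if a \<in> A then tensor_norm (row_sum r N a) (t a) else 0)"
    proof (rule tendsto_prod)
      fix a assume "a \<in> {..<r}"
      then show "(\<lambda>n. tensor_norm (row_sum r N a) (mix n A a))
          \<longlonglongrightarrow> (if a \<in> A then tensor_norm (row_sum r N a) (t a) else 0)"
        using lim[of a] by (simp add: mix_def norm_d)
    qed
    also have "(\<Prod>a<r. if a \<in> A then tensor_norm (row_sum r N a) (t a) else 0) = 0"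
      using a0 by (intro prod_zero) auto
    finally have "(\<lambda>n. contr B r N (mix n A)) \<longlonglongrightarrow> 0"
      by (rule Lim_null_comparison[rotated]) (auto intro!: always_eventually abs_contr_le mix)
    then show ?thesis using False by simp
  qed
  have "(\<lambda>n. contr B r N (s n)) \<longlonglongrightarrow> (\<Sum>A\<in>Pow {..<r}. if A = {..<r} then contr B r N t else 0)"
    unfolding expand mult_1 by (intro tendsto_sum summand)
  then show ?thesis by simp
qed

end


section \<open>Projection onto finite orthonormal systems and Parseval's identity\<close>

lemma projection_bounds:
  fixes h :: "'h::real_inner"
  assumes F: "finite F" "orthonormal_set F"
  defines "p \<equiv> \<Sum>b\<in>F. inner h b *\<^sub>R b"
  shows projection_best: "s \<in> span F \<Longrightarrow> norm (h - p) \<le> norm (h - s)"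
    and bessel: "(\<Sum>b\<in>F. (inner h b)\<^sup>2) \<le> (norm h)\<^sup>2"
proof -
  have coord: "inner p b = inner h b" if "b \<in> F" for b
  proof -
    have "inner p b = (\<Sum>c\<in>F. inner h c * (if c = b then 1 else 0))"
      unfolding p_def inner_sum_left
      by (intro sum.cong refl) (use F that in \<open>auto simp: orthonormal_set_def\<close>)
    then show ?thesis using F that by (simp add: mult_delta_right)
  qed
  have orth: "inner (h - p) s = 0" if "s \<in> span F" for s
    using that
  proof (induction rule: span_induct_alt)
    case base
    then show ?case by simp
  next
    case (step c x y)
    then show ?case using coord[of x] by (simp add: inner_add_right inner_diff_left)
  qed
  have p: "p \<in> span F"
    unfolding p_def by (intro span_sum span_scale span_base)
  have pyth: "(norm (h - s))\<^sup>2 = (norm (h - p))\<^sup>2 + (norm (p - s))\<^sup>2" if "s \<in> span F" for s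
  proof -
    have "inner (h - p) (p - s) = 0"
      by (rule orth) (intro span_diff p that)
    moreover have "h - s = (h - p) + (p - s)" by simp
    ultimately show ?thesis
      unfolding power2_norm_eq_inner by (simp only: inner_add_left inner_add_right) (simp add: inner_commute)
  qed
  show "norm (h - p) \<le> norm (h - s)" if "s \<in> span F"
    by (rule power2_le_imp_le) (use pyth[OF that] in auto)
  have "inner p p = (\<Sum>b\<in>F. inner h b * inner p b)"
    by (subst (2) p_def) (simp add: inner_sum_right)
  then have "inner p p = (\<Sum>b\<in>F. (inner h b)\<^sup>2)"
    by (simp only: coord power2_eq_square cong: sum.cong)
  then have "(norm p)\<^sup>2 = (\<Sum>b\<in>F. (inner h b)\<^sup>2)"
    by (simp add: dot_square_norm)
  moreover have "(norm h)\<^sup>2 = (norm (h - p))\<^sup>2 + (norm p)\<^sup>2"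
    using pyth[of 0] by (simp add: span_zero)
  ultimately show "(\<Sum>b\<in>F. (inner h b)\<^sup>2) \<le> (norm h)\<^sup>2" by simp
qed

text \<open>Density of the span yields a finite \<open>F0\<close> whose span comes close to
  \<open>h\<close>. The projection onto any larger finite system is at least as close, so all later
  partial sums are close to the limit, as an unordered sum demands.\<close>

lemma parseval:
  fixes h k :: "'h::real_inner"
  assumes B: "orthonormal_basis B"
  shows "((\<lambda>b. inner h b * inner k b) has_sum inner h k) B"
  unfolding has_sum_def
proof (rule tendstoI)
  fix e :: real assume "e > 0"
  have ons: "orthonormal_set B" and dense: "closure (span B) = UNIV"
    using B by (auto simp: orthonormal_basis_def)
  \<comment> \<open>Adding 1 keeps the tolerance meaningful when \<open>k = 0\<close>.\<close>
  have "0 < e / (norm k + 1)"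
    using \<open>e > 0\<close> by (simp add: add_nonneg_pos)
  then obtain s where s: "s \<in> span B" "dist s h < e / (norm k + 1)"
    using dense closure_approachable[of h "span B"] by auto
  from s(1) obtain F0 c where F0: "finite F0" "F0 \<subseteq> B" and s_eq: "s = (\<Sum>b\<in>F0. c b *\<^sub>R b)"
    by (auto simp: span_explicit)
  have s_span: "s \<in> span F0"
    unfolding s_eq by (intro span_sum span_scale span_base)
  have "dist (\<Sum>b\<in>F. inner h b * inner k b) (inner h k) < e"
    if F: "finite F" "F0 \<subseteq> F" "F \<subseteq> B" for F
  proof -
    define p where "p = (\<Sum>b\<in>F. inner h b *\<^sub>R b)"
    have "s \<in> span F" using s_span F(2) span_mono by blast
    then have "norm (h - p) \<le> norm (h - s)"
      unfolding p_def using F ons by (intro projection_best) (auto intro: orthonormal_set_subset)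
    also have "\<dots> < e / (norm k + 1)" using s(2) by (simp add: dist_norm norm_minus_commute)
    finally have close: "norm (h - p) * (norm k + 1) < e"
      by (simp add: pos_less_divide_eq add_nonneg_pos)
    have "dist (\<Sum>b\<in>F. inner h b * inner k b) (inner h k) = \<bar>inner (h - p) k\<bar>"
      by (simp add: dist_real_def p_def inner_diff_right inner_sum_right inner_commute[of _ k] abs_minus_commute)
    also have "\<dots> \<le> norm (h - p) * norm k" by (rule Cauchy_Schwarz_ineq2)
    also have "\<dots> \<le> norm (h - p) * (norm k + 1)" by (intro mult_left_mono) auto
    finally show ?thesis using close by linarith
  qed
  then show "\<forall>\<^sub>F F in finite_subsets_at_top B. dist (\<Sum>b\<in>F. inner h b * inner k b) (inner h k) < e"
    unfolding eventually_finite_subsets_at_top using F0 by blast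
qed

lemma parseval_abs_summable:
  fixes h k :: "'h::real_inner"
  assumes "orthonormal_basis B"
  shows "(\<lambda>b. norm (inner h b * inner k b)) summable_on B"
  by (rule iffD1[OF summable_on_iff_abs_summable_on_real has_sum_imp_summable[OF parseval[OF assms]]])

lemma prod_nth_eq_prod_list: "(\<Prod>i<length ks. g (ks ! i)) = prod_list (map g ks)"
  by (induction ks) (auto simp: prod.lessThan_Suc_shift simp del: prod.lessThan_Suc)

lemma pure_power_eq: "length ks = q \<Longrightarrow> pure_power q h ks = prod_list (map (inner h) ks)"
  unfolding pure_power_def using prod_nth_eq_prod_list[of "inner h" ks] by auto

lemma square_sum_pure_power:
  assumes "finite F"
  shows "square_sum q (pure_power q h) F = (\<Sum>b\<in>F. (inner h b)\<^sup>2) ^ q"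
proof (induction q)
  case 0
  have "{bs. set bs \<subseteq> F \<and> length bs = 0} = {[]}" by auto
  then show ?case by (simp add: square_sum_def pure_power_eq)
next
  case (Suc q)
  let ?L = "\<lambda>q. {bs. set bs \<subseteq> F \<and> length bs = q}"
  have lists: "?L (Suc q) = (\<lambda>(b, bs). b # bs) ` (F \<times> ?L q)"
    by (auto simp: length_Suc_conv image_iff)
  have inj: "inj_on (\<lambda>(b, bs). b # bs) (F \<times> ?L q)"
    by (auto simp: inj_on_def)
  have "square_sum (Suc q) (pure_power (Suc q) h) F
      = (\<Sum>(b, bs)\<in>F \<times> ?L q. (inner h b)\<^sup>2 * (pure_power q h bs)\<^sup>2)"
    unfolding square_sum_def lists sum.reindex[OF inj]
    by (intro sum.cong) (auto simp: pure_power_eq power_mult_distrib)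
  also have "\<dots> = (\<Sum>b\<in>F. (inner h b)\<^sup>2) * square_sum q (pure_power q h) F"
    unfolding square_sum_def sum_product by (simp add: sum.cartesian_product)
  finally show ?case using Suc by simp
qed

lemma hs_bounded_pure_power: "hs_bounded q (pure_power q h)"
  unfolding hs_bounded_def
  by (rule bdd_aboveI[of _ "((norm h)\<^sup>2) ^ q"])
    (auto simp: square_sum_pure_power intro!: power_mono bessel sum_nonneg)

text \<open>A power evaluates leg by leg, so the product over vertices regroups into a product over
  edges, in which each label meets the two vectors at the ends of its edge. The sum over labellings
  factors accordingly, and each factor is Parseval's identity.\<close>

lemma contr_pure_power:
  assumes B: "orthonormal_basis B" and N: "loopfree r N"
  shows "contr B r N (\<lambda>a. pure_power (row_sum r N a) (h a))
    = (\<Prod>(a, b)\<in>{(a, b). a < b \<and> b < r}. inner (h a) (h b) ^ N a b)"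
proof -
  let ?E = "edges r N"
  have fin: "finite {(a, b). a < b \<and> b < r}"
    by (rule finite_subset[of _ "{..<r} \<times> {..<r}"]) auto
  have prods: "(\<Prod>a<r. pure_power (row_sum r N a) (h a) (legs r N i a))
      = (\<Prod>e\<in>?E. inner (h (fst e)) (i e) * inner (h (fst (snd e))) (i e))" for i
  proof -
    have "(\<Prod>a<r. pure_power (row_sum r N a) (h a) (legs r N i a))
        = (\<Prod>a<r. \<Prod>e\<in>{e \<in> ?E. a \<in> {fst e, fst (snd e)}}. inner (h a) (i e))"
    proof (rule prod.cong[OF refl])
      fix a assume "a \<in> {..<r}"
      then have a: "a < r" by simp
      have "pure_power (row_sum r N a) (h a) (legs r N i a)
          = prod_list (map (\<lambda>e. inner (h a) (i e)) (leg_list r N a))"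
        by (simp add: pure_power_eq legs_eq length_leg_list[OF N a] comp_def)
      also have "\<dots> = (\<Prod>e\<in>set (leg_list r N a). inner (h a) (i e))"
        by (rule prod.distinct_set_conv_list[symmetric]) (rule distinct_leg_list)
      finally show "pure_power (row_sum r N a) (h a) (legs r N i a)
          = (\<Prod>e\<in>{e \<in> ?E. a \<in> {fst e, fst (snd e)}}. inner (h a) (i e))"
        unfolding set_leg_list[OF N a] .
    qed
    also have "\<dots> = (\<Prod>e\<in>?E. \<Prod>a\<in>{a \<in> {..<r}. a \<in> {fst e, fst (snd e)}}. inner (h a) (i e))"
      by (rule prod.swap_restrict) (auto simp: finite_edges)
    also have "\<dots> = (\<Prod>e\<in>?E. inner (h (fst e)) (i e) * inner (h (fst (snd e))) (i e))"
    proof (rule prod.cong[OF refl])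
      fix e assume "e \<in> ?E"
      then have "fst e \<noteq> fst (snd e)" "{a \<in> {..<r}. a \<in> {fst e, fst (snd e)}} = {fst e, fst (snd e)}"
        by (auto simp: edges_def)
      then show "(\<Prod>a\<in>{a \<in> {..<r}. a \<in> {fst e, fst (snd e)}}. inner (h a) (i e))
          = inner (h (fst e)) (i e) * inner (h (fst (snd e))) (i e)"
        by simp
    qed
    finally show ?thesis .
  qed
  have "contr B r N (\<lambda>a. pure_power (row_sum r N a) (h a))
      = (\<Sum>\<^sub>\<infinity>i\<in>PiE ?E (\<lambda>_. B). \<Prod>e\<in>?E. inner (h (fst e)) (i e) * inner (h (fst (snd e))) (i e))"
    unfolding contr_def prods ..
  also have "\<dots> = (\<Prod>e\<in>?E. \<Sum>\<^sub>\<infinity>b\<in>B. inner (h (fst e)) b * inner (h (fst (snd e))) b)"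
    by (rule infsum_prod_PiE_abs) (use parseval_abs_summable[OF B] finite_edges in auto)
  also have "\<dots> = (\<Prod>e\<in>?E. inner (h (fst e)) (h (fst (snd e))))"
    by (intro prod.cong refl infsumI parseval B)
  also have "\<dots> = (\<Prod>((a, b), j)\<in>(SIGMA p:{(a, b). a < b \<and> b < r}. {..<N (fst p) (snd p)}).
      inner (h a) (h b))"
    by (rule prod.reindex_bij_witness[of _ "\<lambda>((a, b), j). (a, b, j)" "\<lambda>(a, b, j). ((a, b), j)"])
      (auto simp: edges_def)
  also have "\<dots> = (\<Prod>p\<in>{(a, b). a < b \<and> b < r}. \<Prod>j<N (fst p) (snd p). inner (h (fst p)) (h (snd p)))"
    by (subst prod.Sigma) (use fin in \<open>auto simp: case_prod_unfold\<close>)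
  also have "\<dots> = (\<Prod>(a, b)\<in>{(a, b). a < b \<and> b < r}. inner (h a) (h b) ^ N a b)"
    by (simp add: case_prod_unfold)
  finally show ?thesis .
qed

section \<open>Gaussian integration by parts and the diagram formula\<close>

text \<open>A class closed under sums and products that contains every Gaussian variable; inside it
  integrability is a matter of algebra.\<close>

definition has_all_moments :: "'w measure \<Rightarrow> ('w \<Rightarrow> real) \<Rightarrow> bool" where
  "has_all_moments M X \<longleftrightarrow> X \<in> borel_measurable M \<and> (\<forall>n. integrable M (\<lambda>w. X w ^ n))"

lemma has_all_moments_integrable: "has_all_moments M X \<Longrightarrow> integrable M X"
  unfolding has_all_moments_def by (drule conjunct2, drule spec[of _ 1]) simp

lemma has_all_moments_measurable: "has_all_moments M X \<Longrightarrow> X \<in> borel_measurable M"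
  by (simp add: has_all_moments_def)

lemma has_all_moments_power: "has_all_moments M X \<Longrightarrow> has_all_moments M (\<lambda>w. X w ^ n)"
  by (auto simp: has_all_moments_def power_mult[symmetric])

lemma has_all_moments_mult:
  assumes X: "has_all_moments M X" and Y: "has_all_moments M Y"
  shows "has_all_moments M (\<lambda>w. X w * Y w)"
  unfolding has_all_moments_def
proof (intro conjI allI)
  have [measurable]: "X \<in> borel_measurable M" "Y \<in> borel_measurable M"
    using assms by (auto simp: has_all_moments_def)
  show "(\<lambda>w. X w * Y w) \<in> borel_measurable M" by measurable
  show "integrable M (\<lambda>w. (X w * Y w) ^ n)" for n
  proof (rule Bochner_Integration.integrable_bound)
    show "integrable M (\<lambda>w. X w ^ (n * 2) + Y w ^ (n * 2))"
      using assms by (auto simp: has_all_moments_def)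
    have "\<bar>(x * y) ^ n\<bar> \<le> \<bar>x ^ (n * 2) + y ^ (n * 2)\<bar>" for x y :: real
    proof -
      have "2 * \<bar>x ^ n\<bar> * \<bar>y ^ n\<bar> \<le> \<bar>x ^ n\<bar>\<^sup>2 + \<bar>y ^ n\<bar>\<^sup>2" by (rule sum_squares_bound)
      moreover have "0 \<le> \<bar>x ^ n\<bar> * \<bar>y ^ n\<bar>" by simp
      ultimately have "\<bar>(x * y) ^ n\<bar> \<le> (x ^ n)\<^sup>2 + (y ^ n)\<^sup>2"
        by (simp only: power_mult_distrib abs_mult power2_abs)
      then show ?thesis by (simp add: power_mult)
    qed
    then show "AE w in M. norm ((X w * Y w) ^ n) \<le> norm (X w ^ (n * 2) + Y w ^ (n * 2))" by simp
  qed measurable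
qed

lemma has_all_moments_add:
  assumes X: "has_all_moments M X" and Y: "has_all_moments M Y"
  shows "has_all_moments M (\<lambda>w. X w + Y w)"
  unfolding has_all_moments_def
proof (intro conjI allI)
  show "(\<lambda>w. X w + Y w) \<in> borel_measurable M"
    using assms by (auto simp: has_all_moments_def)
  show "integrable M (\<lambda>w. (X w + Y w) ^ n)" for n
    unfolding binomial_ring mult.assoc
    by (intro Bochner_Integration.integrable_sum integrable_mult_right has_all_moments_integrable
        has_all_moments_mult has_all_moments_power assms)
qed

context prob_space
begin

lemma has_all_moments_const: "has_all_moments M (\<lambda>_. c)"
  by (simp add: has_all_moments_def)

lemma has_all_moments_scale: "has_all_moments M X \<Longrightarrow> has_all_moments M (\<lambda>w. c * X w)"
  by (intro has_all_moments_mult has_all_moments_const)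

lemma has_all_moments_sum:
  assumes "\<And>i. i \<in> I \<Longrightarrow> has_all_moments M (X i)"
  shows "has_all_moments M (\<lambda>w. \<Sum>i\<in>I. X i w)"
  using assms
  by (induction I rule: infinite_finite_induct) (auto intro: has_all_moments_const has_all_moments_add)

lemma has_all_moments_prod:
  assumes "\<And>i. i \<in> I \<Longrightarrow> has_all_moments M (X i)"
  shows "has_all_moments M (\<lambda>w. \<Prod>i\<in>I. X i w)"
  using assms
  by (induction I rule: infinite_finite_induct) (auto intro: has_all_moments_const has_all_moments_mult)

lemma has_all_moments_hermite:
  assumes "has_all_moments M X"
  shows "has_all_moments M (\<lambda>w. hermite q (X w))"
proof (induction q rule: less_induct)
  case (less q)
  have minus: "has_all_moments M (\<lambda>w. A w - B w)"
    if "has_all_moments M A" "has_all_moments M B" for A B :: "'a \<Rightarrow> real"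
    using has_all_moments_add[OF that(1) has_all_moments_scale[OF that(2), of "-1"]] by simp
  show ?case
  proof (cases q rule: hermite.cases[of "(q, 0)" for q, simplified])
    case (3 n)
    then show ?thesis
      using less.IH by (auto intro!: minus has_all_moments_mult has_all_moments_scale assms simp del: of_nat_Suc)
  qed (auto intro: has_all_moments_const assms)
qed

text \<open>By the binomial theorem the expectation is a polynomial in \<open>e\<close>, so the
  derivative at 0 is its linear coefficient and no limit is taken under the integral.\<close>

lemma has_real_derivative_moment:
  assumes A: "has_all_moments M A" and L: "has_all_moments M L" and Y: "has_all_moments M Y"
  shows "((\<lambda>e. expectation (\<lambda>w. A w * (L w + e * Y w) ^ n))
    has_real_derivative (real n * expectation (\<lambda>w. A w * Y w * L w ^ (n - 1)))) (at 0)"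
proof -
  define c where "c k = expectation (\<lambda>w. A w * (Y w ^ k * L w ^ (n - k)))" for k
  have int: "integrable M (\<lambda>w. A w * (Y w ^ k * L w ^ (n - k)))" for k
    by (intro has_all_moments_integrable has_all_moments_mult has_all_moments_power assms)
  have "expectation (\<lambda>w. A w * (L w + e * Y w) ^ n) = (\<Sum>k\<le>n. (of_nat (n choose k) * c k) * e ^ k)" for e
  proof -
    have "A w * (L w + e * Y w) ^ n
        = (\<Sum>k\<le>n. (of_nat (n choose k) * e ^ k) * (A w * (Y w ^ k * L w ^ (n - k))))" for w
      unfolding add.commute[of "L w"] binomial_ring sum_distrib_left
      by (intro sum.cong refl) (simp add: power_mult_distrib)
    then have "expectation (\<lambda>w. A w * (L w + e * Y w) ^ n)
        = expectation (\<lambda>w. \<Sum>k\<le>n. (of_nat (n choose k) * e ^ k) * (A w * (Y w ^ k * L w ^ (n - k))))"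
      by presburger
    also have "\<dots> = (\<Sum>k\<le>n. (of_nat (n choose k) * e ^ k) * c k)"
      unfolding c_def by (subst Bochner_Integration.integral_sum) (intro integrable_mult_right int, simp)
    finally show ?thesis by (simp add: mult_ac)
  qed
  then have eq: "(\<lambda>e. expectation (\<lambda>w. A w * (L w + e * Y w) ^ n))
      = (\<lambda>e. \<Sum>k\<le>n. (of_nat (n choose k) * c k) * e ^ k)" by auto
  have "((\<lambda>e. \<Sum>k\<le>n. (of_nat (n choose k) * c k) * e ^ k) has_real_derivative
      (\<Sum>k\<le>n. (of_nat (n choose k) * c k) * (of_nat k * 0 ^ (k - 1)))) (at 0)"
    by (auto intro!: derivative_eq_intros sum.cong)
  also have "(\<Sum>k\<le>n. (of_nat (n choose k) * c k) * (of_nat k * 0 ^ (k - 1))) = real n * c 1"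
  proof (cases n)
    case (Suc n')
    have "(\<Sum>k\<le>n. (of_nat (n choose k) * c k) * (of_nat k * 0 ^ (k - 1)))
        = (\<Sum>k\<in>{1}. (of_nat (n choose k) * c k) * (of_nat k * 0 ^ (k - 1)))"
      by (rule sum.mono_neutral_right) (auto simp: Suc)
    then show ?thesis by simp
  qed simp
  finally show ?thesis
    unfolding eq by (simp add: c_def mult.assoc)
qed

end

text \<open>A vector space of random variables, each of them centered Gaussian: joint Gaussianity in
  the form in which \<open>gaussian_canvas\<close> supplies it.\<close>

locale gaussian_space = prob_space M for M :: "'w measure" +
  fixes \<G> :: "('w \<Rightarrow> real) set"
  assumes add_mem: "\<And>X Y. X \<in> \<G> \<Longrightarrow> Y \<in> \<G> \<Longrightarrow> (\<lambda>w. X w + Y w) \<in> \<G>"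
    and scale_mem: "\<And>c X. X \<in> \<G> \<Longrightarrow> (\<lambda>w. c * X w) \<in> \<G>"
    and gaussian: "\<And>X. X \<in> \<G> \<Longrightarrow> centered_gaussian_rv M X"
begin

definition cov :: "('w \<Rightarrow> real) \<Rightarrow> ('w \<Rightarrow> real) \<Rightarrow> real" where
  "cov X Y = expectation (\<lambda>w. X w * Y w)"

lemma gaussian_moments:
  assumes "X \<in> \<G>"
  shows has_all_moments: "has_all_moments M X"
    and odd_moment: "expectation (\<lambda>w. X w ^ (2 * k + 1)) = 0"
    and even_moment: "expectation (\<lambda>w. X w ^ (2 * k)) = fact (2 * k) / (2 ^ k * fact k) * cov X X ^ k"
proof -
  have X[measurable]: "X \<in> borel_measurable M"
    using gaussian[OF assms] by (simp add: centered_gaussian_rv_def)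
  consider "AE w in M. X w = 0" | \<sigma> where "\<sigma> > 0" "distributed M lborel X (normal_density 0 \<sigma>)"
    using gaussian[OF assms] by (auto simp: centered_gaussian_rv_def)
  then have "has_all_moments M X \<and> (\<forall>k. expectation (\<lambda>w. X w ^ (2 * k + 1)) = 0) \<and>
    (\<forall>k. expectation (\<lambda>w. X w ^ (2 * k)) = fact (2 * k) / (2 ^ k * fact k) * cov X X ^ k)"
  proof cases
    \<comment> \<open>The degenerate variable obeys the general formulas: its variance is 0, and
      \<open>0 ^ 0 = 1\<close> covers the moment of order 0.\<close>
    case 1
    have pow: "has_bochner_integral M (\<lambda>w. X w ^ n) (if n = 0 then 1 else 0)" for n
    proof -
      have "has_bochner_integral M (\<lambda>w. X w ^ n) (if n = 0 then 1 else 0)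
          = has_bochner_integral M (\<lambda>_. if n = 0 then 1 else 0 :: real) (if n = 0 then 1 else 0)"
        by (rule has_bochner_integral_cong_AE) (use 1 in \<open>auto elim!: eventually_mono\<close>)
      then show ?thesis
        by (cases "n = 0") (auto simp: has_bochner_integral_iff prob_space)
    qed
    have "cov X X = 0"
      using has_bochner_integral_integral_eq[OF pow[of 2]] by (simp add: cov_def power2_eq_square)
    then show ?thesis
      using pow by (auto simp: has_all_moments_def has_bochner_integral_iff simp del: power_Suc)
  next
    case 2
    have int: "integrable M (\<lambda>w. X w ^ n)" for n
      using distributed_integrable[OF 2(2), of "\<lambda>x. x ^ n"] integrable_normal_moment[OF 2(1), of 0 n]
      by simp
    have ex: "expectation (\<lambda>w. X w ^ n) = (\<integral>x. normal_density 0 \<sigma> x * x ^ n \<partial>lborel)" for n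
      using distributed_integral[OF 2(2), of "\<lambda>x. x ^ n"] by simp
    have even: "expectation (\<lambda>w. X w ^ (2 * k)) = fact (2 * k) / ((2 / \<sigma>\<^sup>2) ^ k * fact k)" for k
      unfolding ex using integral_normal_moment_even[OF 2(1), of 0 k] by simp
    have "cov X X = \<sigma>\<^sup>2"
      using even[of 1] by (simp add: cov_def power2_eq_square)
    then have "expectation (\<lambda>w. X w ^ (2 * k)) = fact (2 * k) / (2 ^ k * fact k) * cov X X ^ k" for k
      unfolding even by (simp add: power_divide)
    moreover have "expectation (\<lambda>w. X w ^ (2 * k + 1)) = 0" for k
      unfolding ex using integral_normal_moment_odd[OF 2(1), of 0 k] by simp
    ultimately show ?thesis
      using int by (auto simp: has_all_moments_def)
  qed
  then show "has_all_moments M X" "expectation (\<lambda>w. X w ^ (2 * k + 1)) = 0"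
    "expectation (\<lambda>w. X w ^ (2 * k)) = fact (2 * k) / (2 ^ k * fact k) * cov X X ^ k"
    by blast+
qed

lemma cov_integrable: "X \<in> \<G> \<Longrightarrow> Y \<in> \<G> \<Longrightarrow> integrable M (\<lambda>w. X w * Y w)"
  by (intro has_all_moments_integrable has_all_moments_mult has_all_moments)

lemma cov_add_right:
  assumes "X \<in> \<G>" "Y \<in> \<G>" "Y' \<in> \<G>"
  shows "cov X (\<lambda>w. Y w + c * Y' w) = cov X Y + c * cov X Y'"
  using cov_integrable[OF assms(1,2)] cov_integrable[OF assms(1,3)]
  by (simp add: cov_def distrib_left mult.left_commute[of _ c])

lemma cov_commute: "cov X Y = cov Y X"
  by (simp add: cov_def mult.commute)

lemma perturb_mem: "X \<in> \<G> \<Longrightarrow> Y \<in> \<G> \<Longrightarrow> (\<lambda>w. X w + c * Y w) \<in> \<G>"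
  by (intro add_mem scale_mem)

text \<open>The power of an auxiliary Gaussian variable \<open>L\<close> lets the rule pass to products: perturbing
  \<open>L\<close> in the direction of \<open>X\<close> and differentiating produces the factor \<open>X\<close>.\<close>

definition ibp :: "('w \<Rightarrow> real) \<Rightarrow> (('w \<Rightarrow> real) \<Rightarrow> 'w \<Rightarrow> real) \<Rightarrow> bool" where
  "ibp F D \<longleftrightarrow> has_all_moments M F \<and>
     (\<forall>Y\<in>\<G>. has_all_moments M (D Y) \<and>
       (\<forall>L\<in>\<G>. \<forall>n. expectation (\<lambda>w. Y w * F w * L w ^ n)
          = expectation (\<lambda>w. D Y w * L w ^ n) + real n * cov Y L * expectation (\<lambda>w. F w * L w ^ (n - 1))))"

lemma ibp_expectation:
  assumes "ibp F D" "Y \<in> \<G>"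
  shows "expectation (\<lambda>w. Y w * F w) = expectation (D Y)"
proof -
  have "expectation (\<lambda>w. Y w * F w * Y w ^ 0)
      = expectation (\<lambda>w. D Y w * Y w ^ 0) + real 0 * cov Y Y * expectation (\<lambda>w. F w * Y w ^ (0 - 1))"
    using assms unfolding ibp_def by blast
  then show ?thesis by simp
qed

text \<open>The moments of \<open>L + e * Y\<close> depend on \<open>e\<close> through the variance
  alone, a quadratic polynomial in \<open>e\<close>. Differentiating the moment of order
  \<open>Suc n\<close> at 0 in two ways gives the rule; for even \<open>n\<close> that moment is odd
  and both sides vanish.\<close>

lemma ibp_one: "ibp (\<lambda>_. 1) (\<lambda>_ _. 0)"
  unfolding ibp_def
proof (intro conjI ballI allI)
  fix Y L n assume Y: "Y \<in> \<G>" and L: "L \<in> \<G>"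
  let ?\<phi> = "\<lambda>e. expectation (\<lambda>w. (L w + e * Y w) ^ Suc n)"
  have d1: "(?\<phi> has_real_derivative (real (Suc n) * expectation (\<lambda>w. Y w * L w ^ n))) (at 0)"
    using has_real_derivative_moment[OF has_all_moments_const[of 1] has_all_moments[OF L]
        has_all_moments[OF Y], of "Suc n"] by simp
  have "real (Suc n) * expectation (\<lambda>w. Y w * L w ^ n)
      = real (Suc n) * (real n * cov Y L * expectation (\<lambda>w. L w ^ (n - 1)))"
  proof (cases "even n")
    case True
    then obtain k where k: "n = 2 * k" by blast
    have "?\<phi> = (\<lambda>_. 0)"
      using odd_moment[OF perturb_mem[OF L Y], of _ k] by (simp add: k)
    then have "real (Suc n) * expectation (\<lambda>w. Y w * L w ^ n) = 0"
      using DERIV_unique[OF d1, of 0] by (simp del: power_Suc)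
    moreover have "real n * expectation (\<lambda>w. L w ^ (n - 1)) = 0"
    proof (cases k)
      case (Suc k')
      then show ?thesis using odd_moment[OF L, of k'] by (simp add: k)
    qed (simp add: k)
    ultimately show ?thesis
      by (simp only: mult.commute[of _ "cov Y L"] mult.assoc mult_zero_right)
  next
    case False
    then obtain k where k: "n = Suc (2 * k)" using oddE by fastforce
    \<comment> \<open>The variance of \<open>L + e * Y\<close>; its slope \<open>2 * cov Y L\<close>
      at 0 is the source of the covariance in the rule.\<close>
    define Q where "Q e = cov L L + 2 * cov Y L * e + cov Y Y * e\<^sup>2" for e
    have Q: "cov (\<lambda>w. L w + e * Y w) (\<lambda>w. L w + e * Y w) = Q e" for e
      unfolding cov_add_right[OF perturb_mem[OF L Y] L Y] cov_commute[of "\<lambda>w. L w + e * Y w"]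
        cov_add_right[OF L L Y] cov_add_right[OF Y L Y] cov_commute[of L Y]
      by (simp add: Q_def algebra_simps power2_eq_square)
    let ?K = "fact (2 * Suc k) / (2 ^ Suc k * fact (Suc k)) :: real"
    have "?\<phi> = (\<lambda>e. ?K * Q e ^ Suc k)"
      using even_moment[OF perturb_mem[OF L Y], of _ "Suc k"] by (auto simp: k Q fun_eq_iff)
    moreover have "(Q has_real_derivative 2 * cov Y L) (at 0)"
      unfolding Q_def by (auto intro!: derivative_eq_intros)
    from DERIV_cmult[OF DERIV_power[OF this, of "Suc k"], of ?K]
    have "((\<lambda>e. ?K * Q e ^ Suc k) has_real_derivative
        ?K * (real (Suc k) * (2 * cov Y L * Q 0 ^ (Suc k - 1)))) (at 0)"
      by (simp only: One_nat_def)
    ultimately have "real (Suc n) * expectation (\<lambda>w. Y w * L w ^ n)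
        = ?K * (real (Suc k) * (2 * cov Y L * Q 0 ^ (Suc k - 1)))"
      using DERIV_unique[OF d1] by simp
    also have "\<dots> = real (Suc n) * (real n * cov Y L * (fact (2 * k) / (2 ^ k * fact k) * cov L L ^ k))"
    proof -
      have "fact (2 * Suc k) = real (Suc n) * real n * fact (2 * k)"
        by (simp add: k)
      then show ?thesis by (simp add: Q_def divide_simps)
    qed
    also have "fact (2 * k) / (2 ^ k * fact k) * cov L L ^ k = expectation (\<lambda>w. L w ^ (n - 1))"
      using even_moment[OF L, of k] by (simp add: k)
    finally show ?thesis .
  qed
  then have "expectation (\<lambda>w. Y w * L w ^ n) = real n * cov Y L * expectation (\<lambda>w. L w ^ (n - 1))"
    by (simp del: of_nat_Suc)
  then show "expectation (\<lambda>w. Y w * 1 * L w ^ n)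
      = expectation (\<lambda>w. 0 * L w ^ n) + real n * cov Y L * expectation (\<lambda>w. 1 * L w ^ (n - 1))"
    by simp
qed (rule has_all_moments_const)+

text \<open>The rule of order \<open>Suc n\<close> holds with \<open>L + e * X\<close> for every
  \<open>e\<close>. Comparing derivatives at 0 produces the factor \<open>X\<close>; the slope
  \<open>cov Y X\<close> of \<open>cov Y (L + e * X)\<close> is the new term, and the common factor
  \<open>Suc n\<close> cancels.\<close>

lemma ibp_mult:
  assumes F: "ibp F D" and X: "X \<in> \<G>"
  shows "ibp (\<lambda>w. X w * F w) (\<lambda>Y w. cov Y X * F w + X w * D Y w)"
  unfolding ibp_def
proof (intro conjI ballI allI)
  have aF: "has_all_moments M F" and aD: "\<And>Y. Y \<in> \<G> \<Longrightarrow> has_all_moments M (D Y)"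
    using F by (auto simp: ibp_def)
  note aX = has_all_moments[OF X]
  show "has_all_moments M (\<lambda>w. X w * F w)"
    by (intro has_all_moments_mult aX aF)
  fix Y assume Y: "Y \<in> \<G>"
  note aY = has_all_moments[OF Y]
  show "has_all_moments M (\<lambda>w. cov Y X * F w + X w * D Y w)"
    by (intro has_all_moments_add has_all_moments_scale has_all_moments_mult aX aF aD Y)
  fix L n assume L: "L \<in> \<G>"
  note aL = has_all_moments[OF L]
  have eq: "expectation (\<lambda>w. Y w * F w * (L w + e * X w) ^ Suc n)
      = expectation (\<lambda>w. D Y w * (L w + e * X w) ^ Suc n)
        + real (Suc n) * (cov Y L + e * cov Y X) * expectation (\<lambda>w. F w * (L w + e * X w) ^ n)" for e
    using F Y perturb_mem[OF L X, of e] unfolding ibp_def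
    by (simp add: cov_add_right[OF Y L X] del: power_Suc of_nat_Suc)
  have d1: "((\<lambda>e. expectation (\<lambda>w. Y w * F w * (L w + e * X w) ^ Suc n)) has_real_derivative
      real (Suc n) * expectation (\<lambda>w. Y w * F w * X w * L w ^ n)) (at 0)"
    using has_real_derivative_moment[OF has_all_moments_mult[OF aY aF] aL aX, of "Suc n"] by simp
  have d2: "((\<lambda>e. expectation (\<lambda>w. D Y w * (L w + e * X w) ^ Suc n)) has_real_derivative
      real (Suc n) * expectation (\<lambda>w. D Y w * X w * L w ^ n)) (at 0)"
    using has_real_derivative_moment[OF aD[OF Y] aL aX, of "Suc n"] by simp
  have d3: "((\<lambda>e. expectation (\<lambda>w. F w * (L w + e * X w) ^ n)) has_real_derivative
      real n * expectation (\<lambda>w. F w * X w * L w ^ (n - 1))) (at 0)"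
    using has_real_derivative_moment[OF aF aL aX, of n] by simp
  have "((\<lambda>e. expectation (\<lambda>w. Y w * F w * (L w + e * X w) ^ Suc n)) has_real_derivative
      real (Suc n) * expectation (\<lambda>w. D Y w * X w * L w ^ n)
      + real (Suc n) * (cov Y X * expectation (\<lambda>w. F w * L w ^ n)
        + cov Y L * (real n * expectation (\<lambda>w. F w * X w * L w ^ (n - 1))))) (at 0)"
    unfolding eq by (rule derivative_eq_intros d2 d3 refl)+ (simp add: algebra_simps)
  from DERIV_unique[OF d1 this]
  have "real (Suc n) * expectation (\<lambda>w. Y w * F w * X w * L w ^ n)
      = real (Suc n) * (expectation (\<lambda>w. D Y w * X w * L w ^ n) + cov Y X * expectation (\<lambda>w. F w * L w ^ n)
        + cov Y L * (real n * expectation (\<lambda>w. F w * X w * L w ^ (n - 1))))"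
    by (simp add: algebra_simps)
  then have main: "expectation (\<lambda>w. Y w * F w * X w * L w ^ n)
      = expectation (\<lambda>w. D Y w * X w * L w ^ n) + cov Y X * expectation (\<lambda>w. F w * L w ^ n)
        + cov Y L * (real n * expectation (\<lambda>w. F w * X w * L w ^ (n - 1)))"
    unfolding mult_cancel_left by simp
  have "expectation (\<lambda>w. cov Y X * (F w * L w ^ n) + D Y w * X w * L w ^ n)
      = cov Y X * expectation (\<lambda>w. F w * L w ^ n) + expectation (\<lambda>w. D Y w * X w * L w ^ n)"
    by (subst Bochner_Integration.integral_add)
      (auto intro!: has_all_moments_integrable has_all_moments_scale has_all_moments_mult has_all_moments_power
        aF aL aX aD Y)
  then show "expectation (\<lambda>w. Y w * (X w * F w) * L w ^ n)
      = expectation (\<lambda>w. (cov Y X * F w + X w * D Y w) * L w ^ n)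
        + real n * cov Y L * expectation (\<lambda>w. X w * F w * L w ^ (n - 1))"
    using main by (simp add: algebra_simps)
qed

lemma ibp_linear:
  assumes F: "ibp F D" and G: "ibp G E"
  shows "ibp (\<lambda>w. F w + c * G w) (\<lambda>Y w. D Y w + c * E Y w)"
  unfolding ibp_def
proof (intro conjI ballI allI)
  have aF: "has_all_moments M F" "\<And>Y. Y \<in> \<G> \<Longrightarrow> has_all_moments M (D Y)"
    and aG: "has_all_moments M G" "\<And>Y. Y \<in> \<G> \<Longrightarrow> has_all_moments M (E Y)"
    using F G by (auto simp: ibp_def)
  show "has_all_moments M (\<lambda>w. F w + c * G w)"
    by (intro has_all_moments_add has_all_moments_scale aF aG)
  fix Y assume Y: "Y \<in> \<G>"
  show "has_all_moments M (\<lambda>w. D Y w + c * E Y w)"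
    by (intro has_all_moments_add has_all_moments_scale aF aG Y)
  fix L n assume L: "L \<in> \<G>"
  have lin: "expectation (\<lambda>w. (A w + c * B w) * L w ^ k)
      = expectation (\<lambda>w. A w * L w ^ k) + c * expectation (\<lambda>w. B w * L w ^ k)"
    if "has_all_moments M A" "has_all_moments M B" for A B k
  proof -
    have "integrable M (\<lambda>w. A w * L w ^ k)" "integrable M (\<lambda>w. B w * L w ^ k)"
      by (intro has_all_moments_integrable has_all_moments_mult has_all_moments_power has_all_moments L that)+
    then show ?thesis by (simp add: distrib_right mult.assoc)
  qed
  have "expectation (\<lambda>w. Y w * (F w + c * G w) * L w ^ n)
      = expectation (\<lambda>w. Y w * F w * L w ^ n) + c * expectation (\<lambda>w. Y w * G w * L w ^ n)"
    using lin[OF has_all_moments_mult[OF has_all_moments[OF Y] aF(1)]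
        has_all_moments_mult[OF has_all_moments[OF Y] aG(1)], of n]
    by (simp add: algebra_simps)
  also have "\<dots> = (expectation (\<lambda>w. D Y w * L w ^ n) + real n * cov Y L * expectation (\<lambda>w. F w * L w ^ (n - 1)))
      + c * (expectation (\<lambda>w. E Y w * L w ^ n) + real n * cov Y L * expectation (\<lambda>w. G w * L w ^ (n - 1)))"
    using F G Y L by (simp add: ibp_def)
  also have "\<dots> = expectation (\<lambda>w. (D Y w + c * E Y w) * L w ^ n)
      + real n * cov Y L * expectation (\<lambda>w. (F w + c * G w) * L w ^ (n - 1))"
    unfolding lin[OF aF(2)[OF Y] aG(2)[OF Y]] lin[OF aF(1) aG(1)] by (simp add: algebra_simps)
  finally show "expectation (\<lambda>w. Y w * (F w + c * G w) * L w ^ n)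
      = expectation (\<lambda>w. (D Y w + c * E Y w) * L w ^ n)
      + real n * cov Y L * expectation (\<lambda>w. (F w + c * G w) * L w ^ (n - 1))" .
qed

text \<open>The three-term recurrence makes the derivative of the polynomial of index
  \<open>q\<close> equal to \<open>q\<close> times the preceding one. The factor \<open>F\<close> is
  arbitrary so that products can be built one factor at a time.\<close>

lemma ibp_hermite:
  assumes F: "ibp F D" and X: "X \<in> \<G>"
  shows "ibp (\<lambda>w. hermite q (X w) * F w)
    (\<lambda>Y w. real q * cov Y X * hermite (q - 1) (X w) * F w + hermite q (X w) * D Y w)"
proof (induction q rule: less_induct)
  case (less q)
  show ?case
  proof (cases q rule: hermite.cases[of "(q, 0)" for q, simplified])
    case 1
    then show ?thesis using F by simp
  next
    case 2
    then show ?thesis using ibp_mult[OF F X] by simp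
  next
    case (3 n)
    have "ibp (\<lambda>w. X w * (hermite (Suc n) (X w) * F w) + (- real (Suc n)) * (hermite n (X w) * F w))
      (\<lambda>Y w. (cov Y X * (hermite (Suc n) (X w) * F w) + X w *
          (real (Suc n) * cov Y X * hermite (Suc n - 1) (X w) * F w + hermite (Suc n) (X w) * D Y w))
        + (- real (Suc n)) * (real n * cov Y X * hermite (n - 1) (X w) * F w + hermite n (X w) * D Y w))"
      using 3 by (intro ibp_linear ibp_mult less.IH X) auto
    also have "(\<lambda>w. X w * (hermite (Suc n) (X w) * F w) + (- real (Suc n)) * (hermite n (X w) * F w))
        = (\<lambda>w. hermite q (X w) * F w)"
      by (simp add: 3 algebra_simps)
    also have "(\<lambda>Y w. (cov Y X * (hermite (Suc n) (X w) * F w) + X w *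
          (real (Suc n) * cov Y X * hermite (Suc n - 1) (X w) * F w + hermite (Suc n) (X w) * D Y w))
        + (- real (Suc n)) * (real n * cov Y X * hermite (n - 1) (X w) * F w + hermite n (X w) * D Y w))
      = (\<lambda>Y w. real q * cov Y X * hermite (q - 1) (X w) * F w + hermite q (X w) * D Y w)"
      by (cases n) (simp_all add: 3 algebra_simps)
    finally show ?thesis .
  qed
qed

text \<open>Leibniz's rule. Where \<open>q b = 0\<close> the truncated index \<open>q b - 1\<close>
  is harmless, since its coefficient vanishes.\<close>

lemma ibp_hermite_prod:
  assumes "finite A" "\<And>a. a \<in> A \<Longrightarrow> X a \<in> \<G>"
  shows "ibp (\<lambda>w. \<Prod>a\<in>A. hermite (q a) (X a w))
    (\<lambda>Y w. \<Sum>b\<in>A. real (q b) * cov Y (X b) * (\<Prod>a\<in>A. hermite (if a = b then q a - 1 else q a) (X a w)))"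
  using assms
proof (induction A rule: finite_induct)
  case empty
  then show ?case using ibp_one by simp
next
  case (insert x A)
  have IH: "ibp (\<lambda>w. \<Prod>a\<in>A. hermite (q a) (X a w))
    (\<lambda>Y w. \<Sum>b\<in>A. real (q b) * cov Y (X b) * (\<Prod>a\<in>A. hermite (if a = b then q a - 1 else q a) (X a w)))"
    using insert by auto
  have neq: "(\<Prod>a\<in>A. hermite (if a = x then q a - 1 else q a) (X a w)) = (\<Prod>a\<in>A. hermite (q a) (X a w))" for w
    by (rule prod.cong) (use insert.hyps in auto)
  have "(\<Sum>b\<in>A. real (q b) * cov Y (X b) * (hermite (if x = b then q x - 1 else q x) (X x w) *
        (\<Prod>a\<in>A. hermite (if a = b then q a - 1 else q a) (X a w))))
      = hermite (q x) (X x w) * (\<Sum>b\<in>A. real (q b) * cov Y (X b) *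
        (\<Prod>a\<in>A. hermite (if a = b then q a - 1 else q a) (X a w)))" for Y w
    unfolding sum_distrib_left by (rule sum.cong) (use insert.hyps in auto)
  then show ?case
    using ibp_hermite[OF IH insert.prems[of x], of "q x"] insert.hyps by (simp add: neq mult.assoc)
qed

end

section \<open>Multigraphs with prescribed degrees and their recursion\<close>

definition arrays_with :: "nat \<Rightarrow> (nat \<Rightarrow> nat) \<Rightarrow> array set" where
  "arrays_with r q = {N. (\<forall>a b. N a b = N b a) \<and> (\<forall>a. N a a = 0) \<and> (\<forall>a b. r \<le> a \<longrightarrow> N a b = 0) \<and>
     (\<forall>a<r. row_sum r N a = q a)}"

lemma array_entry_le_row_sum:
  assumes "a < r" "b < r" "a \<noteq> b"
  shows "N a b \<le> row_sum r N a"
  unfolding row_sum_def by (rule member_le_sum) (use assms in auto)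

lemma finite_arrays: "finite (arrays r m)"
proof (rule finite_subset)
  let ?S = "{g. (\<forall>p. (p \<in> {..<r} \<times> {..<r} \<longrightarrow> g p \<in> {..m}) \<and> (p \<notin> {..<r} \<times> {..<r} \<longrightarrow> g p = 0))}"
  show "arrays r m \<subseteq> curry ` ?S"
  proof
    fix N assume N: "N \<in> arrays r m"
    have le: "N a b \<le> m" if "a < r" "b < r" for a b
      using N array_entry_le_row_sum[of a r b N] that by (cases "a = b") (auto simp: arrays_def intro: le_trans)
    have zero: "N a b = 0" if "\<not> (a < r \<and> b < r)" for a b
      using N that by (auto simp: arrays_def not_less)
    have "N = curry (\<lambda>(a, b). N a b)" by (simp add: fun_eq_iff)
    moreover have "(\<lambda>(a, b). N a b) \<in> ?S" using le zero by auto
    ultimately show "N \<in> curry ` ?S" by (rule image_eqI)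
  qed
  show "finite (curry ` ?S)" by (intro finite_imageI finite_set_of_finite_funs) auto
qed

lemma arrays_with_subset:
  assumes "\<And>a. a < r \<Longrightarrow> q a \<le> m"
  shows "arrays_with r q \<subseteq> arrays r m"
  using assms by (auto simp: arrays_with_def arrays_def)

lemma finite_arrays_with: "finite (arrays_with r q)"
  by (rule finite_subset[OF arrays_with_subset finite_arrays[of r "Max (q ` {..<r})"]]) simp

text \<open>Comparing unordered pairs raises the entries at \<open>(a, b)\<close> and
  \<open>(b, a)\<close> together, so that symmetry survives.\<close>

definition bump :: "nat \<Rightarrow> nat \<Rightarrow> array \<Rightarrow> array" where
  "bump a b N = (\<lambda>x y. if {x, y} = {a, b} then Suc (N x y) else N x y)"

lemma row_sum_bump:
  assumes "a < r" "b < r" "a \<noteq> b" "x < r"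
  shows "row_sum r (bump a b N) x = row_sum r N x + (if x = a \<or> x = b then 1 else 0)"
proof -
  have "row_sum r (bump a b N) x = (\<Sum>y\<in>{..<r} - {x}. N x y + (if {x, y} = {a, b} then 1 else 0))"
    unfolding row_sum_def bump_def by (rule sum.cong) auto
  also have "\<dots> = row_sum r N x + (\<Sum>y\<in>{..<r} - {x}. if {x, y} = {a, b} then 1 else 0)"
    by (simp add: sum.distrib row_sum_def)
  also have "(\<Sum>y\<in>{..<r} - {x}. if {x, y} = {a, b} then 1 else 0)
      = (\<Sum>y\<in>{..<r} - {x}. if y = (if x = a then b else a) then if x = a \<or> x = b then 1 else 0 else (0::nat))"
    by (rule sum.cong) (auto simp: doubleton_eq_iff)
  also have "\<dots> = (if x = a \<or> x = b then 1 else 0)"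
    using assms by (auto simp: sum.delta)
  finally show ?thesis .
qed

text \<open>Removing an edge undoes adding one; \<open>0 < N a b\<close> keeps the subtraction from
  being truncated. The degrees after a removal are found by adding the edge back.\<close>

lemma bump_bij:
  assumes "a < r" "b < r" "a \<noteq> b" "0 < q a" "0 < q b"
  shows "bij_betw (bump a b) (arrays_with r (q(a := q a - 1, b := q b - 1))) {N \<in> arrays_with r q. 0 < N a b}"
proof (rule bij_betw_byWitness[where f' = "\<lambda>N x y. if {x, y} = {a, b} then N x y - 1 else N x y"])
  let ?u = "\<lambda>N x y. if {x, y} = {a, b} then N x y - 1 else N x y :: nat"
  show "\<forall>N\<in>arrays_with r (q(a := q a - 1, b := q b - 1)). ?u (bump a b N) = N"
    by (auto simp: bump_def fun_eq_iff)
  have sym: "N x y = N y x" if "N \<in> arrays_with r q" for N x y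
    using that by (auto simp: arrays_with_def)
  have undo: "bump a b (?u N) = N" if "N \<in> {N \<in> arrays_with r q. 0 < N a b}" for N
  proof (intro ext)
    fix x y
    show "bump a b (?u N) x y = N x y"
      using that sym[of N a b] by (auto simp: bump_def doubleton_eq_iff)
  qed
  then show "\<forall>N\<in>{N \<in> arrays_with r q. 0 < N a b}. bump a b (?u N) = N" by blast
  show "bump a b ` arrays_with r (q(a := q a - 1, b := q b - 1)) \<subseteq> {N \<in> arrays_with r q. 0 < N a b}"
  proof safe
    fix N assume N: "N \<in> arrays_with r (q(a := q a - 1, b := q b - 1))"
    show "0 < bump a b N a b" by (simp add: bump_def)
    have "row_sum r (bump a b N) x = q x" if "x < r" for x
      using N that assms row_sum_bump[OF assms(1-3) that, of N] by (auto simp: arrays_with_def)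
    moreover have "bump a b N x y = bump a b N y x" for x y
      using N by (auto simp: arrays_with_def bump_def insert_commute)
    moreover have "bump a b N x x = 0" for x
      using N assms(3) by (auto simp: arrays_with_def bump_def doubleton_eq_iff)
    moreover have "bump a b N x y = 0" if "r \<le> x" for x y
      using N assms(1,2) that by (auto simp: arrays_with_def bump_def doubleton_eq_iff)
    ultimately show "bump a b N \<in> arrays_with r q"
      by (simp add: arrays_with_def)
  qed
  show "?u ` {N \<in> arrays_with r q. 0 < N a b} \<subseteq> arrays_with r (q(a := q a - 1, b := q b - 1))"
  proof (rule image_subsetI)
    fix N assume N': "N \<in> {N \<in> arrays_with r q. 0 < N a b}"
    then have N: "N \<in> arrays_with r q" by simp
    have rows: "row_sum r (?u N) x = (q(a := q a - 1, b := q b - 1)) x" if "x < r" for x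
    proof -
      have "row_sum r N x = row_sum r (?u N) x + (if x = a \<or> x = b then 1 else 0)"
        using row_sum_bump[OF assms(1-3) that, of "?u N"] undo[OF N'] by simp
      then show ?thesis using N that assms(3) by (auto simp: arrays_with_def)
    qed
    have "?u N x y = ?u N y x" for x y
      using N by (auto simp: arrays_with_def insert_commute)
    moreover have "?u N x x = 0" for x
      using N by (auto simp: arrays_with_def)
    moreover have "?u N x y = 0" if "r \<le> x" for x y
      using N that by (auto simp: arrays_with_def)
    ultimately show "?u N \<in> arrays_with r (q(a := q a - 1, b := q b - 1))"
      using rows unfolding arrays_with_def by blast
  qed
qed

abbreviation vertex_pairs :: "nat \<Rightarrow> (nat \<times> nat) set" where
  "vertex_pairs r \<equiv> {(a, b). a < b \<and> b < r}"

lemma finite_vertex_pairs: "finite (vertex_pairs r)"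
  by (rule finite_subset[of _ "{..<r} \<times> {..<r}"]) auto

text \<open>These are the coefficients in the expansion of the exponential of the sum of
  \<open>c a b * t a * t b\<close> over pairs, the generating function of expected Hermite products
  of variables with unit variance.\<close>

definition edge_weight :: "nat \<Rightarrow> (nat \<Rightarrow> nat \<Rightarrow> real) \<Rightarrow> array \<Rightarrow> real" where
  "edge_weight r c N = (\<Prod>(a, b)\<in>vertex_pairs r. c a b ^ N a b / fact (N a b))"

lemma edge_weight_bump:
  assumes "a < r" "b < r" "a \<noteq> b" and c: "\<And>x y. c x y = c y x" and N: "\<And>x y. N x y = N y x"
  shows "real (Suc (N a b)) * edge_weight r c (bump a b N) = c a b * edge_weight r c N"
proof -
  \<comment> \<open>The weight ranges over increasing pairs, so the ends of the new edge have to be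
    sorted.\<close>
  let ?p = "(min a b, max a b)"
  have p: "?p \<in> vertex_pairs r" using assms(1-3) by auto
  have rest: "(\<Prod>(x, y)\<in>vertex_pairs r - {?p}. c x y ^ bump a b N x y / fact (bump a b N x y))
      = (\<Prod>(x, y)\<in>vertex_pairs r - {?p}. c x y ^ N x y / fact (N x y))"
    by (rule prod.cong[OF refl]) (auto simp: bump_def doubleton_eq_iff min_def max_def split: if_splits)
  have "c (min a b) (max a b) = c a b" "N (min a b) (max a b) = N a b"
    "bump a b N (min a b) (max a b) = Suc (N a b)"
    using c N by (auto simp: bump_def min_def max_def doubleton_eq_iff)
  then show ?thesis
    unfolding edge_weight_def prod.remove[OF finite_vertex_pairs p] rest
    by (simp add: divide_simps del: of_nat_Suc)
qed

text \<open>The degree \<open>q a\<close> is the sum of the multiplicities \<open>N a b\<close>, and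
  weighting by a multiplicity amounts to deleting one edge from \<open>a\<close> to
  \<open>b\<close>. Integration by parts yields the same recursion for the expectations.\<close>

lemma arrays_with_recursion:
  assumes a: "a < r" "0 < q a" and c: "\<And>x y. c x y = c y x"
  shows "real (q a) * (\<Sum>N\<in>arrays_with r q. edge_weight r c N)
    = (\<Sum>b\<in>{b \<in> {..<r} - {a}. 0 < q b}. c a b * (\<Sum>N\<in>arrays_with r (q(a := q a - 1, b := q b - 1)). edge_weight r c N))"
proof -
  have "real (q a) * (\<Sum>N\<in>arrays_with r q. edge_weight r c N)
      = (\<Sum>N\<in>arrays_with r q. \<Sum>b\<in>{..<r} - {a}. real (N a b) * edge_weight r c N)"
    unfolding sum_distrib_left
  proof (rule sum.cong[OF refl])
    fix N assume "N \<in> arrays_with r q"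
    then have "row_sum r N a = q a"
      using a by (auto simp: arrays_with_def)
    then have "q a = (\<Sum>b\<in>{..<r} - {a}. N a b)"
      by (simp only: row_sum_def)
    then show "real (q a) * edge_weight r c N = (\<Sum>b\<in>{..<r} - {a}. real (N a b) * edge_weight r c N)"
      by (simp add: sum_distrib_right)
  qed
  also have "\<dots> = (\<Sum>b\<in>{..<r} - {a}. \<Sum>N\<in>arrays_with r q. real (N a b) * edge_weight r c N)"
    by (rule sum.swap)
  also have "\<dots> = (\<Sum>b\<in>{..<r} - {a}. \<Sum>N\<in>{N \<in> arrays_with r q. 0 < N a b}. real (N a b) * edge_weight r c N)"
    by (intro sum.cong[OF refl] sum.mono_neutral_right) (auto simp: finite_arrays_with)
  \<comment> \<open>A vertex of degree 0 carries no edge. Its terms have to go before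
    \<open>q b - 1\<close> appears, where the subtraction would be truncated.\<close>
  also have "\<dots> = (\<Sum>b\<in>{b \<in> {..<r} - {a}. 0 < q b}. \<Sum>N\<in>{N \<in> arrays_with r q. 0 < N a b}. real (N a b) * edge_weight r c N)"
  proof (rule sum.mono_neutral_right)
    show "\<forall>b\<in>({..<r} - {a}) - {b \<in> {..<r} - {a}. 0 < q b}.
        (\<Sum>N\<in>{N \<in> arrays_with r q. 0 < N a b}. real (N a b) * edge_weight r c N) = 0"
    proof
      fix b assume b: "b \<in> ({..<r} - {a}) - {b \<in> {..<r} - {a}. 0 < q b}"
      have none: "{N \<in> arrays_with r q. 0 < N a b} = {}"
      proof (rule ccontr)
        assume "\<not> ?thesis"
        then obtain N where N: "N \<in> arrays_with r q" "0 < N a b" by blast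
        have "N b a \<le> row_sum r N b" using a b by (intro array_entry_le_row_sum) auto
        then show False using N b by (auto simp: arrays_with_def)
      qed
      show "(\<Sum>N\<in>{N \<in> arrays_with r q. 0 < N a b}. real (N a b) * edge_weight r c N) = 0"
        unfolding none by simp
    qed
  qed auto
  also have "\<dots> = (\<Sum>b\<in>{b \<in> {..<r} - {a}. 0 < q b}. c a b * (\<Sum>N\<in>arrays_with r (q(a := q a - 1, b := q b - 1)). edge_weight r c N))"
  proof (rule sum.cong[OF refl])
    fix b assume b: "b \<in> {b \<in> {..<r} - {a}. 0 < q b}"
    let ?q = "q(a := q a - 1, b := q b - 1)"
    have "(\<Sum>N\<in>{N \<in> arrays_with r q. 0 < N a b}. real (N a b) * edge_weight r c N)
        = (\<Sum>N\<in>arrays_with r ?q. real (bump a b N a b) * edge_weight r c (bump a b N))"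
      by (rule sum.reindex_bij_betw[symmetric], rule bump_bij) (use a b in auto)
    also have "\<dots> = (\<Sum>N\<in>arrays_with r ?q. c a b * edge_weight r c N)"
    proof (rule sum.cong[OF refl])
      fix N assume N: "N \<in> arrays_with r ?q"
      have "real (Suc (N a b)) * edge_weight r c (bump a b N) = c a b * edge_weight r c N"
        by (rule edge_weight_bump) (use a b c N in \<open>auto simp: arrays_with_def\<close>)
      then show "real (bump a b N a b) * edge_weight r c (bump a b N) = c a b * edge_weight r c N"
        by (simp add: bump_def)
    qed
    finally show "(\<Sum>N\<in>{N \<in> arrays_with r q. 0 < N a b}. real (N a b) * edge_weight r c N)
        = c a b * (\<Sum>N\<in>arrays_with r ?q. edge_weight r c N)"
      by (simp add: sum_distrib_left)
  qed
  finally show ?thesis .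
qed

text \<open>Induction on the total degree. Split off a factor \<open>X a\<close> by the Hermite
  recurrence and integrate it by parts: the term \<open>b = a\<close> cancels the subtracted term of
  the recurrence because the variance is 1, and the other terms form the recursion of the weighted
  multigraphs. Unit variance is demanded only where \<open>q a\<close> is positive, so that a vertex
  of degree 0 may carry any variable.\<close>

lemma (in gaussian_space) hermite_diagram:
  assumes "\<And>a. a < r \<Longrightarrow> X a \<in> \<G>" "\<And>a. a < r \<Longrightarrow> 0 < q a \<Longrightarrow> cov (X a) (X a) = 1"
  shows "expectation (\<lambda>w. \<Prod>a<r. hermite (q a) (X a w))
    = (\<Prod>a<r. fact (q a)) * (\<Sum>N\<in>arrays_with r q. edge_weight r (\<lambda>a b. cov (X a) (X b)) N)"
  using assms(2)
proof (induction "\<Sum>a<r. q a" arbitrary: q rule: less_induct)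
  case less
  let ?c = "\<lambda>a b. cov (X a) (X b)"
  show ?case
  proof (cases "\<forall>a<r. q a = 0")
    case True
    have "arrays_with r q = {\<lambda>_ _. 0}"
    proof (intro equalityI subsetI)
      fix N assume N: "N \<in> arrays_with r q"
      have "N a b = 0" for a b
      proof (cases "a < r \<and> b < r \<and> a \<noteq> b")
        case True
        then have "N a b \<le> row_sum r N a" using array_entry_le_row_sum by blast
        then show ?thesis using N True \<open>\<forall>a<r. q a = 0\<close> by (auto simp: arrays_with_def)
      next
        case False
        then show ?thesis using N by (auto simp: arrays_with_def not_less)
      qed
      then show "N \<in> {\<lambda>_ _. 0}" by auto
    qed (use True in \<open>auto simp: arrays_with_def row_sum_def\<close>)
    then show ?thesis using True by (simp add: edge_weight_def prob_space)
  next
    case False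
    then obtain a where a: "a < r" "0 < q a" by auto
    then obtain p where p: "q a = Suc p" by (cases "q a") auto
    let ?H = "\<lambda>q w. \<Prod>b<r. hermite (q b) (X b w)"
    have am: "has_all_moments M (?H q)" for q
      by (intro has_all_moments_prod has_all_moments_hermite has_all_moments assms(1)) auto
    let ?low = "q(a := p)"
    let ?D = "\<lambda>b. \<lambda>c. if c = b then ?low c - 1 else ?low c"
    have split: "?H q' w = hermite (q' a) (X a w) * (\<Prod>b\<in>{..<r} - {a}. hermite (q' b) (X b w))" for q' w
      using a by (intro prod.remove) auto
    have step: "?H q w = X a w * ?H ?low w - real p * ?H (q(a := p - 1)) w" for w
    proof -
      have same: "(\<Prod>b\<in>{..<r} - {a}. hermite ((q(a := k)) b) (X b w)) = (\<Prod>b\<in>{..<r} - {a}. hermite (q b) (X b w))" for k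
        by (rule prod.cong) auto
      show ?thesis
        unfolding split same by (cases p) (auto simp: p algebra_simps)
    qed
    have ibp: "expectation (\<lambda>w. X a w * ?H ?low w)
        = expectation (\<lambda>w. \<Sum>b<r. real (?low b) * cov (X a) (X b) * ?H (?D b) w)"
      using ibp_expectation[OF ibp_hermite_prod[of "{..<r}" X ?low], of "X a"] assms(1) a by auto
    also have "\<dots> = (\<Sum>b<r. real (?low b) * cov (X a) (X b) * expectation (?H (?D b)))"
      using has_all_moments_integrable[OF am] by simp
    also have "\<dots> = real p * expectation (?H (q(a := p - 1)))
        + (\<Sum>b\<in>{..<r} - {a}. real (q b) * cov (X a) (X b) * expectation (?H (q(a := q a - 1, b := q b - 1))))"
    proof (subst sum.remove[of _ a])
      have D: "?D a c = (q(a := p - 1)) c" for c by auto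
      moreover have "cov (X a) (X a) = 1" using less.prems a by blast
      moreover have "(\<Sum>b\<in>{..<r} - {a}. real (?low b) * cov (X a) (X b) * expectation (?H (?D b)))
          = (\<Sum>b\<in>{..<r} - {a}. real (q b) * cov (X a) (X b) * expectation (?H (q(a := q a - 1, b := q b - 1))))"
      proof (rule sum.cong[OF refl])
        fix b assume "b \<in> {..<r} - {a}"
        then have "?D b c = (q(a := q a - 1, b := q b - 1)) c" "?low b = q b" for c
          by (auto simp: p)
        then show "real (?low b) * cov (X a) (X b) * expectation (?H (?D b))
            = real (q b) * cov (X a) (X b) * expectation (?H (q(a := q a - 1, b := q b - 1)))" by (simp only:)
      qed
      ultimately show "real (?low a) * cov (X a) (X a) * expectation (?H (?D a))
          + (\<Sum>b\<in>{..<r} - {a}. real (?low b) * cov (X a) (X b) * expectation (?H (?D b)))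
          = real p * expectation (?H (q(a := p - 1)))
          + (\<Sum>b\<in>{..<r} - {a}. real (q b) * cov (X a) (X b) * expectation (?H (q(a := q a - 1, b := q b - 1))))"
        by (simp only: D fun_upd_same mult_1_right)
    qed (use a in auto)
    finally have "expectation (\<lambda>w. X a w * ?H ?low w) = real p * expectation (?H (q(a := p - 1)))
        + (\<Sum>b\<in>{..<r} - {a}. real (q b) * cov (X a) (X b) * expectation (?H (q(a := q a - 1, b := q b - 1))))" .
    moreover have "expectation (?H q) = expectation (\<lambda>w. X a w * ?H ?low w) - real p * expectation (?H (q(a := p - 1)))"
      unfolding step using has_all_moments_integrable[OF am]
        has_all_moments_integrable[OF has_all_moments_mult[OF has_all_moments[OF assms(1)[OF a(1)]] am[of ?low]]]
      by simp
    ultimately have "expectation (?H q) = (\<Sum>b\<in>{..<r} - {a}. real (q b) * ?c a b * expectation (?H (q(a := q a - 1, b := q b - 1))))"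
      by simp
    also have "\<dots> = (\<Sum>b\<in>{b \<in> {..<r} - {a}. 0 < q b}. real (q b) * ?c a b * expectation (?H (q(a := q a - 1, b := q b - 1))))"
      by (rule sum.mono_neutral_right) auto
    also have "\<dots> = (\<Sum>b\<in>{b \<in> {..<r} - {a}. 0 < q b}. (\<Prod>x<r. fact (q x)) / real (q a) *
        (?c a b * (\<Sum>N\<in>arrays_with r (q(a := q a - 1, b := q b - 1)). edge_weight r ?c N)))"
    proof (rule sum.cong[OF refl])
      fix b assume b: "b \<in> {b \<in> {..<r} - {a}. 0 < q b}"
      let ?q = "q(a := q a - 1, b := q b - 1)"
      have "(\<Sum>x<r. ?q x) < (\<Sum>x<r. q x)"
        by (rule sum_strict_mono_ex1) (use a b in \<open>auto intro!: bexI[of _ a]\<close>)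
      moreover have "cov (X x) (X x) = 1" if "x < r" "0 < ?q x" for x
        by (rule less.prems) (use that a b in \<open>auto split: if_splits\<close>)
      ultimately have IH: "expectation (?H ?q) = (\<Prod>x<r. fact (?q x)) * (\<Sum>N\<in>arrays_with r ?q. edge_weight r ?c N)"
        by (rule less.hyps)
      have ab: "a \<in> {..<r}" "b \<in> {..<r} - {a}" using a b by auto
      have facts: "(\<Prod>x<r. fact (q' x)) = (fact (q' a) * (fact (q' b) * (\<Prod>x\<in>{..<r} - {a} - {b}. fact (q' x))) :: real)" for q'
        using ab by (subst prod.remove[of _ a], simp, simp, subst prod.remove[of _ b]) auto
      have rest: "(\<Prod>x\<in>{..<r} - {a} - {b}. fact (?q x)) = (\<Prod>x\<in>{..<r} - {a} - {b}. fact (q x) :: real)"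
        by (rule prod.cong) auto
      have fa: "fact (q a) = real (q a) * fact (q a - 1)" "fact (q b) = real (q b) * fact (q b - 1)"
        using a b by (auto simp: fact_reduce)
      \<comment> \<open>Lowering both degrees removes the factors \<open>q a\<close> and
        \<open>q b\<close> from the factorials: \<open>q b\<close> is the coefficient from
        integration by parts, \<open>q a\<close> the one in
        \<open>arrays_with_recursion\<close>.\<close>
      have "(\<Prod>x<r. fact (q x)) / real (q a) = real (q b) * (\<Prod>x<r. fact (?q x))"
        unfolding facts rest using a b by (simp add: fa)
      then show "real (q b) * ?c a b * expectation (?H ?q) = (\<Prod>x<r. fact (q x)) / real (q a) *
          (?c a b * (\<Sum>N\<in>arrays_with r ?q. edge_weight r ?c N))"
        unfolding IH by simp
    qed
    also have "\<dots> = (\<Prod>x<r. fact (q x)) / real (q a) * (real (q a) * (\<Sum>N\<in>arrays_with r q. edge_weight r ?c N))"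
      unfolding sum_distrib_left[symmetric]
      by (subst arrays_with_recursion[of a r q ?c]) (use a cov_commute in auto)
    finally show ?thesis using a by simp
  qed
qed

section \<open>The Gram matrix\<close>

lemma laplacian_form:
  assumes N: "\<And>a b. N a b = N b a" "\<And>a. N a a = 0"
  shows "(\<Sum>a<r. \<Sum>b<r. x a * laplacian r N a b * x b)
    = (\<Sum>(a, b)\<in>vertex_pairs r. real (N a b) * (x a - x b)\<^sup>2)"
proof -
  let ?g = "\<lambda>a b. real (N a b) * (x a - x b)\<^sup>2"
  have row: "(\<Sum>b<r. x a * laplacian r N a b * x b) = (\<Sum>b<r. real (N a b) * ((x a)\<^sup>2 - x a * x b))" if "a < r" for a
  proof -
    have "(\<Sum>b<r. x a * laplacian r N a b * x b)
        = real (row_sum r N a) * (x a)\<^sup>2 + (\<Sum>b\<in>{..<r} - {a}. - (real (N a b) * (x a * x b)))"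
      using that by (subst sum.remove[of _ a]) (auto simp: laplacian_def power2_eq_square intro!: sum.cong)
    also have "\<dots> = (\<Sum>b\<in>{..<r} - {a}. real (N a b) * ((x a)\<^sup>2 - x a * x b))"
      by (simp add: row_sum_def sum_distrib_left algebra_simps sum_subtractf sum_negf)
    also have "\<dots> = (\<Sum>b<r. real (N a b) * ((x a)\<^sup>2 - x a * x b))"
      using that N(2) by (subst (2) sum.remove[of _ a]) auto
    finally show ?thesis .
  qed
  have swap: "(\<Sum>a<r. \<Sum>b<r. real (N a b) * (x b)\<^sup>2) = (\<Sum>a<r. \<Sum>b<r. real (N a b) * (x a)\<^sup>2)"
    by (subst sum.swap) (use N(1) in simp)
  \<comment> \<open>Doubling turns the form into a symmetric sum over ordered pairs, which splits
    into increasing pairs and their reversals.\<close>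
  have "2 * (\<Sum>a<r. \<Sum>b<r. x a * laplacian r N a b * x b)
      = (\<Sum>a<r. \<Sum>b<r. 2 * (real (N a b) * ((x a)\<^sup>2 - x a * x b)))"
    by (simp add: row sum_distrib_left)
  also have "\<dots> = (\<Sum>a<r. \<Sum>b<r. real (N a b) * (x a)\<^sup>2) + (\<Sum>a<r. \<Sum>b<r. real (N a b) * (x b)\<^sup>2)
      - (\<Sum>a<r. \<Sum>b<r. 2 * (real (N a b) * (x a * x b)))"
    unfolding swap by (simp add: sum.distrib[symmetric] sum_subtractf[symmetric] algebra_simps)
  also have "\<dots> = (\<Sum>a<r. \<Sum>b<r. ?g a b)"
    by (simp add: sum.distrib[symmetric] sum_subtractf[symmetric] algebra_simps power2_eq_square)
  also have "\<dots> = (\<Sum>(a, b)\<in>{..<r} \<times> {..<r}. ?g a b)"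
    by (simp add: sum.cartesian_product)
  also have "\<dots> = (\<Sum>(a, b)\<in>vertex_pairs r \<union> prod.swap ` vertex_pairs r. ?g a b)"
    by (rule sum.mono_neutral_right) (auto simp: N(2) image_iff, metis nat_neq_iff)
  also have "\<dots> = (\<Sum>(a, b)\<in>vertex_pairs r. ?g a b) + (\<Sum>(a, b)\<in>prod.swap ` vertex_pairs r. ?g a b)"
    by (rule sum.union_disjoint) (auto intro: finite_vertex_pairs)
  also have "(\<Sum>(a, b)\<in>prod.swap ` vertex_pairs r. ?g a b) = (\<Sum>(a, b)\<in>vertex_pairs r. ?g a b)"
    by (subst sum.reindex) (auto simp: case_prod_unfold N(1) power2_commute intro!: sum.cong)
  finally show ?thesis by simp
qed

text \<open>Real coefficients are allowed so that the difference of two arrays is covered.\<close>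

definition edge_form :: "nat \<Rightarrow> (nat \<Rightarrow> nat \<Rightarrow> real) \<Rightarrow> (nat \<Rightarrow> real) \<Rightarrow> real" where
  "edge_form r D x = (\<Sum>(a, b)\<in>vertex_pairs r. D a b * (x a - x b)\<^sup>2)"

lemma chi_eq:
  assumes "N \<in> arrays r m"
  shows "chi r N x = exp (- edge_form r (\<lambda>a b. real (N a b)) x)"
  unfolding chi_def edge_form_def by (subst laplacian_form) (use assms in \<open>auto simp: arrays_def\<close>)

lemma edge_form_line:
  "edge_form r D (\<lambda>a. x a + t * y a)
    = edge_form r D x + t * (\<Sum>(a, b)\<in>vertex_pairs r. 2 * D a b * (x a - x b) * (y a - y b)) + t\<^sup>2 * edge_form r D y"
  unfolding edge_form_def sum_distrib_left sum.distrib[symmetric]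
  by (rule sum.cong) (auto simp: algebra_simps power2_eq_square)

text \<open>Polarization at two coordinate vectors recovers the coefficient of a pair.\<close>

lemma edge_form_nonzero:
  assumes p: "(a, b) \<in> vertex_pairs r" and D: "D a b \<noteq> 0"
  shows "\<exists>x. edge_form r D x \<noteq> 0"
proof (rule ccontr)
  assume "\<not> ?thesis"
  then have zero: "edge_form r D x = 0" for x by blast
  let ?e = "\<lambda>a c. if c = a then 1 else 0 :: real"
  have "0 = (\<Sum>(c, d)\<in>vertex_pairs r. 2 * D c d * (?e a c - ?e a d) * (?e b c - ?e b d))"
    using edge_form_line[of r D "?e a" 1 "?e b"] by (simp only: zero)
  also have "\<dots> = (\<Sum>(c, d)\<in>{(a, b)}. 2 * D c d * (?e a c - ?e a d) * (?e b c - ?e b d))"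
    by (rule sum.mono_neutral_right) (use p in \<open>auto simp: finite_vertex_pairs split: if_splits\<close>)
  also have "\<dots> = - 2 * D a b" using p by auto
  finally show False using D by simp
qed

text \<open>Along a line from a point good for the old forms, in a direction good for the new one,
  each form is a polynomial in \<open>t\<close> of degree at most 2. It is nonzero, by its constant
  coefficient for an old form and its quadratic one for the new form, so only finitely many
  \<open>t\<close> are bad.\<close>

lemma generic_point:
  assumes "finite I" "\<And>i. i \<in> I \<Longrightarrow> \<exists>x. edge_form r (D i) x \<noteq> 0"
  shows "\<exists>x. \<forall>i\<in>I. edge_form r (D i) x \<noteq> 0"
  using assms
proof (induction I rule: finite_induct)
  case empty
  then show ?case by simp
next
  case (insert j I)
  then obtain x where x: "\<forall>i\<in>I. edge_form r (D i) x \<noteq> 0" by auto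
  obtain y where y: "edge_form r (D j) y \<noteq> 0" using insert.prems by blast
  define p where "p i = [: edge_form r (D i) x,
      (\<Sum>(a, b)\<in>vertex_pairs r. 2 * D i a b * (x a - x b) * (y a - y b)), edge_form r (D i) y :]" for i
  have "p i \<noteq> 0" if "i \<in> insert j I" for i
    using x y that by (auto simp: p_def)
  then have "finite (\<Union>i\<in>insert j I. {t. poly (p i) t = 0})"
    using insert.hyps(1) by (intro finite_UN_I poly_roots_finite) auto
  then obtain t where "t \<notin> (\<Union>i\<in>insert j I. {t. poly (p i) t = 0})"
    using ex_new_if_finite[OF infinite_UNIV_char_0] by blast
  moreover have "poly (p i) t = edge_form r (D i) (\<lambda>a. x a + t * y a)" for i
    by (simp add: p_def edge_form_line algebra_simps power2_eq_square)
  ultimately show ?case by auto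
qed

text \<open>Divide by the exponential of smallest rate among those with nonzero coefficient and let
  \<open>s\<close> tend to infinity: only that coefficient survives.\<close>

lemma exp_independent:
  fixes v q :: "'i \<Rightarrow> real"
  assumes "finite I" "inj_on q I" and zero: "\<And>s. s \<ge> 0 \<Longrightarrow> (\<Sum>i\<in>I. v i * exp (- (s * q i))) = 0"
  shows "\<forall>i\<in>I. v i = 0"
proof (rule ccontr)
  assume "\<not> ?thesis"
  define J where "J = {i \<in> I. v i \<noteq> 0}"
  have J: "finite J" "J \<noteq> {}" using assms(1) \<open>\<not> _\<close> by (auto simp: J_def)
  obtain k where k: "k \<in> J" "\<And>i. i \<in> J \<Longrightarrow> q k \<le> q i"
    using J by (metis arg_min_if_finite(1) arg_min_least)
  have "((\<lambda>s. \<Sum>i\<in>J. v i * exp (- (s * (q i - q k)))) \<longlongrightarrow> (\<Sum>i\<in>J. if i = k then v k else 0)) at_top"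
  proof (rule tendsto_sum)
    fix i assume i: "i \<in> J"
    show "((\<lambda>s. v i * exp (- (s * (q i - q k)))) \<longlongrightarrow> (if i = k then v k else 0)) at_top"
    proof (cases "i = k")
      case False
      then have "q i - q k > 0"
        using k i assms(2) by (force simp: J_def inj_on_def less_le)
      then have "filterlim (\<lambda>s. s * (q i - q k)) at_top at_top"
        by (subst mult.commute) (intro filterlim_tendsto_pos_mult_at_top[OF tendsto_const] filterlim_ident)
      then have "((\<lambda>s. exp (- (s * (q i - q k)))) \<longlongrightarrow> 0) at_top"
        by (intro filterlim_compose[OF exp_at_bot] filterlim_compose[OF filterlim_uminus_at_bot_at_top])
      then show ?thesis using False tendsto_mult_right_zero by fastforce
    qed simp
  qed
  moreover have "eventually (\<lambda>s. (\<Sum>i\<in>J. v i * exp (- (s * (q i - q k)))) = 0) at_top"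
    using eventually_ge_at_top[of 0]
  proof eventually_elim
    case (elim s)
    have "(\<Sum>i\<in>J. v i * exp (- (s * (q i - q k)))) = (\<Sum>i\<in>J. v i * exp (- (s * q i))) * exp (s * q k)"
      unfolding sum_distrib_right by (intro sum.cong refl) (simp add: mult_exp_exp algebra_simps)
    also have "(\<Sum>i\<in>J. v i * exp (- (s * q i))) = (\<Sum>i\<in>I. v i * exp (- (s * q i)))"
      by (rule sum.mono_neutral_left) (auto simp: J_def assms(1))
    finally show ?case using zero[OF elim] by simp
  qed
  ultimately have "((\<lambda>s::real. 0::real) \<longlongrightarrow> (\<Sum>i\<in>J. if i = k then v k else 0)) at_top"
    by (rule Lim_transform_eventually)
  then have "(\<Sum>i\<in>J. if i = k then v k else 0) = 0"
    by (simp add: tendsto_const_iff)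
  then show False using J k by (simp add: J_def)
qed

lemma chi_independent:
  assumes zero: "\<And>x. (\<Sum>N\<in>arrays r m. v N * chi r N x) = 0"
  shows "\<forall>N\<in>arrays r m. v N = 0"
proof -
  define I where "I = {(N, N'). N \<in> arrays r m \<and> N' \<in> arrays r m \<and> N \<noteq> N'}"
  let ?D = "\<lambda>(N, N') a b. real (N a b) - real (N' a b)"
  have "finite I" by (rule finite_subset[of _ "arrays r m \<times> arrays r m"]) (auto simp: I_def finite_arrays)
  moreover have "\<exists>x. edge_form r (?D i) x \<noteq> 0" if iI: "i \<in> I" for i
  proof -
    obtain N N' where i: "i = (N, N')" "N \<in> arrays r m" "N' \<in> arrays r m" "N \<noteq> N'"
      using iI by (cases i) (auto simp: I_def)
    then obtain a b where ab: "N a b \<noteq> N' a b" by (auto simp: fun_eq_iff)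
    have sym: "K x y = K y x" and diag: "K x x = 0" and out: "r \<le> x \<Longrightarrow> K x y = 0"
      if "K \<in> {N, N'}" for K x y
      using i that by (auto simp: arrays_def)
    have "\<exists>c d. (c, d) \<in> vertex_pairs r \<and> N c d \<noteq> N' c d"
    proof (cases a b rule: linorder_cases)
      case less
      have "b < r" using ab out[of N b a] out[of N' b a] sym[of N a b] sym[of N' a b] by (cases "b < r") auto
      then show ?thesis using ab less by blast
    next
      case equal
      then show ?thesis using ab diag[of N b] diag[of N' b] by simp
    next
      case greater
      have "a < r" using ab out[of N a b] out[of N' a b] by (cases "a < r") auto
      moreover have "N b a \<noteq> N' b a" using ab sym[of N a b] sym[of N' a b] by simp
      ultimately show ?thesis using greater by blast
    qed
    then obtain c d where "(c, d) \<in> vertex_pairs r" "?D i c d \<noteq> 0"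
      by (auto simp: i(1))
    then show ?thesis by (rule edge_form_nonzero)
  qed
  ultimately have "\<exists>x. \<forall>i\<in>I. edge_form r (?D i) x \<noteq> 0" by (rule generic_point)
  then obtain x where x: "\<forall>i\<in>I. edge_form r (?D i) x \<noteq> 0" ..
  define q where "q N = edge_form r (\<lambda>a b. real (N a b)) x" for N
  have "edge_form r (?D (N, N')) x = q N - q N'" for N N'
    unfolding q_def edge_form_def sum_subtractf[symmetric] by (rule sum.cong) (auto simp: algebra_simps)
  then have inj: "inj_on q (arrays r m)"
    using x by (fastforce simp: inj_on_def I_def)
  show ?thesis
  proof (rule exp_independent[OF finite_arrays inj])
    fix s :: real assume s: "s \<ge> 0"
    \<comment> \<open>Quadratic homogeneity: the parameter \<open>s\<close> of the exponentials
      corresponds to scaling the point by \<open>sqrt s\<close>.\<close>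
    have scale: "edge_form r D (\<lambda>a. sqrt s * x a) = s * edge_form r D x" for D
      unfolding edge_form_def sum_distrib_left
      by (rule sum.cong) (use s in \<open>auto simp: right_diff_distrib[symmetric] power_mult_distrib\<close>)
    have "chi r N (\<lambda>a. sqrt s * x a) = exp (- (s * q N))" if "N \<in> arrays r m" for N
      unfolding chi_eq[OF that] scale q_def ..
    then show "(\<Sum>N\<in>arrays r m. v N * exp (- (s * q N))) = 0"
      using zero[of "\<lambda>a. sqrt s * x a"] by simp
  qed
qed

section \<open>Helmert coordinates on the centered space\<close>

lemma helmert_span:
  assumes "(\<Sum>a<Suc n. x a) = 0"
  shows "\<exists>z. \<forall>a<Suc n. x a = (\<Sum>k<n. z k * helmert k a)"
  using assms
proof (induction n arbitrary: x)
  case 0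
  then show ?case by simp
next
  case (Suc n)
  \<comment> \<open>Among the vectors in play only \<open>helmert n\<close> is nonzero at the last
    coordinate, so \<open>c\<close> is forced; subtracting that multiple leaves a centered vector
    with one coordinate less.\<close>
  define c where "c = x (Suc n) / helmert n (Suc n)"
  define y where "y a = x a - c * helmert n a" for a
  have nz: "helmert n (Suc n) \<noteq> 0" by (simp add: helmert_def del: of_nat_Suc)
  then have top: "y (Suc n) = 0" by (simp add: y_def c_def)
  have "(\<Sum>a<Suc (Suc n). y a) = 0"
    unfolding y_def sum_subtractf sum_distrib_left[symmetric]
    using Suc.prems helmert_sum_upto[of n "Suc (Suc n)"] by simp
  then have "(\<Sum>a<Suc n. y a) = 0" using top by simp
  then obtain z where z: "\<And>a. a < Suc n \<Longrightarrow> y a = (\<Sum>k<n. z k * helmert k a)" using Suc.IH by blast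
  have "x a = (\<Sum>k<Suc n. (z(n := c)) k * helmert k a)" if "a < Suc (Suc n)" for a
  proof -
    have "(\<Sum>k<n. z k * helmert k a) = y a"
    proof (cases "a = Suc n")
      case True
      have "(\<Sum>k<n. z k * helmert k a) = 0"
        by (rule sum.neutral) (auto simp: True helmert_def)
      then show ?thesis using top True by simp
    qed (use z that in auto)
    then show ?thesis by (simp add: y_def)
  qed
  then show ?case by blast
qed

definition from_helmert :: "nat \<Rightarrow> (nat \<Rightarrow> real) \<Rightarrow> nat \<Rightarrow> real" where
  "from_helmert r z = (\<lambda>a\<in>{..<r}. \<Sum>k<r - 1. z k * helmert k a)"

lemma from_helmert_in: "from_helmert r z \<in> centered_space r"
proof -
  have "(\<Sum>a<r. \<Sum>k<r - 1. z k * helmert k a) = (\<Sum>k<r - 1. z k * (\<Sum>a<r. helmert k a))"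
    by (subst sum.swap) (simp add: sum_distrib_left)
  also have "\<dots> = 0"
    by (rule sum.neutral) (auto simp: helmert_sum_upto)
  finally show ?thesis by (simp add: centered_space_def from_helmert_def)
qed

lemma chi_shift:
  assumes "N \<in> arrays r m" "\<And>a. a < r \<Longrightarrow> y a = x a - c"
  shows "chi r N y = chi r N x"
  unfolding chi_eq[OF assms(1)] edge_form_def
  by (intro arg_cong[of _ _ "\<lambda>t. exp (- t)"] sum.cong) (auto simp: assms(2))

text \<open>Subtracting the mean moves any point to the centered space without changing any
  \<open>chi\<close>, so a relation on the centered space extends to all points.\<close>

lemma chi_independent_centered:
  assumes r: "r \<ge> 1" and zero: "\<And>z. (\<Sum>N\<in>arrays r m. v N * chi r N (from_helmert r z)) = 0"
  shows "\<forall>N\<in>arrays r m. v N = 0"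
proof (rule chi_independent)
  fix x :: "nat \<Rightarrow> real"
  define c where "c = (\<Sum>a<r. x a) / real r"
  obtain n where n: "r = Suc n" using r by (cases r) auto
  have "(\<Sum>a<r. x a - c) = 0" using r by (simp add: sum_subtractf c_def)
  then obtain z where z: "\<And>a. a < r \<Longrightarrow> x a - c = (\<Sum>k<n. z k * helmert k a)"
    using helmert_span[of "\<lambda>a. x a - c" n] by (auto simp: n)
  have "chi r N (from_helmert r z) = chi r N x" if "N \<in> arrays r m" for N
    using that by (rule chi_shift[where c = c]) (use z in \<open>auto simp: from_helmert_def n\<close>)
  then show "(\<Sum>N\<in>arrays r m. v N * chi r N x) = 0"
    using zero[of z] by simp
qed


section \<open>Gaussian integrals of positive definite forms\<close>

definition quad :: "nat \<Rightarrow> (nat \<Rightarrow> nat \<Rightarrow> real) \<Rightarrow> (nat \<Rightarrow> real) \<Rightarrow> real" where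
  "quad n A z = (\<Sum>k<n. \<Sum>l<n. z k * A k l * z l)"

definition pos_def_form :: "nat \<Rightarrow> (nat \<Rightarrow> nat \<Rightarrow> real) \<Rightarrow> bool" where
  "pos_def_form n A \<longleftrightarrow> (\<forall>k<n. \<forall>l<n. A k l = A l k) \<and> (\<forall>z. (\<exists>k<n. z k \<noteq> 0) \<longrightarrow> 0 < quad n A z)"

lemma quad_cong: "(\<And>k. k < n \<Longrightarrow> z k = z' k) \<Longrightarrow> quad n A z = quad n A z'"
  unfolding quad_def by (intro sum.cong refl) auto

lemma gaussian_integral_1d:
  fixes a b c :: real
  assumes a: "a > 0"
  shows "(\<integral>\<^sup>+y. ennreal (exp (- (a * y\<^sup>2 + 2 * b * y + c))) \<partial>lborel) = ennreal (sqrt (pi / a) * exp (b\<^sup>2 / a - c))"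
proof -
  \<comment> \<open>Completing the square: the integrand is a multiple of the normal density with
    mean \<open>- b / a\<close> and variance \<open>1 / (2 * a)\<close>.\<close>
  define s where "s = sqrt (1 / (2 * a))"
  have s: "s > 0" "s\<^sup>2 = 1 / (2 * a)" using a by (auto simp: s_def)
  have eq: "exp (- (a * y\<^sup>2 + 2 * b * y + c))
      = (sqrt (pi / a) * exp (b\<^sup>2 / a - c)) * normal_density (- b / a) s y" for y
  proof -
    have "- (a * y\<^sup>2 + 2 * b * y + c) = (b\<^sup>2 / a - c) + - (y - - b / a)\<^sup>2 / (2 * s\<^sup>2)"
      using a unfolding s(2) by (simp add: field_simps power2_eq_square)
    then have "exp (- (a * y\<^sup>2 + 2 * b * y + c)) = exp (b\<^sup>2 / a - c) * exp (- (y - - b / a)\<^sup>2 / (2 * s\<^sup>2))"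
      by (simp only: exp_add)
    also have "\<dots> = (sqrt (pi / a) * (1 / sqrt (2 * pi * s\<^sup>2))) * (exp (b\<^sup>2 / a - c) * exp (- (y - - b / a)\<^sup>2 / (2 * s\<^sup>2)))"
      using a by (simp add: s(2) real_sqrt_divide)
    also have "\<dots> = (sqrt (pi / a) * exp (b\<^sup>2 / a - c)) * normal_density (- b / a) s y"
      unfolding normal_density_def by (simp only: mult_ac)
    finally show ?thesis .
  qed
  have "(\<integral>\<^sup>+y. ennreal (normal_density (- b / a) s y) \<partial>lborel) = 1"
    by (subst nn_integral_eq_integral) (use s(1) in auto)
  then show ?thesis
    unfolding eq using a by (simp add: ennreal_mult nn_integral_cmult)
qed

lemma quad_Suc:
  assumes "\<forall>k<Suc n. \<forall>l<Suc n. A k l = A l k"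
  shows "quad (Suc n) A z = A n n * (z n)\<^sup>2 + 2 * (\<Sum>k<n. z k * A k n) * z n + quad n A z"
proof -
  have "(\<Sum>l<n. z n * A n l * z l) = (\<Sum>k<n. z k * A k n) * z n"
    unfolding sum_distrib_right by (rule sum.cong) (use assms in auto)
  moreover have "(\<Sum>k<n. z k * A k n * z n) = (\<Sum>k<n. z k * A k n) * z n"
    by (simp add: sum_distrib_right)
  ultimately show ?thesis
    unfolding quad_def by (simp add: sum.distrib power2_eq_square algebra_simps)
qed

text \<open>The form left over after completing the square in coordinate \<open>n\<close>.\<close>

definition schur :: "nat \<Rightarrow> (nat \<Rightarrow> nat \<Rightarrow> real) \<Rightarrow> nat \<Rightarrow> nat \<Rightarrow> real" where
  "schur n A k l = A k l - A k n * A n l / A n n"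

lemma quad_schur:
  assumes "\<forall>k<Suc n. \<forall>l<Suc n. A k l = A l k"
  shows "quad n (schur n A) z = quad n A z - (\<Sum>k<n. z k * A k n)\<^sup>2 / A n n"
proof -
  have "(\<Sum>k<n. z k * A k n)\<^sup>2 = (\<Sum>k<n. \<Sum>l<n. (z k * A k n) * (z l * A n l))"
    unfolding power2_eq_square sum_product by (intro sum.cong refl) (use assms in auto)
  then show ?thesis
    by (simp add: quad_def schur_def sum_divide_distrib sum_subtractf[symmetric] algebra_simps)
qed

lemma pos_def_form_schur:
  assumes "pos_def_form (Suc n) A"
  shows "0 < A n n" "pos_def_form n (schur n A)"
proof -
  have sym: "\<forall>k<Suc n. \<forall>l<Suc n. A k l = A l k"
    and pos: "\<And>z. (\<exists>k<Suc n. z k \<noteq> 0) \<Longrightarrow> 0 < quad (Suc n) A z"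
    using assms by (auto simp: pos_def_form_def)
  have "0 < quad (Suc n) A (\<lambda>k. if k = n then 1 else 0)"
    by (rule pos) auto
  then show Ann: "0 < A n n"
    unfolding quad_Suc[OF sym] by (simp add: quad_def)
  have "0 < quad n (schur n A) z" if z: "\<exists>k<n. z k \<noteq> 0" for z
  proof -
    \<comment> \<open>The minimizer of the form in its last coordinate, where the form takes the
      value of the Schur complement.\<close>
    define t where "t = - (\<Sum>k<n. z k * A k n) / A n n"
    have "0 < quad (Suc n) A (z(n := t))"
      using z by (intro pos) force
    also have "\<dots> = A n n * t\<^sup>2 + 2 * (\<Sum>k<n. z k * A k n) * t + quad n A z"
      unfolding quad_Suc[OF sym] using quad_cong[of n "z(n := t)" z A] by simp
    also have "\<dots> = quad n (schur n A) z"
      unfolding quad_schur[OF sym] t_def using Ann by (simp add: field_simps power2_eq_square)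
    finally show ?thesis .
  qed
  then show "pos_def_form n (schur n A)"
    using sym by (auto simp: pos_def_form_def schur_def)
qed

definition form_det :: "nat \<Rightarrow> (nat \<Rightarrow> nat \<Rightarrow> real) \<Rightarrow> real" where
  "form_det n A = Determinant.det (Matrix.mat n n (\<lambda>(k, l). A k l))"

text \<open>Block elimination: the matrix is a block upper triangular one with diagonal blocks
  \<open>schur n A\<close> and \<open>A n n\<close>, times a block lower triangular one with
  identity blocks on the diagonal.\<close>

lemma form_det_Suc:
  assumes "A n n \<noteq> 0"
  shows "form_det (Suc n) A = A n n * form_det n (schur n A)"
proof -
  let ?S = "Matrix.mat n n (\<lambda>(k, l). schur n A k l)"
  let ?c = "Matrix.mat n 1 (\<lambda>(k, l). A k n)"
  let ?d = "Matrix.mat 1 1 (\<lambda>(k, l). A n n)"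
  let ?u = "Matrix.mat 1 n (\<lambda>(k, l). A n l / A n n)"
  let ?L = "four_block_mat ?S ?c (0\<^sub>m 1 n) ?d"
  let ?U = "four_block_mat (1\<^sub>m n) (0\<^sub>m n 1) ?u (1\<^sub>m 1)"
  have prod: "?L * ?U = four_block_mat (?S * 1\<^sub>m n + ?c * ?u) (?S * 0\<^sub>m n 1 + ?c * 1\<^sub>m 1)
      (0\<^sub>m 1 n * 1\<^sub>m n + ?d * ?u) (0\<^sub>m 1 n * 0\<^sub>m n 1 + ?d * 1\<^sub>m 1)"
    by (rule mult_four_block_mat[of _ n n _ 1 _ 1]) auto
  have "Matrix.mat (Suc n) (Suc n) (\<lambda>(k, l). A k l) = ?L * ?U"
    unfolding prod
    by (rule eq_matI) (use assms in \<open>auto simp: scalar_prod_def schur_def less_Suc_eq field_simps\<close>)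
  then have "form_det (Suc n) A = Determinant.det (?L * ?U)"
    by (simp add: form_det_def)
  also have "\<dots> = Determinant.det ?L * Determinant.det ?U"
    by (rule det_mult[of _ "n + 1"]) auto
  also have "Determinant.det ?L = form_det n (schur n A) * A n n"
    by (subst det_four_block_mat_lower_left_zero[of _ n _ 1]) (auto simp: form_det_def det_single)
  also have "Determinant.det ?U = 1"
    by (subst det_four_block_mat_upper_right_zero[of _ n _ 1]) auto
  finally show ?thesis by simp
qed

lemma quad_measurable:
  assumes "\<And>k. k < n \<Longrightarrow> (\<lambda>z. f z k) \<in> borel_measurable M"
  shows "(\<lambda>z. quad n A (f z)) \<in> borel_measurable M"
  unfolding quad_def
  by (intro borel_measurable_sum borel_measurable_times borel_measurable_const) (use assms in auto)

lemma component_measurable: "k \<in> I \<Longrightarrow> (\<lambda>z. z k) \<in> borel_measurable (PiM I (\<lambda>_. lborel :: real measure))"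
  using measurable_component_singleton[of k I "\<lambda>_. lborel :: real measure"] by simp

text \<open>Integrating out the last coordinate leaves the integral for the Schur complement with
  the factor \<open>sqrt (pi / A n n)\<close>, which matches the recursion of the determinant.
  Positivity of the determinant is carried along so that the constants are nonnegative.\<close>

lemma gaussian_integral:
  assumes "pos_def_form n A"
  shows "0 < form_det n A \<and>
    (\<integral>\<^sup>+z. ennreal (exp (- quad n A z)) \<partial>PiM {..<n} (\<lambda>_. lborel)) = ennreal (sqrt pi ^ n / sqrt (form_det n A))"
  using assms
proof (induction n arbitrary: A)
  case 0
  then show ?case by (simp add: form_det_def quad_def PiM_empty nn_integral_count_space_finite)
next
  case (Suc n)
  interpret product_sigma_finite "\<lambda>_. lborel :: real measure" by standard
  have sym: "\<forall>k<Suc n. \<forall>l<Suc n. A k l = A l k" using Suc.prems by (simp add: pos_def_form_def)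
  note Ann = pos_def_form_schur(1)[OF Suc.prems]
  note IH = Suc.IH[OF pos_def_form_schur(2)[OF Suc.prems]]
  have det: "form_det (Suc n) A = A n n * form_det n (schur n A)"
    using Ann by (intro form_det_Suc) simp
  have meas: "(\<lambda>z. ennreal (exp (- quad m B z))) \<in> borel_measurable (PiM {..<m} (\<lambda>_. lborel))" for m B
    by (intro measurable_compose[OF _ measurable_ennreal] borel_measurable_exp[THEN measurable_compose[rotated]]
        borel_measurable_uminus quad_measurable component_measurable) auto
  have "(\<integral>\<^sup>+z. ennreal (exp (- quad (Suc n) A z)) \<partial>PiM {..<Suc n} (\<lambda>_. lborel))
      = (\<integral>\<^sup>+x. \<integral>\<^sup>+y. ennreal (exp (- quad (Suc n) A (x(n := y)))) \<partial>lborel \<partial>PiM {..<n} (\<lambda>_. lborel))"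
    using meas[of "Suc n" A] unfolding lessThan_Suc by (intro product_nn_integral_insert) auto
  also have "\<dots> = (\<integral>\<^sup>+x. ennreal (sqrt (pi / A n n)) * ennreal (exp (- quad n (schur n A) x)) \<partial>PiM {..<n} (\<lambda>_. lborel))"
  proof (rule nn_integral_cong)
    fix x :: "nat \<Rightarrow> real"
    let ?b = "\<Sum>k<n. x k * A k n"
    have "quad (Suc n) A (x(n := y)) = A n n * y\<^sup>2 + 2 * ?b * y + quad n A x" for y
      unfolding quad_Suc[OF sym] using quad_cong[of n "x(n := y)" x A] by simp
    then have "(\<integral>\<^sup>+y. ennreal (exp (- quad (Suc n) A (x(n := y)))) \<partial>lborel)
        = ennreal (sqrt (pi / A n n) * exp (?b\<^sup>2 / A n n - quad n A x))"
      by (simp only: gaussian_integral_1d[OF Ann])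
    also have "?b\<^sup>2 / A n n - quad n A x = - quad n (schur n A) x"
      unfolding quad_schur[OF sym] by simp
    also have "ennreal (sqrt (pi / A n n) * exp (- quad n (schur n A) x))
        = ennreal (sqrt (pi / A n n)) * ennreal (exp (- quad n (schur n A) x))"
      using Ann by (intro ennreal_mult) auto
    finally show "(\<integral>\<^sup>+y. ennreal (exp (- quad (Suc n) A (x(n := y)))) \<partial>lborel)
        = ennreal (sqrt (pi / A n n)) * ennreal (exp (- quad n (schur n A) x))" .
  qed
  also have "\<dots> = ennreal (sqrt (pi / A n n)) * ennreal (sqrt pi ^ n / sqrt (form_det n (schur n A)))"
    using meas[of n] IH by (subst nn_integral_cmult) auto
  also have "\<dots> = ennreal (sqrt pi ^ Suc n / sqrt (form_det (Suc n) A))"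
    using Ann IH by (simp add: ennreal_mult[symmetric] det real_sqrt_mult real_sqrt_divide)
  finally show ?case using det Ann IH by simp
qed


section \<open>Entries of the Gram matrix\<close>

lemma from_helmert_measurable:
  "from_helmert r \<in> measurable (PiM {..<r - 1} (\<lambda>_. lborel))
    (restrict_space (PiM {..<r} (\<lambda>_. borel)) (centered_space r))"
proof (rule measurable_restrict_space2)
  show "from_helmert r \<in> space (PiM {..<r - 1} (\<lambda>_. lborel)) \<rightarrow> centered_space r"
    using from_helmert_in by auto
  have "(\<lambda>z. \<Sum>k<r - 1. z k * helmert k a) \<in> borel_measurable (PiM {..<r - 1} (\<lambda>_. lborel))" for a
    by (intro borel_measurable_sum borel_measurable_times borel_measurable_const component_measurable)
  then show "from_helmert r \<in> measurable (PiM {..<r - 1} (\<lambda>_. lborel)) (PiM {..<r} (\<lambda>_. borel))"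
    unfolding from_helmert_def by (intro measurable_restrict) auto
qed

lemma centered_lebesgue_eq:
  "centered_lebesgue r = distr (PiM {..<r - 1} (\<lambda>_. lborel))
     (restrict_space (PiM {..<r} (\<lambda>_. borel)) (centered_space r)) (from_helmert r)"
  by (simp add: centered_lebesgue_def from_helmert_def[abs_def])

lemma sets_centered_gauss [simp]:
  "sets (centered_gauss r) = sets (restrict_space (PiM {..<r} (\<lambda>_. borel)) (centered_space r))"
  by (simp add: centered_gauss_def centered_lebesgue_def)

lemma coordinate_measurable:
  assumes "a < r"
  shows "(\<lambda>x. x a) \<in> borel_measurable (restrict_space (PiM {..<r} (\<lambda>_. borel :: real measure)) (centered_space r))"
  by (intro measurable_restrict_space1 measurable_component_singleton) (use assms in simp)

lemma chi_measurable:
  "chi r N \<in> borel_measurable (restrict_space (PiM {..<r} (\<lambda>_. borel)) (centered_space r))"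
  unfolding chi_def
  by (intro borel_measurable_exp[THEN measurable_compose[rotated]] borel_measurable_uminus borel_measurable_sum
      borel_measurable_times borel_measurable_const coordinate_measurable) auto

lemma chi_measurable_gauss: "chi r N \<in> borel_measurable (centered_gauss r)"
  using chi_measurable by (simp cong: measurable_cong_sets)

text \<open>The matrix inside \<open>centered_det\<close>: the restriction of \<open>A\<close> to
  the centered space in the Helmert basis.\<close>

definition helmert_form :: "nat \<Rightarrow> (nat \<Rightarrow> nat \<Rightarrow> real) \<Rightarrow> nat \<Rightarrow> nat \<Rightarrow> real" where
  "helmert_form r A k l = (\<Sum>a<r. \<Sum>b<r. helmert k a * A a b * helmert l b)"

lemma quad_helmert_form: "quad (r - 1) (helmert_form r A) z = quad r A (from_helmert r z)"
proof -
  have "quad r A (from_helmert r z)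
      = (\<Sum>a<r. \<Sum>b<r. \<Sum>k<r - 1. \<Sum>l<r - 1. z k * (helmert k a * A a b * helmert l b) * z l)"
    unfolding quad_def
  proof (intro sum.cong refl)
    fix a b assume "a \<in> {..<r}" "b \<in> {..<r}"
    then have "from_helmert r z a * A a b * from_helmert r z b
        = (\<Sum>k<r - 1. z k * helmert k a * A a b) * (\<Sum>l<r - 1. z l * helmert l b)"
      by (simp add: from_helmert_def sum_distrib_right)
    then show "from_helmert r z a * A a b * from_helmert r z b
        = (\<Sum>k<r - 1. \<Sum>l<r - 1. z k * (helmert k a * A a b * helmert l b) * z l)"
      unfolding sum_product by (simp add: mult_ac)
  qed
  also have "\<dots> = (\<Sum>a<r. \<Sum>k<r - 1. \<Sum>l<r - 1. \<Sum>b<r. z k * (helmert k a * A a b * helmert l b) * z l)"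
    by (rule sum.cong[OF refl], rule trans[OF sum.swap], rule sum.cong[OF refl], rule sum.swap)
  also have "\<dots> = (\<Sum>k<r - 1. \<Sum>l<r - 1. \<Sum>a<r. \<Sum>b<r. z k * (helmert k a * A a b * helmert l b) * z l)"
    by (rule trans[OF sum.swap], rule sum.cong[OF refl], rule sum.swap)
  also have "\<dots> = quad (r - 1) (helmert_form r A) z"
    unfolding quad_def helmert_form_def sum_distrib_left sum_distrib_right ..
  finally show ?thesis by simp
qed

text \<open>The parametrization is an isometry; this is \<open>quad_helmert_form\<close> for the
  identity form together with orthonormality of the Helmert vectors.\<close>

lemma from_helmert_norm: "(\<Sum>a<r. (from_helmert r z a)\<^sup>2) = (\<Sum>k<r - 1. (z k)\<^sup>2)"
proof -
  have "(\<Sum>a<r. (from_helmert r z a)\<^sup>2) = quad r (\<lambda>a b. if a = b then 1 else 0) (from_helmert r z)"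
    unfolding quad_def by (intro sum.cong refl) (simp add: power2_eq_square mult_delta_left mult_delta_right)
  also have "\<dots> = quad (r - 1) (helmert_form r (\<lambda>a b. if a = b then 1 else 0)) z"
    by (rule quad_helmert_form[symmetric])
  also have "\<dots> = (\<Sum>k<r - 1. \<Sum>l<r - 1. z k * (if k = l then 1 else 0) * z l)"
    unfolding quad_def
  proof (intro sum.cong refl)
    fix k l assume "k \<in> {..<r - 1}" "l \<in> {..<r - 1}"
    then have "(\<Sum>a<r. helmert k a * helmert l a) = (if k = l then 1 else 0)"
      by (intro helmert_orthonormal) auto
    moreover have "helmert_form r (\<lambda>a b. if a = b then 1 else 0) k l = (\<Sum>a<r. helmert k a * helmert l a)"
      unfolding helmert_form_def by (intro sum.cong refl) (simp add: mult_delta_left mult_delta_right)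
    ultimately show "z k * helmert_form r (\<lambda>a b. if a = b then 1 else 0) k l * z l = z k * (if k = l then 1 else 0) * z l"
      by simp
  qed
  also have "\<dots> = (\<Sum>k<r - 1. (z k)\<^sup>2)"
    by (intro sum.cong refl) (simp add: power2_eq_square mult_delta_left mult_delta_right)
  finally show ?thesis .
qed

lemma edge_form_nonneg: "(\<And>a b. 0 \<le> D a b) \<Longrightarrow> 0 \<le> edge_form r D x"
  unfolding edge_form_def by (rule sum_nonneg) auto

lemma quad_laplacian:
  assumes "N \<in> arrays r m"
  shows "quad r (laplacian r N) x = edge_form r (\<lambda>a b. real (N a b)) x"
  unfolding quad_def edge_form_def by (rule laplacian_form) (use assms in \<open>auto simp: arrays_def\<close>)

context
  fixes r m :: nat and N N' :: array
  assumes N: "N \<in> arrays r m" and N': "N' \<in> arrays r m"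
begin

abbreviation gram_form :: "nat \<Rightarrow> nat \<Rightarrow> real" where
  "gram_form \<equiv> (\<lambda>a b. (if a = b then 1 else 0) + laplacian r N a b + laplacian r N' a b)"

lemma quad_gram_form:
  "quad r gram_form x = (\<Sum>a<r. (x a)\<^sup>2) + quad r (laplacian r N) x + quad r (laplacian r N') x"
proof -
  have "quad r gram_form x = quad r (\<lambda>a b. if a = b then 1 else 0) x + quad r (laplacian r N) x + quad r (laplacian r N') x"
    unfolding quad_def by (simp add: sum.distrib[symmetric] distrib_left distrib_right)
  also have "quad r (\<lambda>a b. if a = b then 1 else 0) x = (\<Sum>a<r. (x a)\<^sup>2)"
    unfolding quad_def by (intro sum.cong refl) (simp add: power2_eq_square mult_delta_left mult_delta_right)
  finally show ?thesis .
qed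

lemma quad_laplacian_nonneg: "0 \<le> quad r (laplacian r N) x" "0 \<le> quad r (laplacian r N') x"
  unfolding quad_laplacian[OF N] quad_laplacian[OF N'] by (intro edge_form_nonneg; simp)+

lemma pos_def_gram_form: "pos_def_form (r - 1) (helmert_form r gram_form)"
  unfolding pos_def_form_def
proof (intro conjI allI impI)
  fix k l
  have "gram_form a b = gram_form b a" for a b
    using N N' by (auto simp: laplacian_def arrays_def)
  then show "helmert_form r gram_form k l = helmert_form r gram_form l k"
    unfolding helmert_form_def by (subst sum.swap) (simp add: mult_ac)
next
  fix z :: "nat \<Rightarrow> real" assume "\<exists>k<r - 1. z k \<noteq> 0"
  then obtain k where "k < r - 1" "z k \<noteq> 0" by blast
  then have "0 < (\<Sum>k<r - 1. (z k)\<^sup>2)"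
    by (intro sum_pos2[of _ k]) auto
  then show "0 < quad (r - 1) (helmert_form r gram_form) z"
    unfolding quad_helmert_form quad_gram_form from_helmert_norm
    using quad_laplacian_nonneg[of "from_helmert r z"] by linarith
qed

text \<open>The Gaussian density and both functions \<open>chi\<close> merge into a single
  exponential, of minus the form \<open>gram_form\<close>, and \<open>gaussian_integral\<close>
  applies in Helmert coordinates.\<close>

lemma gram_integral:
  assumes r: "r \<ge> 1"
  shows "integrable (centered_gauss r) (\<lambda>x. chi r N x * chi r N' x)"
    and "gram r N N' = 1 / sqrt (centered_det r gram_form)"
proof -
  have det: "centered_det r gram_form = form_det (r - 1) (helmert_form r gram_form)"
    by (simp add: centered_det_def form_det_def helmert_form_def)
  \<comment> \<open>The normalization cancels the power of \<open>sqrt pi\<close> exactly; the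
    natural difference \<open>r - 1\<close> agrees with the real one because
    \<open>r \<ge> 1\<close>.\<close>
  define K where "K = pi powr (- (real r - 1) / 2)"
  have K: "K > 0" "K * sqrt pi ^ (r - 1) = 1"
  proof -
    have "sqrt pi ^ (r - 1) = pi powr ((real r - 1) / 2)"
      using r by (simp add: powr_half_sqrt[symmetric] powr_realpow[symmetric] powr_powr of_nat_diff)
    then show "K * sqrt pi ^ (r - 1) = 1"
      by (simp add: K_def powr_add[symmetric] add_divide_distrib[symmetric])
  qed (simp add: K_def)
  let ?f = "\<lambda>x. chi r N x * chi r N' x"
  let ?R = "restrict_space (PiM {..<r} (\<lambda>_. borel :: real measure)) (centered_space r)"
  have f: "?f \<in> borel_measurable ?R"
    by (intro borel_measurable_times chi_measurable)
  have sq: "(\<lambda>x. \<Sum>a<r. (x a)\<^sup>2) \<in> borel_measurable ?R"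
    by (intro borel_measurable_sum borel_measurable_power coordinate_measurable) auto
  have dens: "(\<lambda>x. ennreal (K * exp (- (\<Sum>a<r. (x a)\<^sup>2)))) \<in> borel_measurable ?R"
    by (intro measurable_compose[OF _ measurable_ennreal] borel_measurable_times borel_measurable_const
      borel_measurable_exp[THEN measurable_compose[rotated]] borel_measurable_uminus sq)
  have sets: "sets (centered_lebesgue r) = sets ?R" by (simp add: centered_lebesgue_def)
  have "(\<integral>\<^sup>+x. ennreal (?f x) \<partial>centered_gauss r)
      = (\<integral>\<^sup>+x. ennreal (K * exp (- (\<Sum>a<r. (x a)\<^sup>2))) * ennreal (?f x) \<partial>centered_lebesgue r)"
    unfolding centered_gauss_def K_def[symmetric]
    using f dens by (intro nn_integral_density) (simp_all add: sets cong: measurable_cong_sets)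
  also have "\<dots> = (\<integral>\<^sup>+z. ennreal (K * exp (- (\<Sum>a<r. (from_helmert r z a)\<^sup>2))) * ennreal (?f (from_helmert r z))
      \<partial>PiM {..<r - 1} (\<lambda>_. lborel))"
    unfolding centered_lebesgue_eq
    by (rule nn_integral_distr[OF from_helmert_measurable])
      (simp only: measurable_distr_eq1, intro borel_measurable_times_ennreal dens measurable_compose[OF f measurable_ennreal])
  also have "\<dots> = (\<integral>\<^sup>+z. ennreal K * ennreal (exp (- quad (r - 1) (helmert_form r gram_form) z)) \<partial>PiM {..<r - 1} (\<lambda>_. lborel))"
  proof (rule nn_integral_cong)
    fix z :: "nat \<Rightarrow> real"
    let ?x = "from_helmert r z"
    have "K * exp (- (\<Sum>a<r. (?x a)\<^sup>2)) * (chi r N ?x * chi r N' ?x)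
        = K * exp (- quad (r - 1) (helmert_form r gram_form) z)"
      unfolding quad_helmert_form quad_gram_form chi_def quad_def[symmetric] by (simp add: exp_add exp_minus exp_diff field_simps)
    then show "ennreal (K * exp (- (\<Sum>a<r. (?x a)\<^sup>2))) * ennreal (?f ?x)
        = ennreal K * ennreal (exp (- quad (r - 1) (helmert_form r gram_form) z))"
      using K(1) by (simp add: ennreal_mult[symmetric] chi_def)
  qed
  also have "\<dots> = ennreal K * (\<integral>\<^sup>+z. ennreal (exp (- quad (r - 1) (helmert_form r gram_form) z)) \<partial>PiM {..<r - 1} (\<lambda>_. lborel))"
    by (intro nn_integral_cmult measurable_compose[OF _ measurable_ennreal]
      borel_measurable_exp[THEN measurable_compose[rotated]] borel_measurable_uminus quad_measurable component_measurable) auto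
  also have "\<dots> = ennreal K * ennreal (sqrt pi ^ (r - 1) / sqrt (centered_det r gram_form))"
    using gaussian_integral[OF pos_def_gram_form] by (simp add: det)
  also have "\<dots> = ennreal (1 / sqrt (centered_det r gram_form))"
    using K gaussian_integral[OF pos_def_gram_form] by (simp add: ennreal_mult[symmetric] det)
  finally have nn: "(\<integral>\<^sup>+x. ennreal (?f x) \<partial>centered_gauss r) = ennreal (1 / sqrt (centered_det r gram_form))" .
  have meas: "?f \<in> borel_measurable (centered_gauss r)"
    by (intro borel_measurable_times chi_measurable_gauss)
  show "integrable (centered_gauss r) ?f"
    by (rule integrableI_nonneg[OF meas]) (simp add: chi_def, simp add: nn)
  have "gram r N N' = enn2real (\<integral>\<^sup>+x. ennreal (?f x) \<partial>centered_gauss r)"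
    unfolding gram_def by (rule integral_eq_nn_integral[OF meas]) (simp add: chi_def)
  then show "gram r N N' = 1 / sqrt (centered_det r gram_form)"
    using gaussian_integral[OF pos_def_gram_form] by (simp add: nn det)
qed

end


section \<open>Positive definiteness and inversion\<close>

lemma open_emeasure_lborel_pos:
  fixes S :: "real set"
  assumes "open S" "x \<in> S"
  shows "0 < emeasure lborel S"
proof -
  obtain e where e: "e > 0" "ball x e \<subseteq> S" using assms open_contains_ball by blast
  have "0 < emeasure lborel {x - e <..< x + e}" using e(1) by simp
  also have "\<dots> \<le> emeasure lborel S"
    using e(2) assms(1) by (intro emeasure_mono) (auto simp: ball_eq_greaterThanLessThan)
  finally show ?thesis .
qed

text \<open>By continuity a nonzero value persists on an open box, and an open box has positive
  product measure. Continuity refers to all functions on the naturals while the measure lives on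
  extensional ones; dependence on the first \<open>n\<close> coordinates alone bridges the
  two.\<close>

lemma AE_lborel_PiM_continuous_zero:
  fixes F :: "(nat \<Rightarrow> real) \<Rightarrow> real"
  assumes cont: "continuous_on UNIV F" and dep: "\<And>z z'. (\<And>k. k < n \<Longrightarrow> z k = z' k) \<Longrightarrow> F z = F z'"
    and AE: "AE z in PiM {..<n} (\<lambda>_. lborel). F z = 0"
  shows "F z = 0"
proof (rule ccontr)
  assume nz: "F z \<noteq> 0"
  interpret product_sigma_finite "\<lambda>_. lborel :: real measure" by standard
  have "open (F -` (- {0}))" using cont by (intro open_vimage) (auto simp: open_Compl)
  then have basis: "openin (product_topology (\<lambda>_. euclidean) UNIV) (F -` (- {0}))"
    by (simp add: open_fun_def)
  have "z \<in> F -` (- {0})" using nz by simp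
  from product_topology_open_contains_basis[OF basis this]
  obtain X where X': "z \<in> (\<Pi>\<^sub>E i\<in>UNIV. X i) \<and> (\<forall>i. openin euclidean (X i)) \<and>
      finite {i. X i \<noteq> topspace euclidean} \<and> (\<Pi>\<^sub>E i\<in>UNIV. X i) \<subseteq> F -` (- {0})" ..
  note X1 = conjunct1[OF X']
  have X2: "open (X i)" for i
    by (rule iffD2[OF open_openin spec[OF conjunct1[OF conjunct2[OF X']]]])
  note X = X1 X2 conjunct2[OF conjunct2[OF conjunct2[OF X']]]
  have box: "F y \<noteq> 0" if "y \<in> PiE {..<n} X" for y
  proof -
    \<comment> \<open>From coordinate \<open>n\<close> on the values of \<open>z\<close> are kept,
      so that the glued point stays in the infinite box.\<close>
    have "(if k < n then y k else z k) \<in> X k" for k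
      using PiE_mem[OF X1, of k] PiE_mem[OF that, of k] by simp
    then have "(\<lambda>k. if k < n then y k else z k) \<in> (\<Pi>\<^sub>E i\<in>UNIV. X i)"
      by (intro PiE_I) auto
    then have "F (\<lambda>k. if k < n then y k else z k) \<noteq> 0" using X(3) by blast
    moreover have "F (\<lambda>k. if k < n then y k else z k) = F y" by (rule dep) auto
    ultimately show ?thesis by simp
  qed
  have sets: "PiE {..<n} X \<in> sets (PiM {..<n} (\<lambda>_. lborel))"
    using X(2) by (intro sets_PiM_I_finite) auto
  have "emeasure (PiM {..<n} (\<lambda>_. lborel)) (PiE {..<n} X) = (\<Prod>i<n. emeasure lborel (X i))"
    using X(2) by (intro emeasure_PiM) auto
  also have "\<dots> \<noteq> 0"
    using open_emeasure_lborel_pos[OF X2 PiE_mem[OF X1]] by (simp add: prod_zero_iff less_imp_neq[symmetric])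
  finally have pos: "emeasure (PiM {..<n} (\<lambda>_. lborel)) (PiE {..<n} X) \<noteq> 0" .
  have "AE y in PiM {..<n} (\<lambda>_. lborel). y \<notin> PiE {..<n} X"
    using AE by eventually_elim (use box in blast)
  then have "emeasure (PiM {..<n} (\<lambda>_. lborel)) (PiE {..<n} X) = 0"
    by (subst (asm) AE_iff_measurable[OF sets]) (use sets.sets_into_space[OF sets] in auto)
  then show False using pos by simp
qed

text \<open>The density is positive, so vanishing almost everywhere passes from the Gaussian measure
  to Lebesgue measure in Helmert coordinates, where continuity removes the exceptional set.\<close>

lemma chi_sum_AE_zero:
  assumes r: "r \<ge> 1" and AE: "AE x in centered_gauss r. (\<Sum>N\<in>arrays r m. v N * chi r N x) = 0"
  shows "\<forall>N\<in>arrays r m. v N = 0"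
proof (rule chi_independent_centered[OF r])
  fix z :: "nat \<Rightarrow> real"
  let ?S = "\<lambda>x. \<Sum>N\<in>arrays r m. v N * chi r N x"
  let ?R = "restrict_space (PiM {..<r} (\<lambda>_. borel :: real measure)) (centered_space r)"
  have S: "?S \<in> borel_measurable ?R"
    by (intro borel_measurable_sum borel_measurable_times borel_measurable_const chi_measurable)
  have sq: "(\<lambda>x. \<Sum>a<r. (x a)\<^sup>2) \<in> borel_measurable ?R"
    by (intro borel_measurable_sum borel_measurable_power coordinate_measurable) auto
  have dens: "(\<lambda>x. ennreal (pi powr (- (real r - 1) / 2) * exp (- (\<Sum>a<r. (x a)\<^sup>2)))) \<in> borel_measurable (centered_lebesgue r)"
    unfolding centered_lebesgue_eq measurable_distr_eq1
    by (intro measurable_compose[OF _ measurable_ennreal] borel_measurable_times borel_measurable_const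
      borel_measurable_exp[THEN measurable_compose[rotated]] borel_measurable_uminus sq)
  have "AE x in centered_lebesgue r. ?S x = 0"
    using AE unfolding centered_gauss_def AE_density[OF dens] by (auto simp: ennreal_zero_less_mult_iff)
  then have ae: "AE z in PiM {..<r - 1} (\<lambda>_. lborel). ?S (from_helmert r z) = 0"
    unfolding centered_lebesgue_eq
    by (subst (asm) AE_distr_iff[OF from_helmert_measurable]) (use S in measurable)
  show "?S (from_helmert r z) = 0"
  proof (rule AE_lborel_PiM_continuous_zero[OF _ _ ae])
    have "continuous_on UNIV (\<lambda>z. from_helmert r z a)" for a
      by (cases "a < r") (auto simp: from_helmert_def intro!: continuous_intros)
    then show "continuous_on UNIV (\<lambda>z. ?S (from_helmert r z))"
      unfolding chi_def by (intro continuous_intros)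
    show "?S (from_helmert r z) = ?S (from_helmert r z')" if "\<And>k. k < r - 1 \<Longrightarrow> z k = z' k" for z z'
    proof -
      have "from_helmert r z = from_helmert r z'"
        using that unfolding from_helmert_def by (intro restrict_ext sum.cong) auto
      then show ?thesis by simp
    qed
  qed
qed

text \<open>The quadratic form at \<open>v\<close> is the squared L2 norm of the combination with
  coefficients \<open>v\<close>. A zero norm yields vanishing almost everywhere only, which
  \<open>chi_sum_AE_zero\<close> turns into zero coefficients.\<close>

lemma pos_def_gram:
  assumes r: "r \<ge> 1"
  shows "pos_def_on (arrays r m) (gram r)"
  unfolding pos_def_on_def
proof (intro conjI ballI allI impI)
  show "gram r N N' = gram r N' N" for N N'
    by (simp add: gram_def mult.commute)
  fix v :: "array \<Rightarrow> real" assume v: "\<exists>N\<in>arrays r m. v N \<noteq> 0"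
  let ?A = "arrays r m"
  let ?S = "\<lambda>x. \<Sum>N\<in>?A. v N * chi r N x"
  have sq: "(?S x)\<^sup>2 = (\<Sum>N\<in>?A. \<Sum>N'\<in>?A. (v N * v N') * (chi r N x * chi r N' x))" for x
    unfolding power2_eq_square sum_product by (simp add: mult_ac)
  have int: "integrable (centered_gauss r) (\<lambda>x. (v N * v N') * (chi r N x * chi r N' x))"
    if "N \<in> ?A" "N' \<in> ?A" for N N'
    by (intro integrable_mult_right gram_integral(1)[OF that r])
  have intS: "integrable (centered_gauss r) (\<lambda>x. (?S x)\<^sup>2)"
    unfolding sq by (intro Bochner_Integration.integrable_sum int)
  have "(\<Sum>N\<in>?A. \<Sum>N'\<in>?A. v N * gram r N N' * v N') = (\<integral>x. (?S x)\<^sup>2 \<partial>centered_gauss r)"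
    unfolding sq gram_def
    by (subst Bochner_Integration.integral_sum, (intro Bochner_Integration.integrable_sum int; assumption),
        intro sum.cong refl, subst Bochner_Integration.integral_sum, (intro int; assumption),
        simp add: mult_ac)
  moreover have "(\<integral>x. (?S x)\<^sup>2 \<partial>centered_gauss r) \<noteq> 0"
  proof
    assume "(\<integral>x. (?S x)\<^sup>2 \<partial>centered_gauss r) = 0"
    then have "AE x in centered_gauss r. (?S x)\<^sup>2 = 0"
      using integral_nonneg_eq_0_iff_AE[OF intS] by simp
    then have "AE x in centered_gauss r. ?S x = 0" by simp
    then show False using chi_sum_AE_zero[OF r] v by blast
  qed
  moreover have "0 \<le> (\<integral>x. (?S x)\<^sup>2 \<partial>centered_gauss r)" by simp
  ultimately show "0 < (\<Sum>N\<in>?A. \<Sum>N'\<in>?A. v N * gram r N N' * v N')" by linarith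
qed

text \<open>Enumerating the index set gives a genuine matrix. A nonzero kernel vector would make the
  quadratic form vanish, so the determinant is nonzero.\<close>

lemma pos_def_inverse:
  assumes I: "finite I" and G: "pos_def_on I G"
  shows "\<exists>H. inverse_matrix_on I G H"
proof -
  define n where "n = card I"
  obtain e where e: "bij_betw e {..<n} I"
    using ex_bij_betw_nat_finite[OF I] by (auto simp: n_def lessThan_atLeast0)
  define A where "A = Matrix.mat n n (\<lambda>(k, l). G (e k) (e l))"
  have A: "A \<in> carrier_mat n n" by (simp add: A_def)
  define d where "d = the_inv_into {..<n} e"
  have d: "d (e k) = k" if "k < n" for k
    unfolding d_def by (rule the_inv_into_f_f) (use e that in \<open>auto simp: bij_betw_def\<close>)
  have dI: "d i < n" "e (d i) = i" if "i \<in> I" for i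
    using that e d by (auto simp: bij_betw_def)
  have reindex: "(\<Sum>i\<in>I. g i) = (\<Sum>k<n. g (e k))" for g :: "'a \<Rightarrow> real"
    by (rule sum.reindex_bij_betw[OF e, symmetric])
  have "Determinant.det A \<noteq> 0"
  proof
    assume "Determinant.det A = 0"
    then obtain v where v: "v \<in> carrier_vec n" "v \<noteq> 0\<^sub>v n" "A *\<^sub>v v = 0\<^sub>v n"
      using det_0_iff_vec_prod_zero_field[OF A] by blast
    define w where "w i = vec_index v (d i)" for i
    have "\<exists>k<n. vec_index v k \<noteq> 0" using v(1,2) by (metis carrier_vecD eq_vecI index_zero_vec)
    then have "\<exists>i\<in>I. w i \<noteq> 0" using e d by (force simp: w_def bij_betw_def)
    then have "0 < (\<Sum>i\<in>I. \<Sum>j\<in>I. w i * G i j * w j)" using G by (auto simp: pos_def_on_def)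
    also have "\<dots> = (\<Sum>k<n. vec_index v k * (\<Sum>l<n. G (e k) (e l) * vec_index v l))"
      unfolding reindex w_def by (intro sum.cong refl) (simp add: d sum_distrib_left mult.assoc)
    also have "\<dots> = (\<Sum>k<n. vec_index v k * vec_index (A *\<^sub>v v) k)"
      using v(1) by (intro sum.cong refl) (auto simp: A_def scalar_prod_def lessThan_atLeast0)
    also have "\<dots> = 0" unfolding v(3) by simp
    finally show False by simp
  qed
  from det_non_zero_imp_unit[OF A this, of "()"]
  obtain C where C: "C \<in> carrier_mat n n" "C * A = 1\<^sub>m n" "A * C = 1\<^sub>m n"
    by (auto simp: Units_def ring_mat_def)
  have "inverse_matrix_on I G (\<lambda>i j. C $$ (d i, d j))"
    unfolding inverse_matrix_on_def
  proof (intro ballI conjI)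
    fix i j assume i: "i \<in> I" and j: "j \<in> I"
    have eq: "d i = d j \<longleftrightarrow> i = j" using dI[OF i] dI[OF j] by metis
    have "(\<Sum>k\<in>I. G i k * C $$ (d k, d j)) = (A * C) $$ (d i, d j)"
      unfolding reindex using dI[OF i] dI[OF j] A C(1)
      by (auto simp: A_def scalar_prod_def lessThan_atLeast0 d intro!: sum.cong)
    then show "(\<Sum>k\<in>I. G i k * C $$ (d k, d j)) = (if i = j then 1 else 0)"
      unfolding C(3) using dI[OF i] dI[OF j] eq by simp
    have "(\<Sum>k\<in>I. C $$ (d i, d k) * G k j) = (C * A) $$ (d i, d j)"
      unfolding reindex using dI[OF i] dI[OF j] A C(1)
      by (auto simp: A_def scalar_prod_def lessThan_atLeast0 d intro!: sum.cong)
    then show "(\<Sum>k\<in>I. C $$ (d i, d k) * G k j) = (if i = j then 1 else 0)"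
      unfolding C(2) using dI[OF i] dI[OF j] eq by simp
  qed
  then show ?thesis by blast
qed

section \<open>The law of a continuous process\<close>

definition path_ball :: "(real \<Rightarrow> real) \<Rightarrow> real \<Rightarrow> real \<Rightarrow> (real \<Rightarrow> real) set" where
  "path_ball p k e = {q \<in> continuous_paths. \<forall>t\<in>{-k..k}. \<bar>q t - p t\<bar> < e}"

lemma locally_uniform_topology_eq:
  "locally_uniform_topology = topology_generated_by {path_ball p k e | p k e. p \<in> continuous_paths \<and> 0 < e}"
  by (simp add: locally_uniform_topology_def path_ball_def)

lemma openin_path_ball: "p \<in> continuous_paths \<Longrightarrow> 0 < e \<Longrightarrow> openin locally_uniform_topology (path_ball p k e)"
  unfolding locally_uniform_topology_eq by (rule topology_generated_by_Basis) blast

lemma openin_subset_continuous_paths: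
  assumes "openin locally_uniform_topology U"
  shows "U \<subseteq> continuous_paths"
proof -
  have "U \<subseteq> topspace locally_uniform_topology" using assms by (rule openin_subset)
  also have "\<dots> \<subseteq> continuous_paths"
    unfolding locally_uniform_topology_eq topology_generated_by_topspace by (auto simp: path_ball_def)
  finally show ?thesis .
qed

lemma path_ball_mono: "k \<le> k' \<Longrightarrow> e' \<le> e \<Longrightarrow> path_ball p k' e' \<subseteq> path_ball p k e"
proof (rule subsetI)
  fix q assume le: "k \<le> k'" "e' \<le> e" and q: "q \<in> path_ball p k' e'"
  have "\<bar>q t - p t\<bar> < e" if "t \<in> {-k..k}" for t
  proof -
    have "t \<in> {-k'..k'}" using that le(1) by auto
    then have "\<bar>q t - p t\<bar> < e'" using q by (simp add: path_ball_def)
    then show ?thesis using le(2) by linarith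
  qed
  then show "q \<in> path_ball p k e" using q by (simp add: path_ball_def)
qed

text \<open>The distance of \<open>p\<close> from \<open>p0\<close> attains its maximum on the
  compact window, and the maximum is below \<open>e\<close>; the slack is a radius around
  \<open>p\<close>. For negative \<open>k\<close> the window is empty.\<close>

lemma path_ball_inner:
  assumes p: "p \<in> path_ball p0 k e" and p0: "p0 \<in> continuous_paths" and e: "0 < e"
  shows "\<exists>d>0. path_ball p k d \<subseteq> path_ball p0 k e"
proof (cases "0 \<le> k")
  case True
  have "continuous_on UNIV p" "continuous_on UNIV p0"
    using p p0 by (auto simp: path_ball_def continuous_paths_def)
  then have "continuous_on {-k..k} (\<lambda>t. \<bar>p t - p0 t\<bar>)"
    by (intro continuous_intros) (auto elim: continuous_on_subset)
  then obtain s where s: "s \<in> {-k..k}" "\<And>t. t \<in> {-k..k} \<Longrightarrow> \<bar>p t - p0 t\<bar> \<le> \<bar>p s - p0 s\<bar>"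
    using continuous_attains_sup[of "{-k..k}" "\<lambda>t. \<bar>p t - p0 t\<bar>"] True by auto
  have "\<bar>p s - p0 s\<bar> < e" using p s(1) by (auto simp: path_ball_def)
  moreover have "path_ball p k (e - \<bar>p s - p0 s\<bar>) \<subseteq> path_ball p0 k e"
  proof
    fix q assume q: "q \<in> path_ball p k (e - \<bar>p s - p0 s\<bar>)"
    have "\<bar>q t - p0 t\<bar> < e" if "t \<in> {-k..k}" for t
    proof -
      have "\<bar>q t - p t\<bar> < e - \<bar>p s - p0 s\<bar>" using q that by (simp add: path_ball_def)
      then show ?thesis using s(2)[OF that] by linarith
    qed
    then show "q \<in> path_ball p0 k e" using q by (simp add: path_ball_def)
  qed
  ultimately show ?thesis by (intro exI[of _ "e - \<bar>p s - p0 s\<bar>"]) auto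
next
  case False
  then show ?thesis using e by (intro exI[of _ e]) (auto simp: path_ball_def)
qed

text \<open>A generating set need not be centered at \<open>p\<close>. Recentering inside a
  generator, and taking the larger window and smaller radius in an intersection, shows that the
  balls around \<open>p\<close> form a neighbourhood base.\<close>

lemma openin_contains_path_ball:
  assumes "openin locally_uniform_topology U" "p \<in> U"
  shows "\<exists>k e. 0 < e \<and> path_ball p k e \<subseteq> U"
proof -
  have "generate_topology_on {path_ball p k e | p k e. p \<in> continuous_paths \<and> 0 < e} U"
    using assms(1) unfolding locally_uniform_topology_eq openin_topology_generated_by_iff .
  then show ?thesis using assms(2)
  proof (induction rule: generate_topology_on.induct)
    case (Int A B)
    then obtain k e k' e' where "0 < e" "path_ball p k e \<subseteq> A" "0 < e'" "path_ball p k' e' \<subseteq> B" by blast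
    moreover have "path_ball p (max k k') (min e e') \<subseteq> path_ball p k e"
      "path_ball p (max k k') (min e e') \<subseteq> path_ball p k' e'"
      by (rule path_ball_mono; simp)+
    ultimately have "0 < min e e' \<and> path_ball p (max k k') (min e e') \<subseteq> A \<inter> B" by auto
    then show ?case by blast
  next
    case (UN K)
    then obtain A where "A \<in> K" "p \<in> A" by blast
    then show ?case using UN.IH[of A] by blast
  next
    case (Basis s)
    then obtain p0 k e where s: "s = path_ball p0 k e" "p0 \<in> continuous_paths" "0 < e" by blast
    then show ?case using path_ball_inner[of p p0 k e] Basis.prems by blast
  qed simp
qed

text \<open>Step functions with rational values form a countable family that approximates continuous paths
  uniformly on compact intervals; testing at rational times makes the neighbourhoods measurable.\<close>

definition step_path :: "nat \<times> nat \<times> rat list \<Rightarrow> real \<Rightarrow> real" where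
  "step_path = (\<lambda>(k, N, l) t. of_rat (l ! nat \<lfloor>(t + real k) * real N\<rfloor>))"

definition step_nbhd :: "nat \<times> nat \<times> rat list \<Rightarrow> nat \<Rightarrow> (real \<Rightarrow> real) set" where
  "step_nbhd s n = {q. \<forall>t\<in>\<rat> \<inter> {- real (fst s)..real (fst s)}. \<bar>q t - step_path s t\<bar> \<le> 1 / real (Suc n)}"

lemma step_approximation:
  assumes p: "p \<in> continuous_paths"
  shows "\<exists>N l. p \<in> step_nbhd (k, N, l) n"
proof -
  let ?e = "1 / real (Suc n)"
  have "uniformly_continuous_on {- real k..real k} p"
    using p by (intro compact_uniformly_continuous) (auto simp: continuous_paths_def intro: continuous_on_subset)
  moreover have e2: "0 < ?e / 2" by simp
  ultimately obtain d where d: "0 < d"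
    "\<And>s t. s \<in> {- real k..real k} \<Longrightarrow> t \<in> {- real k..real k} \<Longrightarrow> dist s t < d \<Longrightarrow> dist (p s) (p t) < ?e / 2"
    unfolding uniformly_continuous_on_def by meson
  obtain N where N: "N > 0" "1 / real N < d"
    using reals_Archimedean[OF d(1)] by (metis inverse_eq_divide zero_less_Suc)
  define x where "x i = real i / real N - real k" for i
  have "\<exists>c::rat. \<bar>of_rat c - p (x i)\<bar> < ?e / 2" for i
  proof -
    obtain c where c: "c \<in> \<rat>" "p (x i) - ?e / 2 < c" "c < p (x i) + ?e / 2"
      using Rats_dense_in_real[of "p (x i) - ?e / 2" "p (x i) + ?e / 2"] e2 by auto
    then obtain c' :: rat where "c = of_rat c'" by (auto elim: Rats_cases)
    then show ?thesis using c by (intro exI[of _ c']) (simp add: abs_less_iff)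
  qed
  then obtain c :: "nat \<Rightarrow> rat" where c: "\<And>i. \<bar>of_rat (c i) - p (x i)\<bar> < ?e / 2" by metis
  \<comment> \<open>The right end \<open>t = real k\<close> falls into the step with index
    \<open>2 * k * N\<close>, hence one entry more than there are cells.\<close>
  define l where "l = map c [0..<Suc (2 * k * N)]"
  have "\<bar>p t - step_path (k, N, l) t\<bar> \<le> ?e" if t: "t \<in> {- real k..real k}" for t
  proof -
    define i where "i = nat \<lfloor>(t + real k) * real N\<rfloor>"
    have nonneg: "0 \<le> (t + real k) * real N" using t by simp
    have i: "real i \<le> (t + real k) * real N" "(t + real k) * real N < real i + 1"
      using nonneg by (auto simp: i_def)
    have "(t + real k) * real N \<le> (2 * real k) * real N"
      using t by (intro mult_right_mono) auto
    then have "real i \<le> real (2 * k * N)" using i(1) by simp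
    then have "i \<le> 2 * k * N" by (simp only: of_nat_le_iff)
    then have len: "i < length l" by (simp add: l_def)
    have "real i / real N \<le> t + real k" "t + real k < (real i + 1) / real N"
      using i N(1) by (simp_all add: pos_divide_le_eq pos_less_divide_eq)
    then have near: "x i \<le> t" "t < x i + 1 / real N"
      by (simp_all add: x_def add_divide_distrib)
    have "- real k \<le> x i" by (simp add: x_def)
    then have "dist (p t) (p (x i)) < ?e / 2"
      using near t N by (intro d(2)) (auto simp: dist_real_def)
    moreover have "step_path (k, N, l) t = of_rat (c i)"
      unfolding step_path_def using len by (simp add: i_def[symmetric] l_def del: upt_Suc)
    moreover have "\<bar>y - z\<bar> \<le> e" if "dist y v < e / 2" "\<bar>z - v\<bar> < e / 2" for y z v e :: real
      using that unfolding dist_real_def by linarith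
    ultimately show ?thesis using c[of i] by metis
  qed
  then have "p \<in> step_nbhd (k, N, l) n" by (auto simp: step_nbhd_def)
  then show ?thesis by blast
qed

text \<open>At rational times both paths are within the tolerance of the same step function, hence
  within twice the tolerance of each other, and continuity extends this to all times. By
  \<open>k > 0\<close> the closed window is the closure of the open one, in which rationals are
  dense.\<close>

lemma step_nbhd_close:
  assumes p: "p \<in> continuous_paths" "p \<in> step_nbhd (k, N, l) n"
    and q: "q \<in> continuous_paths" "q \<in> step_nbhd (k, N, l) n" and t: "t \<in> {- real k..real k}" and k: "k > 0"
  shows "\<bar>q t - p t\<bar> \<le> 2 / real (Suc n)"
proof -
  let ?I = "{- real k <..< real k}"
  have rat: "\<bar>q s - p s\<bar> \<le> 2 / real (Suc n)" if "s \<in> \<rat> \<inter> {- real k..real k}" for s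
  proof -
    have "\<bar>p s - step_path (k, N, l) s\<bar> \<le> 1 / real (Suc n)" "\<bar>q s - step_path (k, N, l) s\<bar> \<le> 1 / real (Suc n)"
      using p(2) q(2) that by (auto simp: step_nbhd_def)
    then have "\<bar>q s - p s\<bar> \<le> 1 / real (Suc n) + 1 / real (Suc n)" by linarith
    then show ?thesis by simp
  qed
  have "closure (?I \<inter> \<rat>) = closure ?I"
    by (rule closure_open_Int_superset) (auto simp: Rats_closure_real)
  then have "t \<in> closure (?I \<inter> \<rat>)"
    using t k by simp
  moreover have "closed {t. \<bar>q t - p t\<bar> \<le> 2 / real (Suc n)}"
    using p(1) q(1) by (intro closed_Collect_le continuous_intros) (auto simp: continuous_paths_def)
  then have "closure (?I \<inter> \<rat>) \<subseteq> {t. \<bar>q t - p t\<bar> \<le> 2 / real (Suc n)}"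
    by (rule closure_minimal[rotated]) (use rat in auto)
  ultimately show ?thesis by auto
qed

text \<open>Second countability of path space: the indices \<open>(s, n)\<close> come from a
  countable type, so an open set is recovered from countably many test neighbourhoods.\<close>

lemma openin_countable_union:
  assumes U: "openin locally_uniform_topology U"
  defines "I \<equiv> {(s, n). continuous_paths \<inter> step_nbhd s n \<subseteq> U}"
  shows "U = continuous_paths \<inter> (\<Union>(s, n)\<in>I. step_nbhd s n)"
proof (intro equalityI subsetI)
  fix p assume pU: "p \<in> U"
  then have p: "p \<in> continuous_paths" using openin_subset_continuous_paths[OF U] by blast
  obtain k e where e: "0 < e" "path_ball p k e \<subseteq> U"
    using openin_contains_path_ball[OF U pU] by blast
  obtain k' where k': "k \<le> real k'" "k' > 0"
    using real_arch_simple[of "max k 1"] by (metis gr0I max.bounded_iff not_one_le_zero of_nat_0)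
  obtain n where n: "2 / real (Suc n) < e"
    using reals_Archimedean[of "e / 2"] e(1) by (auto simp: inverse_eq_divide)
  obtain N l where s: "p \<in> step_nbhd (k', N, l) n"
    using step_approximation[OF p] by blast
  have "continuous_paths \<inter> step_nbhd (k', N, l) n \<subseteq> path_ball p k e"
  proof
    fix q assume q: "q \<in> continuous_paths \<inter> step_nbhd (k', N, l) n"
    have "\<bar>q t - p t\<bar> < e" if "t \<in> {-k..k}" for t
      using step_nbhd_close[OF p s, of q t] q that k' n by auto
    then show "q \<in> path_ball p k e" using q by (auto simp: path_ball_def)
  qed
  then have "((k', N, l), n) \<in> I" using e(2) by (auto simp: I_def)
  then show "p \<in> continuous_paths \<inter> (\<Union>(s, n)\<in>I. step_nbhd s n)" using p s by blast
qed (auto simp: I_def)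

lemma space_path_borel: "space path_borel = continuous_paths"
  unfolding path_borel_def by (intro space_measure_of) (auto dest: openin_subset_continuous_paths)

text \<open>This makes the process a random element of path space, so that integrals against
  \<open>path_law\<close> can be pulled back. An open set reduces to countably many tests at
  rational times, each involving a single variable \<open>Z w t\<close>.\<close>

lemma path_measurable:
  assumes Z: "\<And>u. (\<lambda>w. Z w u) \<in> borel_measurable M" and cont: "\<And>w. w \<in> space M \<Longrightarrow> Z w \<in> continuous_paths"
  shows "Z \<in> measurable M path_borel"
  unfolding path_borel_def
proof (rule measurable_measure_of)
  show "Z \<in> space M \<rightarrow> continuous_paths" using cont by blast
  fix U assume "U \<in> {U. openin locally_uniform_topology U}"
  then have U: "U = continuous_paths \<inter> (\<Union>(s, n)\<in>{(s, n). continuous_paths \<inter> step_nbhd s n \<subseteq> U}. step_nbhd s n)"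
    (is "_ = _ \<inter> (\<Union>(s, n)\<in>?I. _)")
    by (intro openin_countable_union) simp
  have nbhd: "{w \<in> space M. Z w \<in> step_nbhd s n} \<in> sets M" for s n
  proof -
    have "{w \<in> space M. \<bar>Z w t - step_path s t\<bar> \<le> 1 / real (Suc n)} \<in> sets M" for t
      using Z[of t] by measurable
    then show ?thesis
      unfolding step_nbhd_def mem_Collect_eq
      by (intro sets.sets_Collect_countable_All' countable_Int1 countable_rat)
  qed
  have "Z -` U \<inter> space M = (\<Union>(s, n)\<in>?I. {w \<in> space M. Z w \<in> step_nbhd s n})"
    by (subst U) (use cont in auto)
  also have "\<dots> \<in> sets M"
    using nbhd by (intro sets.countable_UN'') (auto intro: countableI_type)
  finally show "Z -` U \<inter> space M \<in> sets M" .
qed (auto dest: openin_subset_continuous_paths)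

text \<open>The paths below \<open>a\<close> at time \<open>u\<close> form an open set: with
  \<open>p\<close> it contains the ball of radius \<open>a - p u\<close> over the window from
  \<open>- \<bar>u\<bar>\<close> to \<open>\<bar>u\<bar>\<close>.\<close>

lemma evaluation_measurable: "(\<lambda>p. p u) \<in> borel_measurable path_borel"
  unfolding borel_measurable_iff_less
proof
  fix a :: real
  let ?U = "{p \<in> continuous_paths. p u < a}"
  have "?U = (\<Union>p\<in>?U. path_ball p \<bar>u\<bar> (a - p u))"
  proof (intro equalityI subsetI)
    fix q assume "q \<in> (\<Union>p\<in>?U. path_ball p \<bar>u\<bar> (a - p u))"
    then obtain p where q: "q \<in> continuous_paths" "\<forall>t\<in>{-\<bar>u\<bar>..\<bar>u\<bar>}. \<bar>q t - p t\<bar> < a - p u"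
      by (auto simp: path_ball_def)
    moreover have "u \<in> {-\<bar>u\<bar>..\<bar>u\<bar>}" by auto
    ultimately have "\<bar>q u - p u\<bar> < a - p u" by blast
    then show "q \<in> ?U" using q(1) by simp
  qed (auto simp: path_ball_def intro!: bexI)
  moreover have "openin locally_uniform_topology (\<Union>p\<in>?U. path_ball p \<bar>u\<bar> (a - p u))"
    by (intro openin_Union) (auto intro: openin_path_ball)
  ultimately have "openin locally_uniform_topology ?U" by simp
  then have "?U \<in> sets path_borel"
    unfolding path_borel_def by (subst sets_measure_of) (auto dest: openin_subset_continuous_paths)
  then show "{p \<in> space path_borel. p u < a} \<in> sets path_borel"
    by (simp add: space_path_borel)
qed

lemma moment_path_law:
  assumes "\<And>u. (\<lambda>w. Z w u) \<in> borel_measurable M" and "\<And>w. w \<in> space M \<Longrightarrow> Z w \<in> continuous_paths"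
  shows "moment M Z r x = (\<integral>p. (\<Prod>a<r. p (x a)) \<partial>path_law M Z)"
  unfolding moment_def path_law_def
  by (rule integral_distr[symmetric]) (use assms in \<open>auto intro!: path_measurable borel_measurable_prod evaluation_measurable\<close>)

section \<open>Passage to multiple Wiener integrals\<close>

text \<open>Bounded second moments give uniform integrability. Fatou's lemma extends the bound to
  the limit, truncation at level \<open>K\<close> costs at most \<open>C / K\<close> in every
  expectation, and the truncated variables converge by domination.\<close>

lemma (in prob_space) expectation_tendsto_of_bounded_square:
  fixes Y :: "nat \<Rightarrow> 'a \<Rightarrow> real"
  assumes Y[measurable]: "\<And>n. Y n \<in> borel_measurable M" and X[measurable]: "X \<in> borel_measurable M"
    and int: "\<And>n. integrable M (\<lambda>w. (Y n w)\<^sup>2)" and bound: "\<And>n. expectation (\<lambda>w. (Y n w)\<^sup>2) \<le> C"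
    and lim: "AE w in M. (\<lambda>n. Y n w) \<longlonglongrightarrow> X w"
  shows "integrable M X" "(\<lambda>n. expectation (Y n)) \<longlonglongrightarrow> expectation X"
proof -
  have C: "0 \<le> C" using bound[of 0] by (rule order_trans[rotated]) simp
  have "(\<integral>\<^sup>+w. ennreal ((X w)\<^sup>2) \<partial>M) = (\<integral>\<^sup>+w. liminf (\<lambda>n. ennreal ((Y n w)\<^sup>2)) \<partial>M)"
  proof (rule nn_integral_cong_AE)
    show "AE w in M. ennreal ((X w)\<^sup>2) = liminf (\<lambda>n. ennreal ((Y n w)\<^sup>2))"
      using lim
    proof eventually_elim
      case (elim w)
      then have "(\<lambda>n. ennreal ((Y n w)\<^sup>2)) \<longlonglongrightarrow> ennreal ((X w)\<^sup>2)"
        by (intro tendsto_ennrealI tendsto_power)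
      then show ?case using lim_imp_Liminf[OF trivial_limit_sequentially] by metis
    qed
  qed
  also have "\<dots> \<le> liminf (\<lambda>n. \<integral>\<^sup>+w. ennreal ((Y n w)\<^sup>2) \<partial>M)"
    by (rule nn_integral_liminf) measurable
  also have "\<dots> \<le> liminf (\<lambda>n::nat. ennreal C)"
  proof (rule Liminf_mono, rule always_eventually, rule allI)
    fix n
    have "(\<integral>\<^sup>+w. ennreal ((Y n w)\<^sup>2) \<partial>M) = ennreal (expectation (\<lambda>w. (Y n w)\<^sup>2))"
      by (rule nn_integral_eq_integral[OF int]) simp
    then show "(\<integral>\<^sup>+w. ennreal ((Y n w)\<^sup>2) \<partial>M) \<le> ennreal C"
      using bound[of n] by (simp add: ennreal_leI)
  qed
  finally have nn: "(\<integral>\<^sup>+w. ennreal ((X w)\<^sup>2) \<partial>M) \<le> ennreal C"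
    by (simp add: Liminf_const)
  have intX2: "integrable M (\<lambda>w. (X w)\<^sup>2)"
    by (rule integrableI_nonneg) (use nn in \<open>auto intro: le_less_trans\<close>)
  have boundX: "expectation (\<lambda>w. (X w)\<^sup>2) \<le> C"
    using nn nn_integral_eq_integral[OF intX2] C by (simp add: ennreal_le_iff)
  have square_int: "integrable M V" if "V \<in> borel_measurable M" "integrable M (\<lambda>w. (V w)\<^sup>2)" for V :: "'a \<Rightarrow> real"
    using that by (rule square_integrable_imp_integrable)
  show intX: "integrable M X" by (rule square_int[OF X intX2])
  define clip where "clip K y = max (- K) (min K y)" for K y :: real
  have clip_meas[measurable]: "(\<lambda>w. clip K (V w)) \<in> borel_measurable M" if [measurable]: "V \<in> borel_measurable M" for K V
    unfolding clip_def by measurable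
  have clip_bound: "\<bar>clip K y\<bar> \<le> K" if "K > 0" for K y
    using that by (auto simp: clip_def)
  have clip_int: "integrable M (\<lambda>w. clip K (V w))" if "K > 0" "V \<in> borel_measurable M" for K V
    by (rule integrable_const_bound[of _ K]) (use clip_bound[OF that(1)] that(2) in auto)
  \<comment> \<open>Only values beyond \<open>K\<close> are changed, and for these
    \<open>\<bar>y\<bar> * K \<le> y\<^sup>2\<close>.\<close>
  have clip_close: "\<bar>y - clip K y\<bar> \<le> y\<^sup>2 / K" if K: "K > 0" for K y
  proof (cases "\<bar>y\<bar> \<le> K")
    case True
    then have "clip K y = y" by (auto simp: clip_def)
    then show ?thesis using K by simp
  next
    case False
    then have "\<bar>y - clip K y\<bar> \<le> \<bar>y\<bar>" using K by (auto simp: clip_def max_def min_def)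
    also have "\<bar>y\<bar> * K \<le> \<bar>y\<bar> * \<bar>y\<bar>" using False by (intro mult_left_mono) auto
    then have "\<bar>y\<bar> \<le> y\<^sup>2 / K" using K by (simp add: pos_le_divide_eq power2_eq_square)
    finally show ?thesis .
  qed
  have trunc: "\<bar>expectation V - expectation (\<lambda>w. clip K (V w))\<bar> \<le> C / K"
    if K: "K > 0" and V: "V \<in> borel_measurable M" "integrable M (\<lambda>w. (V w)\<^sup>2)" "expectation (\<lambda>w. (V w)\<^sup>2) \<le> C" for K V
  proof -
    have i: "integrable M (\<lambda>w. V w - clip K (V w))"
      using square_int[OF V(1,2)] clip_int[OF K V(1)] by simp
    have "\<bar>expectation V - expectation (\<lambda>w. clip K (V w))\<bar> = \<bar>expectation (\<lambda>w. V w - clip K (V w))\<bar>"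
      using square_int[OF V(1,2)] clip_int[OF K V(1)] by simp
    also have "\<dots> \<le> expectation (\<lambda>w. \<bar>V w - clip K (V w)\<bar>)"
      by (rule integral_abs_bound)
    also have "\<dots> \<le> expectation (\<lambda>w. (V w)\<^sup>2 / K)"
      using i V(2) by (intro integral_mono clip_close K) auto
    also have "\<dots> \<le> C / K"
      using V(3) K by (simp add: divide_right_mono)
    finally show ?thesis .
  qed
  show "(\<lambda>n. expectation (Y n)) \<longlonglongrightarrow> expectation X"
  proof (rule LIMSEQ_I)
    fix e :: real assume e: "e > 0"
    \<comment> \<open>Both truncation errors and the clipped difference come out at most
      \<open>e / 4\<close>; the summand 1 keeps \<open>K\<close> positive when
      \<open>C = 0\<close>.\<close>
    define K where "K = 4 * (C + 1) / e"
    have K: "K > 0" using e C by (simp add: K_def)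
    have CK: "C / K \<le> e / 4"
    proof -
      have "C * e \<le> (C + 1) * e" using e by simp
      then show ?thesis using e C by (simp add: K_def field_simps)
    qed
    have "(\<lambda>n. expectation (\<lambda>w. clip K (Y n w))) \<longlonglongrightarrow> expectation (\<lambda>w. clip K (X w))"
    proof (rule integral_dominated_convergence[where w = "\<lambda>_. K"])
      show "AE w in M. (\<lambda>n. clip K (Y n w)) \<longlonglongrightarrow> clip K (X w)"
        using lim by eventually_elim (auto simp: clip_def intro!: tendsto_intros)
    qed (use clip_bound[OF K] in auto)
    then obtain n0 where n0: "\<And>n. n \<ge> n0 \<Longrightarrow>
        norm (expectation (\<lambda>w. clip K (Y n w)) - expectation (\<lambda>w. clip K (X w))) < e / 4"
      using LIMSEQ_D[of _ _ "e / 4"] e by (metis divide_pos_pos zero_less_numeral)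
    have "norm (expectation (Y n) - expectation X) < e" if "n \<ge> n0" for n
      using n0[OF that] trunc[OF K Y int bound, of n] trunc[OF K X intX2 boundX] CK e
      unfolding real_norm_def by linarith
    then show "\<exists>n0. \<forall>n\<ge>n0. norm (expectation (Y n) - expectation X) < e" by blast
  qed
qed

text \<open>The integral with its approximating sequences exposed. In order 0 the vectors may have
  any norm, so that the constant term is treated like the others, with the zero vector, even on the
  trivial space.\<close>

definition wiener_limit ::
    "'w measure \<Rightarrow> ('h::real_inner \<Rightarrow> 'w \<Rightarrow> real) \<Rightarrow> nat \<Rightarrow> 'h tensor \<Rightarrow> ('w \<Rightarrow> real)
      \<Rightarrow> (nat \<Rightarrow> 'h set) \<Rightarrow> (nat \<Rightarrow> 'h \<Rightarrow> real) \<Rightarrow> bool" where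
  "wiener_limit M V q T X S c \<longleftrightarrow>
     X \<in> borel_measurable M \<and> integrable M (\<lambda>w. (X w)\<^sup>2) \<and>
     (\<forall>n. finite (S n) \<and> (\<forall>h\<in>S n. 0 < q \<longrightarrow> norm h = 1)) \<and>
     (\<lambda>n. tensor_norm q (\<lambda>ks. T ks - (\<Sum>h\<in>S n. c n h * pure_power q h ks))) \<longlonglongrightarrow> 0 \<and>
     (\<lambda>n. \<integral>w. (X w - (\<Sum>h\<in>S n. c n h * hermite q (V h w)))\<^sup>2 \<partial>M) \<longlonglongrightarrow> 0"

lemma wiener_limit_positive:
  assumes "multiple_wiener_integral M V q T X"
  shows "\<exists>S c. wiener_limit M V q T X S c"
proof -
  have X: "X \<in> borel_measurable M" "integrable M (\<lambda>w. (X w)\<^sup>2)"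
    using assms by (simp_all add: multiple_wiener_integral_def)
  from assms[unfolded multiple_wiener_integral_def, THEN conjunct2, THEN conjunct2]
  obtain S c where "(\<forall>n. finite (S n) \<and> (\<forall>h\<in>S n. norm h = 1)) \<and>
      (\<lambda>n. tensor_norm q (\<lambda>ks. T ks - (\<Sum>h\<in>S n. c n h * pure_power q h ks))) \<longlonglongrightarrow> 0 \<and>
      (\<lambda>n. \<integral>w. (X w - (\<Sum>h\<in>S n. c n h * hermite q (V h w)))\<^sup>2 \<partial>M) \<longlonglongrightarrow> 0"
    by (elim exE) (rule that)
  then have "wiener_limit M V q T X S c"
    using X by (simp add: wiener_limit_def)
  then show ?thesis by blast
qed

lemma (in prob_space) wiener_limit_zero:
  fixes T :: "'h::real_inner tensor"
  assumes "T \<in> tensor_power_space 0"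
  shows "wiener_limit M V 0 T (\<lambda>_. T []) (\<lambda>_. {0}) (\<lambda>_ _. T [])"
proof -
  have "T ks - (\<Sum>h\<in>{0}. T [] * pure_power 0 h ks) = 0" for ks
    using assms by (cases ks) (auto simp: pure_power_def tensor_power_space_def multilinear_form_def)
  then have diff: "(\<lambda>ks. T ks - (\<Sum>h\<in>{0}. T [] * pure_power 0 h ks)) = (\<lambda>_. 0)"
    by (rule ext)
  have "tensor_norm 0 (\<lambda>_ :: 'h list. 0) = 0"
  proof -
    have "{F :: 'h set. finite F \<and> orthonormal_set F} \<noteq> {}"
      using orthonormal_set_empty by blast
    then have "(SUP F\<in>{F :: 'h set. finite F \<and> orthonormal_set F}. 0 :: real) = 0"
      by (rule cSUP_const)
    then show ?thesis by (simp add: tensor_norm_def square_sum_def)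
  qed
  then show ?thesis unfolding wiener_limit_def diff by simp
qed

lemma arrays_with_loopfree: "N \<in> arrays_with r q \<Longrightarrow> loopfree r N"
  by (auto simp: arrays_with_def loopfree_def)

lemma contr_cong:
  assumes "\<And>a. a < r \<Longrightarrow> t a = t' a"
  shows "contr B r N t = contr B r N t'"
  unfolding contr_def by (intro infsum_cong prod.cong refl) (use assms in auto)

text \<open>The value of the expected product of integrals of orders \<open>q a\<close> at times
  \<open>x a\<close>, in a form that is defined for all tensors \<open>t\<close> and in which limits
  can be taken.\<close>

definition diagram_sum :: "'h::real_inner set \<Rightarrow> nat \<Rightarrow> (nat \<Rightarrow> real) \<Rightarrow> (nat \<Rightarrow> nat) \<Rightarrow> (nat \<Rightarrow> 'h tensor) \<Rightarrow> real" where
  "diagram_sum B r x q t = (\<Prod>a<r. fact (q a)) *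
     (\<Sum>N\<in>arrays_with r q. edge_weight r (\<lambda>a b. exp (- (x a - x b)\<^sup>2)) N * contr B r N t)"

lemma diagram_sum_tendsto:
  assumes B: "orthonormal_set B"
    and t: "\<And>a. a < r \<Longrightarrow> hs_bounded (q a) (t a)"
    and s: "\<And>n a. a < r \<Longrightarrow> hs_bounded (q a) (s n a)"
    and lim: "\<And>a. a < r \<Longrightarrow> (\<lambda>n. tensor_norm (q a) (\<lambda>ks. t a ks - s n a ks)) \<longlonglongrightarrow> 0"
  shows "(\<lambda>n. diagram_sum B r x q (s n)) \<longlonglongrightarrow> diagram_sum B r x q t"
  unfolding diagram_sum_def
proof (intro tendsto_mult tendsto_const tendsto_sum)
  fix N assume N: "N \<in> arrays_with r q"
  then have rows: "row_sum r N a = q a" if "a < r" for a using that by (auto simp: arrays_with_def)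
  show "(\<lambda>n. contr B r N (s n)) \<longlonglongrightarrow> contr B r N t"
    by (rule contr_tendsto[OF B arrays_with_loopfree[OF N]]) (use assms rows in auto)
qed

lemma prod_lessThan_add: "(\<Prod>a<r + k. g a) = (\<Prod>a<r. g a) * (\<Prod>a<k. g (r + a))" for g :: "nat \<Rightarrow> real"
  by (induction k) (auto simp: mult.assoc)

section \<open>The diagram formula on the canvas\<close>

locale canvas = prob_space M for M :: "'w measure" +
  fixes W :: "real \<Rightarrow> 'h::real_inner \<Rightarrow> 'w \<Rightarrow> real" and B :: "'h set"
  assumes canvas: "gaussian_canvas M W" and basis: "orthonormal_basis B"
begin

definition linear_span :: "('w \<Rightarrow> real) set" where
  "linear_span = {X. \<exists>S c. finite S \<and> X = (\<lambda>w. \<Sum>(u, h)\<in>S. c (u, h) * W u h w)}"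

sublocale gaussian_space M linear_span
proof
  fix X Y assume "X \<in> linear_span" "Y \<in> linear_span"
  then obtain S c S' c' where S: "finite S" "X = (\<lambda>w. \<Sum>(u, h)\<in>S. c (u, h) * W u h w)"
    and S': "finite S'" "Y = (\<lambda>w. \<Sum>(u, h)\<in>S'. c' (u, h) * W u h w)"
    by (auto simp: linear_span_def)
  define d where "d p = (if p \<in> S then c p else 0) + (if p \<in> S' then c' p else 0)" for p
  have "X w + Y w = (\<Sum>(u, h)\<in>S \<union> S'. d (u, h) * W u h w)" for w
  proof -
    have "X w = (\<Sum>p\<in>S \<union> S'. (if p \<in> S then c p else 0) * W (fst p) (snd p) w)"
      unfolding S(2) by (rule sum.mono_neutral_cong_left) (use S S' in auto)
    moreover have "Y w = (\<Sum>p\<in>S \<union> S'. (if p \<in> S' then c' p else 0) * W (fst p) (snd p) w)"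
      unfolding S'(2) by (rule sum.mono_neutral_cong_left) (use S S' in auto)
    ultimately show ?thesis
      by (simp add: d_def distrib_right sum.distrib case_prod_unfold cong: if_cong)
  qed
  then show "(\<lambda>w. X w + Y w) \<in> linear_span"
    using S(1) S'(1) unfolding linear_span_def by blast
next
  fix a X assume "X \<in> linear_span"
  then obtain S c where S: "finite S" "X = (\<lambda>w. \<Sum>(u, h)\<in>S. c (u, h) * W u h w)"
    by (auto simp: linear_span_def)
  have "(\<lambda>w. a * X w) = (\<lambda>w. \<Sum>(u, h)\<in>S. (a * c (u, h)) * W u h w)"
    unfolding S(2) sum_distrib_left by (auto intro!: ext sum.cong)
  then have "\<exists>S' c'. finite S' \<and> (\<lambda>w. a * X w) = (\<lambda>w. \<Sum>(u, h)\<in>S'. c' (u, h) * W u h w)"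
    using S(1) by (intro exI[of _ S] exI[of _ "\<lambda>p. a * c p"]) simp
  then show "(\<lambda>w. a * X w) \<in> linear_span" unfolding linear_span_def by simp
next
  fix X assume "X \<in> linear_span"
  then show "centered_gaussian_rv M X"
    using canvas by (auto simp: linear_span_def gaussian_canvas_def)
qed

lemma canvas_mem: "W u h \<in> linear_span"
  unfolding linear_span_def by (rule CollectI, rule exI[of _ "{(u, h)}"], rule exI[of _ "\<lambda>_. 1"]) simp

lemma cov_canvas: "cov (W u h) (W v k) = exp (- (u - v)\<^sup>2) * inner h k"
  using canvas by (simp add: cov_def gaussian_canvas_def)

definition approximant :: "real \<Rightarrow> nat \<Rightarrow> 'h set \<Rightarrow> ('h \<Rightarrow> real) \<Rightarrow> 'w \<Rightarrow> real" where
  "approximant u q S c w = (\<Sum>h\<in>S. c h * hermite q (W u h w))"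

lemma approximant_moments: "has_all_moments M (approximant u q S c)"
  unfolding approximant_def
  by (intro has_all_moments_sum has_all_moments_scale has_all_moments_hermite has_all_moments canvas_mem)

text \<open>Both sides are multilinear, so one vector per vertex suffices. There the covariance
  \<open>exp (- (u - v)\<^sup>2) * inner h k\<close> separates into the kernel, which enters the
  edge weight, and the inner products, which form the contraction of powers.\<close>

lemma approximant_diagram:
  assumes S: "\<And>a. a < r \<Longrightarrow> finite (S a)" "\<And>a h. a < r \<Longrightarrow> h \<in> S a \<Longrightarrow> 0 < q a \<Longrightarrow> norm h = 1"
  shows "expectation (\<lambda>w. \<Prod>a<r. approximant (x a) (q a) (S a) (c a) w)
    = diagram_sum B r x q (\<lambda>a ks. \<Sum>h\<in>S a. c a h * pure_power (q a) h ks)"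
proof -
  let ?e = "\<lambda>a b. exp (- (x a - x b)\<^sup>2)"
  let ?P = "PiE {..<r} S"
  have fin: "finite ?P" using S(1) by (intro finite_PiE) auto
  have B: "orthonormal_set B" using basis by (simp add: orthonormal_basis_def)
  have term1: "expectation (\<lambda>w. \<Prod>a<r. hermite (q a) (W (x a) (\<eta> a) w))
      = (\<Prod>a<r. fact (q a)) * (\<Sum>N\<in>arrays_with r q. edge_weight r ?e N * contr B r N (\<lambda>a. pure_power (q a) (\<eta> a)))"
    if \<eta>: "\<eta> \<in> ?P" for \<eta>
  proof -
    have "cov (W (x a) (\<eta> a)) (W (x a) (\<eta> a)) = 1" if "a < r" "0 < q a" for a
      using S(2)[of a "\<eta> a"] that \<eta> by (auto simp: cov_canvas PiE_iff dot_square_norm)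
    then have "expectation (\<lambda>w. \<Prod>a<r. hermite (q a) (W (x a) (\<eta> a) w))
        = (\<Prod>a<r. fact (q a)) * (\<Sum>N\<in>arrays_with r q. edge_weight r (\<lambda>a b. ?e a b * inner (\<eta> a) (\<eta> b)) N)"
      using hermite_diagram[of r "\<lambda>a. W (x a) (\<eta> a)" q] by (simp add: canvas_mem cov_canvas)
    also have "(\<Sum>N\<in>arrays_with r q. edge_weight r (\<lambda>a b. ?e a b * inner (\<eta> a) (\<eta> b)) N)
        = (\<Sum>N\<in>arrays_with r q. edge_weight r ?e N * contr B r N (\<lambda>a. pure_power (q a) (\<eta> a)))"
    proof (rule sum.cong[OF refl])
      fix N assume N: "N \<in> arrays_with r q"
      have "contr B r N (\<lambda>a. pure_power (q a) (\<eta> a)) = contr B r N (\<lambda>a. pure_power (row_sum r N a) (\<eta> a))"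
        by (rule contr_cong) (use N in \<open>auto simp: arrays_with_def\<close>)
      also have "\<dots> = (\<Prod>(a, b)\<in>vertex_pairs r. inner (\<eta> a) (\<eta> b) ^ N a b)"
        by (rule contr_pure_power[OF basis arrays_with_loopfree[OF N]])
      finally show "edge_weight r (\<lambda>a b. ?e a b * inner (\<eta> a) (\<eta> b)) N
          = edge_weight r ?e N * contr B r N (\<lambda>a. pure_power (q a) (\<eta> a))"
        by (simp add: edge_weight_def prod.distrib[symmetric] case_prod_unfold power_mult_distrib)
    qed
    finally show ?thesis .
  qed
  have int: "integrable M (\<lambda>w. \<Prod>a<r. hermite (q a) (W (x a) (\<eta> a) w))" for \<eta>
    by (intro has_all_moments_integrable has_all_moments_prod has_all_moments_hermite has_all_moments canvas_mem)
  have "(\<Prod>a<r. approximant (x a) (q a) (S a) (c a) w)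
      = (\<Sum>\<eta>\<in>?P. (\<Prod>a<r. c a (\<eta> a)) * (\<Prod>a<r. hermite (q a) (W (x a) (\<eta> a) w)))" for w
    unfolding approximant_def by (subst prod_sum_PiE) (use S(1) in \<open>auto simp: prod.distrib\<close>)
  then have "expectation (\<lambda>w. \<Prod>a<r. approximant (x a) (q a) (S a) (c a) w)
      = (\<Sum>\<eta>\<in>?P. (\<Prod>a<r. c a (\<eta> a)) * expectation (\<lambda>w. \<Prod>a<r. hermite (q a) (W (x a) (\<eta> a) w)))"
    using int by simp
  also have "\<dots> = (\<Sum>\<eta>\<in>?P. \<Sum>N\<in>arrays_with r q. (\<Prod>a<r. fact (q a)) * edge_weight r ?e N *
      ((\<Prod>a<r. c a (\<eta> a)) * contr B r N (\<lambda>a. pure_power (q a) (\<eta> a))))"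
    by (rule sum.cong[OF refl]) (simp add: term1 sum_distrib_left mult_ac)
  also have "\<dots> = (\<Sum>N\<in>arrays_with r q. (\<Prod>a<r. fact (q a)) * edge_weight r ?e N *
      (\<Sum>\<eta>\<in>?P. (\<Prod>a<r. c a (\<eta> a)) * contr B r N (\<lambda>a. pure_power (q a) (\<eta> a))))"
    by (subst sum.swap) (simp add: sum_distrib_left)
  also have "\<dots> = (\<Sum>N\<in>arrays_with r q. (\<Prod>a<r. fact (q a)) * edge_weight r ?e N *
      contr B r N (\<lambda>a ks. \<Sum>h\<in>S a. c a h * pure_power (q a) h ks))"
  proof (rule sum.cong[OF refl])
    fix N assume N: "N \<in> arrays_with r q"
    have "contr B r N (\<lambda>a ks. \<Sum>h\<in>S a. c a h * pure_power (q a) h ks)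
        = (\<Sum>\<eta>\<in>?P. (\<Prod>a<r. c a (\<eta> a)) * contr B r N (\<lambda>a. pure_power (q a) (\<eta> a)))"
    proof (rule contr_multilinear[OF B arrays_with_loopfree[OF N]])
      show "hs_bounded (row_sum r N a) (pure_power (q a) h)" if "a < r" for a h
        using N that hs_bounded_pure_power[of "q a"] by (simp add: arrays_with_def)
    qed (use S(1) in auto)
    then show "(\<Prod>a<r. fact (q a)) * edge_weight r ?e N *
        (\<Sum>\<eta>\<in>?P. (\<Prod>a<r. c a (\<eta> a)) * contr B r N (\<lambda>a. pure_power (q a) (\<eta> a)))
      = (\<Prod>a<r. fact (q a)) * edge_weight r ?e N *
        contr B r N (\<lambda>a ks. \<Sum>h\<in>S a. c a h * pure_power (q a) h ks)" by simp
  qed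
  finally show ?thesis
    by (simp add: diagram_sum_def sum_distrib_left mult_ac)
qed

lemma wiener_limit_diagram:
  assumes lim: "\<And>a. a < r \<Longrightarrow> wiener_limit M (W (x a)) (q a) (t a) (X a) (S a) (c a)"
    and t: "\<And>a. a < r \<Longrightarrow> hs_bounded (q a) (t a)"
  shows "integrable M (\<lambda>w. \<Prod>a<r. X a w)"
    and "expectation (\<lambda>w. \<Prod>a<r. X a w) = diagram_sum B r x q t"
proof -
  have B: "orthonormal_set B" using basis by (simp add: orthonormal_basis_def)
  define F where "F n a = approximant (x a) (q a) (S a n) (c a n)" for n a
  define s where "s n a ks = (\<Sum>h\<in>S a n. c a n h * pure_power (q a) h ks)" for n a ks
  have X[measurable]: "X a \<in> borel_measurable M" and X2: "integrable M (\<lambda>w. (X a w)\<^sup>2)"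
    and S: "\<And>n. finite (S a n)" "\<And>n h. h \<in> S a n \<Longrightarrow> 0 < q a \<Longrightarrow> norm h = 1"
    and tlim: "(\<lambda>n. tensor_norm (q a) (\<lambda>ks. t a ks - s n a ks)) \<longlonglongrightarrow> 0"
    and Xlim: "(\<lambda>n. \<integral>w. (X a w - F n a w)\<^sup>2 \<partial>M) \<longlonglongrightarrow> 0" if "a < r" for a
    using lim[OF that] by (auto simp: wiener_limit_def F_def approximant_def s_def)
  have FM: "has_all_moments M (F n a)" for n a
    unfolding F_def by (rule approximant_moments)
  have Fmeas[measurable]: "F n a \<in> borel_measurable M" for n a
    using FM has_all_moments_measurable by blast
  have s: "hs_bounded (q a) (s n a)" for n a
    unfolding s_def by (intro hs_bounded_sum hs_bounded_scale hs_bounded_pure_power)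
  define Y where "Y n w = (\<Prod>a<r. F n a w)" for n w
  have YM: "has_all_moments M (Y n)" for n
    unfolding Y_def by (intro has_all_moments_prod FM)
  have EY: "expectation (Y n) = diagram_sum B r x q (s n)" for n
    unfolding Y_def F_def s_def by (rule approximant_diagram) (use S in auto)
  \<comment> \<open>Folds \<open>r + r\<close> vertices onto \<open>r\<close>, so that the square of
    the product is again a product of approximants, each vertex occurring twice.\<close>
  let ?g = "\<lambda>a. if a < r then a else a - r"
  have EY2: "expectation (\<lambda>w. (Y n w)\<^sup>2) = diagram_sum B (r + r) (x \<circ> ?g) (q \<circ> ?g) (\<lambda>a. s n (?g a))" for n
  proof -
    have "(Y n w)\<^sup>2 = (\<Prod>a<r + r. F n (?g a) w)" for w
      by (simp add: prod_lessThan_add power2_eq_square Y_def)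
    moreover have "expectation (\<lambda>w. \<Prod>a<r + r. approximant ((x \<circ> ?g) a) ((q \<circ> ?g) a) (S (?g a) n) (c (?g a) n) w)
        = diagram_sum B (r + r) (x \<circ> ?g) (q \<circ> ?g) (\<lambda>a ks. \<Sum>h\<in>S (?g a) n. c (?g a) n h * pure_power ((q \<circ> ?g) a) h ks)"
    proof (rule approximant_diagram)
      show "finite (S (?g a) n)" if "a < r + r" for a
        by (rule S(1)) (use that in auto)
      show "norm h = 1" if "a < r + r" "h \<in> S (?g a) n" "0 < (q \<circ> ?g) a" for a h
        by (rule S(2)[of "?g a" h n]) (use that in auto)
    qed
    ultimately show ?thesis by (simp add: F_def s_def[abs_def] comp_def)
  qed
  have "(\<lambda>n. diagram_sum B (r + r) (x \<circ> ?g) (q \<circ> ?g) (\<lambda>a. s n (?g a)))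
      \<longlonglongrightarrow> diagram_sum B (r + r) (x \<circ> ?g) (q \<circ> ?g) (\<lambda>a. t (?g a))"
    by (rule diagram_sum_tendsto[OF B]) (use s t tlim in auto)
  then have "Bseq (\<lambda>n. expectation (\<lambda>w. (Y n w)\<^sup>2))"
    unfolding EY2 by (intro convergent_imp_Bseq convergentI)
  then obtain C where C: "\<And>n. \<bar>expectation (\<lambda>w. (Y n w)\<^sup>2)\<bar> \<le> C"
    unfolding Bseq_def by auto
  \<comment> \<open>One sequence, tending to 0 in L1, for all factors together, so that a single
    subsequence converges almost surely at every vertex.\<close>
  define \<delta> where "\<delta> n w = (\<Sum>a<r. (X a w - F n a w)\<^sup>2)" for n w
  have int_diff: "integrable M (\<lambda>w. (X a w - F n a w)\<^sup>2)" if a: "a < r" for n a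
  proof (rule Bochner_Integration.integrable_bound)
    show "integrable M (\<lambda>w. 2 * (X a w)\<^sup>2 + 2 * (F n a w)\<^sup>2)"
      using X2[OF a] FM[of n a] by (auto simp: has_all_moments_def)
    have "(y - z)\<^sup>2 \<le> 2 * y\<^sup>2 + 2 * z\<^sup>2" for y z :: real
      using zero_le_power2[of "y + z"] by (simp add: power2_sum power2_diff)
    then show "AE w in M. norm ((X a w - F n a w)\<^sup>2) \<le> norm (2 * (X a w)\<^sup>2 + 2 * (F n a w)\<^sup>2)"
      by simp
  qed (use X[OF a] in measurable)
  have "integrable M (\<delta> n)" for n
    unfolding \<delta>_def by (intro Bochner_Integration.integrable_sum int_diff) auto
  moreover have "(\<lambda>n. \<integral>w. norm (\<delta> n w) \<partial>M) \<longlonglongrightarrow> 0"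
  proof -
    have "(\<integral>w. norm (\<delta> n w) \<partial>M) = (\<Sum>a<r. \<integral>w. (X a w - F n a w)\<^sup>2 \<partial>M)" for n
      unfolding \<delta>_def using int_diff by (simp add: sum_nonneg)
    moreover have "(\<lambda>n. \<Sum>a<r. \<integral>w. (X a w - F n a w)\<^sup>2 \<partial>M) \<longlonglongrightarrow> (\<Sum>a<r. 0)"
      by (intro tendsto_sum Xlim) auto
    ultimately show ?thesis by simp
  qed
  ultimately obtain \<rho> :: "nat \<Rightarrow> nat" where \<rho>: "strict_mono \<rho>" "AE w in M. (\<lambda>n. \<delta> (\<rho> n) w) \<longlonglongrightarrow> 0"
    using tendsto_L1_AE_subseq[of M \<delta>] by blast
  have AE: "AE w in M. (\<lambda>n. Y (\<rho> n) w) \<longlonglongrightarrow> (\<Prod>a<r. X a w)"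
    using \<rho>(2)
  proof eventually_elim
    case (elim w)
    have "(\<lambda>n. F (\<rho> n) a w) \<longlonglongrightarrow> X a w" if a: "a < r" for a
    proof -
      have "(X a w - F (\<rho> n) a w)\<^sup>2 \<le> \<delta> (\<rho> n) w" for n
        unfolding \<delta>_def by (rule member_le_sum) (use a in auto)
      then have "(\<lambda>n. (X a w - F (\<rho> n) a w)\<^sup>2) \<longlonglongrightarrow> 0"
        by (intro tendsto_sandwich[OF _ _ tendsto_const elim]) (auto intro!: always_eventually)
      from tendsto_real_sqrt[OF this] have "(\<lambda>n. \<bar>X a w - F (\<rho> n) a w\<bar>) \<longlonglongrightarrow> 0"
        by simp
      then have "(\<lambda>n. X a w - F (\<rho> n) a w) \<longlonglongrightarrow> 0"
        by (simp only: tendsto_rabs_zero_iff)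
      then have "(\<lambda>n. X a w - (X a w - F (\<rho> n) a w)) \<longlonglongrightarrow> X a w - 0"
        by (intro tendsto_diff tendsto_const)
      then show ?thesis by simp
    qed
    then show ?case unfolding Y_def by (intro tendsto_prod) auto
  qed
  have Xprod: "(\<lambda>w. \<Prod>a<r. X a w) \<in> borel_measurable M"
    by (intro borel_measurable_prod X) auto
  have Y2: "integrable M (\<lambda>w. (Y n w)\<^sup>2)" for n
    using YM[of n] by (simp add: has_all_moments_def)
  note limits = expectation_tendsto_of_bounded_square[OF has_all_moments_measurable[OF YM] Xprod Y2 _ AE]
  have bound: "expectation (\<lambda>w. (Y (\<rho> n) w)\<^sup>2) \<le> C" for n
    using C[of "\<rho> n"] by simp
  show "integrable M (\<lambda>w. \<Prod>a<r. X a w)"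
    using limits(1)[OF bound] by simp
  have "(\<lambda>n. expectation (Y (\<rho> n))) \<longlonglongrightarrow> expectation (\<lambda>w. \<Prod>a<r. X a w)"
    using limits(2)[OF bound] by simp
  moreover have "(\<lambda>n. expectation (Y n)) \<longlonglongrightarrow> diagram_sum B r x q t"
    unfolding EY by (rule diagram_sum_tendsto[OF B]) (use s t tlim in auto)
  then have "(\<lambda>n. expectation (Y (\<rho> n))) \<longlonglongrightarrow> diagram_sum B r x q t"
    using LIMSEQ_subseq_LIMSEQ[OF _ \<rho>(1)] by (simp add: comp_def)
  ultimately show "expectation (\<lambda>w. \<Prod>a<r. X a w) = diagram_sum B r x q t"
    by (rule LIMSEQ_unique)
qed

end

section \<open>The moment expansion\<close>

lemma arrays_with_fibre:
  assumes "q \<in> PiE {..<r} (\<lambda>_. {..m})"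
  shows "{N \<in> arrays r m. restrict (row_sum r N) {..<r} = q} = arrays_with r q"
proof -
  have eq: "restrict (row_sum r N) {..<r} = q \<longleftrightarrow> (\<forall>a<r. row_sum r N a = q a)" for N
    using assms by (auto simp: fun_eq_iff PiE_iff extensional_def restrict_def)
  have "q a \<le> m" if "a < r" for a using assms that by (auto simp: PiE_iff)
  then show ?thesis by (auto simp: eq arrays_def arrays_with_def)
qed

text \<open>The kernel raised to the multiplicities multiplies up to \<open>chi\<close>, while the
  factorials of degrees and multiplicities complete the coefficient.\<close>

lemma diagram_sum_eq:
  assumes "\<And>a. a < r \<Longrightarrow> q a \<le> m"
  shows "diagram_sum B r x q (\<lambda>a. f (q a)) = (\<Sum>N\<in>arrays_with r q. contr_coeff B f r N * chi r N x)"
  unfolding diagram_sum_def sum_distrib_left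
proof (rule sum.cong[OF refl])
  fix N assume N: "N \<in> arrays_with r q"
  then have rows: "row_sum r N a = q a" if "a < r" for a using that by (auto simp: arrays_with_def)
  have "contr B r N (\<lambda>a. f (q a)) = contr B r N (\<lambda>a. f (row_sum r N a))"
    by (rule contr_cong) (simp add: rows)
  moreover have "(\<Prod>a<r. fact (q a)) = (\<Prod>a<r. fact (row_sum r N a) :: real)"
    by (simp add: rows)
  moreover have "edge_weight r (\<lambda>a b. exp (- (x a - x b)\<^sup>2)) N
      = chi r N x / (\<Prod>(a, b)\<in>vertex_pairs r. fact (N a b))"
  proof -
    have "N \<in> arrays r m" using arrays_with_subset[of r q m] assms N by blast
    then have "chi r N x = (\<Prod>(a, b)\<in>vertex_pairs r. exp (- (x a - x b)\<^sup>2) ^ N a b)"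
      by (simp add: chi_eq edge_form_def sum_negf[symmetric] exp_sum[OF finite_vertex_pairs[unfolded case_prod_unfold]]
          case_prod_unfold exp_of_nat_mult[symmetric])
    then show ?thesis
      by (simp add: edge_weight_def case_prod_unfold prod_dividef)
  qed
  ultimately show "(\<Prod>a<r. fact (q a)) * (edge_weight r (\<lambda>a b. exp (- (x a - x b)\<^sup>2)) N * contr B r N (\<lambda>a. f (q a)))
      = contr_coeff B f r N * chi r N x"
    by (simp add: contr_coeff_def)
qed

lemma symmetric_packet_hs_bounded:
  assumes "symmetric_packet m f" "q \<le> m"
  shows "hs_bounded q (f q)"
  using assms by (auto simp: symmetric_packet_def symmetric_tensors_def tensor_power_space_def hs_bounded_def)

locale canvas_with_process =
  fixes M :: "'w measure" and W :: "real \<Rightarrow> 'h::real_inner \<Rightarrow> 'w \<Rightarrow> real" and B :: "'h set"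
    and m :: nat and f :: "'h packet" and Z :: "'w \<Rightarrow> real \<Rightarrow> real"
  assumes process: "canvas_process M W m f Z" and onb: "orthonormal_basis B"
begin

lemma canvas: "gaussian_canvas M W" and packet: "symmetric_packet m f"
  and Z_measurable: "(\<lambda>w. Z w u) \<in> borel_measurable M"
  and Z_continuous: "w \<in> space M \<Longrightarrow> Z w \<in> continuous_paths"
proof -
  show "gaussian_canvas M W" "symmetric_packet m f" "(\<lambda>w. Z w u) \<in> borel_measurable M"
    using process by (auto simp: canvas_process_def)
  assume "w \<in> space M"
  then have smooth: "smooth_path (Z w)" using process by (auto simp: canvas_process_def)
  have "Z w differentiable (at t)" for t
    using smooth[unfolded smooth_path_def, rule_format, of 0 t] by simp
  then show "Z w \<in> continuous_paths"
    by (auto simp: continuous_paths_def continuous_on_eq_continuous_at differentiable_imp_continuous_within)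
qed

sublocale canvas M W B
proof -
  interpret prob_space M using canvas by (simp add: gaussian_canvas_def)
  show "canvas M W B" by unfold_locales (rule canvas onb)+
qed

text \<open>Expanding the product of chaos sums picks one order per factor. The diagram formula then
  sums over arrays with these row sums, and the choices of orders together exhaust
  \<open>arrays r m\<close>.\<close>

lemma moment_expansion:
  shows "integrable M (\<lambda>w. \<Prod>a<r. Z w (x a))"
    and "moment M Z r x = (\<Sum>N\<in>arrays r m. contr_coeff B f r N * chi r N x)"
proof -
  have "\<exists>X. (\<forall>q\<le>m. \<exists>S c. wiener_limit M (W u) q (f q) (X q) S c) \<and> (AE w in M. Z w u = (\<Sum>q\<le>m. X q w))" for u
  proof -
    obtain X where X: "\<forall>q\<in>{1..m}. multiple_wiener_integral M (W u) q (f q) (X q)"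
      and Z: "AE w in M. Z w u = f 0 [] + (\<Sum>q=1..m. X q w)"
      using process unfolding canvas_process_def by blast
    \<comment> \<open>The constant enters as the component of order 0, so that \<open>Z\<close>
      becomes a single sum over \<open>q \<le> m\<close>.\<close>
    define X' where "X' q = (if q = 0 then \<lambda>_. f 0 [] else X q)" for q
    have "\<exists>S c. wiener_limit M (W u) q (f q) (X' q) S c" if "q \<le> m" for q
    proof (cases "q = 0")
      case True
      have "f 0 \<in> tensor_power_space 0"
        using packet by (auto simp: symmetric_packet_def symmetric_tensors_def)
      then show ?thesis using wiener_limit_zero True by (auto simp: X'_def)
    next
      case False
      then have "multiple_wiener_integral M (W u) q (f q) (X q)" using X that by auto
      then show ?thesis using False by (simp add: X'_def wiener_limit_positive)
    qed
    moreover have "(\<Sum>q\<le>m. X' q w) = f 0 [] + (\<Sum>q=1..m. X q w)" for w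
    proof -
      have "{..m} = insert 0 {1..m}" by auto
      then show ?thesis by (simp add: X'_def)
    qed
    ultimately show ?thesis using Z by (intro exI[of _ X']) simp
  qed
  then obtain X where X: "\<And>u q. q \<le> m \<Longrightarrow> \<exists>S c. wiener_limit M (W u) q (f q) (X u q) S c"
    and Z: "\<And>u. AE w in M. Z w u = (\<Sum>q\<le>m. X u q w)"
    by metis
  define S where "S u q = (SOME S. \<exists>c. wiener_limit M (W u) q (f q) (X u q) S c)" for u q
  define c where "c u q = (SOME c. wiener_limit M (W u) q (f q) (X u q) (S u q) c)" for u q
  have lim: "wiener_limit M (W u) q (f q) (X u q) (S u q) (c u q)" if "q \<le> m" for u q
    unfolding c_def S_def by (rule someI_ex[OF someI_ex[OF X[OF that]]])
  let ?Q = "PiE {..<r} (\<lambda>_. {..m})"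
  have finQ: "finite ?Q" by (intro finite_PiE) auto
  have AE: "AE w in M. (\<Prod>a<r. Z w (x a)) = (\<Sum>q\<in>?Q. \<Prod>a<r. X (x a) (q a) w)"
  proof -
    have "AE w in M. \<forall>a\<in>{..<r}. Z w (x a) = (\<Sum>q\<le>m. X (x a) q w)"
      by (intro AE_finite_allI Z) auto
    then show ?thesis
      by eventually_elim (simp add: prod_sum_PiE)
  qed
  have le: "q a \<le> m" if "q \<in> ?Q" "a < r" for q a using that by (auto simp: PiE_iff)
  have int: "integrable M (\<lambda>w. \<Prod>a<r. X (x a) (q a) w)"
    and ex: "expectation (\<lambda>w. \<Prod>a<r. X (x a) (q a) w) = diagram_sum B r x q (\<lambda>a. f (q a))" if q: "q \<in> ?Q" for q
  proof -
    have L: "wiener_limit M (W (x a)) (q a) (f (q a)) (X (x a) (q a)) (S (x a) (q a)) (c (x a) (q a))" if "a < r" for a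
      using lim le[OF q that] by blast
    have T: "hs_bounded (q a) (f (q a))" if "a < r" for a
      using symmetric_packet_hs_bounded[OF packet] le[OF q that] by blast
    show "integrable M (\<lambda>w. \<Prod>a<r. X (x a) (q a) w)"
      by (rule wiener_limit_diagram(1)[OF L T])
    show "expectation (\<lambda>w. \<Prod>a<r. X (x a) (q a) w) = diagram_sum B r x q (\<lambda>a. f (q a))"
      by (rule wiener_limit_diagram(2)[OF L T])
  qed
  have meas: "(\<lambda>w. \<Prod>a<r. Z w (x a)) \<in> borel_measurable M"
    by (intro borel_measurable_prod Z_measurable)
  have sum_int: "integrable M (\<lambda>w. \<Sum>q\<in>?Q. \<Prod>a<r. X (x a) (q a) w)"
    by (intro Bochner_Integration.integrable_sum int)
  show "integrable M (\<lambda>w. \<Prod>a<r. Z w (x a))"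
    by (rule iffD2[OF integrable_cong_AE[OF meas borel_measurable_integrable[OF sum_int] AE] sum_int])
  have "moment M Z r x = expectation (\<lambda>w. \<Sum>q\<in>?Q. \<Prod>a<r. X (x a) (q a) w)"
    unfolding moment_def by (rule integral_cong_AE[OF meas borel_measurable_integrable[OF sum_int] AE])
  also have "\<dots> = (\<Sum>q\<in>?Q. diagram_sum B r x q (\<lambda>a. f (q a)))"
    using int ex by simp
  also have "\<dots> = (\<Sum>q\<in>?Q. \<Sum>N\<in>{N \<in> arrays r m. restrict (row_sum r N) {..<r} = q}. contr_coeff B f r N * chi r N x)"
  proof (rule sum.cong[OF refl])
    fix q assume q: "q \<in> ?Q"
    show "diagram_sum B r x q (\<lambda>a. f (q a))
        = (\<Sum>N\<in>{N \<in> arrays r m. restrict (row_sum r N) {..<r} = q}. contr_coeff B f r N * chi r N x)"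
      unfolding arrays_with_fibre[OF q] by (rule diagram_sum_eq[OF le[OF q]])
  qed
  also have "\<dots> = (\<Sum>N\<in>arrays r m. contr_coeff B f r N * chi r N x)"
    by (rule sum.group[OF finite_arrays finQ], rule image_subsetI, simp only: restrict_PiE_iff, simp add: arrays_def)
  finally show "moment M Z r x = (\<Sum>N\<in>arrays r m. contr_coeff B f r N * chi r N x)" .
qed

lemma moment_vec_integral:
  assumes r: "r \<ge> 1" and N': "N' \<in> arrays r m"
  shows "integrable (centered_gauss r) (\<lambda>x. moment M Z r x * chi r N' x)"
    and "moment_vec M Z r N' = (\<Sum>N\<in>arrays r m. contr_coeff B f r N * gram r N N')"
proof -
  have eq: "moment M Z r x * chi r N' x = (\<Sum>N\<in>arrays r m. contr_coeff B f r N * (chi r N x * chi r N' x))" for x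
    by (simp add: moment_expansion(2) sum_distrib_right mult.assoc)
  have int: "integrable (centered_gauss r) (\<lambda>x. contr_coeff B f r N * (chi r N x * chi r N' x))" if "N \<in> arrays r m" for N
    by (intro integrable_mult_right gram_integral(1)[OF that N' r])
  show "integrable (centered_gauss r) (\<lambda>x. moment M Z r x * chi r N' x)"
    unfolding eq by (intro Bochner_Integration.integrable_sum int)
  show "moment_vec M Z r N' = (\<Sum>N\<in>arrays r m. contr_coeff B f r N * gram r N N')"
    unfolding moment_vec_def eq using int by (simp add: gram_def)
qed

text \<open>By \<open>moment_vec_integral\<close> the moment vector is the symmetric Gram matrix
  applied to the coefficient vector.\<close>

lemma coefficients_from_moments:
  assumes r: "r \<ge> 1" and H: "inverse_matrix_on (arrays r m) (gram r) H" and N: "N \<in> arrays r m"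
  shows "contr_coeff B f r N = (\<Sum>N'\<in>arrays r m. H N N' * moment_vec M Z r N')"
proof -
  let ?A = "arrays r m"
  have "(\<Sum>N'\<in>?A. H N N' * moment_vec M Z r N')
      = (\<Sum>N'\<in>?A. \<Sum>K\<in>?A. contr_coeff B f r K * (H N N' * gram r N' K))"
    by (intro sum.cong refl) (simp add: moment_vec_integral(2)[OF r] sum_distrib_left gram_def mult_ac)
  also have "\<dots> = (\<Sum>K\<in>?A. contr_coeff B f r K * (\<Sum>N'\<in>?A. H N N' * gram r N' K))"
    by (subst sum.swap) (simp add: sum_distrib_left)
  also have "\<dots> = (\<Sum>K\<in>?A. contr_coeff B f r K * (if N = K then 1 else 0))"
    using H N by (intro sum.cong refl) (auto simp: inverse_matrix_on_def)
  also have "\<dots> = contr_coeff B f r N"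
    using N by (simp add: mult_delta_right finite_arrays)
  finally show ?thesis by simp
qed

end

lemma zero_array: "(\<lambda>_ _. 0) \<in> arrays r m"
  by (simp add: arrays_def row_sum_def)

text \<open>The case of the first moment: a single vertex without edges has exactly one labelling,
  the empty one.\<close>

lemma contr_coeff_zero_array: "contr_coeff B f 1 (\<lambda>_ _. 0) = f 0 []"
proof -
  have "edges 1 (\<lambda>_ _. 0) = {}" by (auto simp: edges_def)
  moreover have "{(a, b). a < b \<and> b < (1::nat)} = {}" by auto
  ultimately show ?thesis
    by (simp add: contr_coeff_def contr_def row_sum_def legs_def lessThan_Suc)
qed

text \<open>The combinatorial prefactor depends on \<open>N\<close> alone and is nonzero, so it
  cancels even between different Hilbert spaces.\<close>

lemma contr_coeff_cancel:
  assumes "contr_coeff B f r N = contr_coeff B' g r N"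
  shows "contr B r N (\<lambda>a. f (row_sum r N a)) = contr B' r N (\<lambda>a. g (row_sum r N a))"
proof -
  have "(\<Prod>a<r. fact (row_sum r N a)) / (\<Prod>(a, b)\<in>vertex_pairs r. fact (N a b)) \<noteq> (0 :: real)"
    by (auto simp: prod_zero_iff finite_vertex_pairs)
  then show ?thesis using assms unfolding contr_coeff_def by simp
qed

theorem proposition3p10:
  fixes M :: "'w measure"
    and W :: "real \<Rightarrow> 'h::{real_inner, polish_space} \<Rightarrow> 'w \<Rightarrow> real"
    and m :: nat
    and f :: "'h packet"
    and Z :: "'w \<Rightarrow> real \<Rightarrow> real"
    and B :: "'h set"
  assumes "canvas_process M W m f Z"
    and "orthonormal_basis B"
  shows "(\<forall>r\<ge>1.
            (\<forall>x\<in>centered_space r.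
               integrable M (\<lambda>w. \<Prod>a<r. Z w (x a)) \<and>
               moment M Z r x = (\<Sum>N\<in>arrays r m. contr_coeff B f r N * chi r N x)) \<and>
            finite (arrays r m) \<and>
            (\<forall>N\<in>arrays r m. \<forall>N'\<in>arrays r m.
               integrable (centered_gauss r) (\<lambda>x. chi r N x * chi r N' x) \<and>
               gram r N N' =
                 1 / sqrt (centered_det r
                   (\<lambda>a b. (if a = b then 1 else 0) + laplacian r N a b + laplacian r N' a b))) \<and>
            (\<forall>N'\<in>arrays r m.
               integrable (centered_gauss r) (\<lambda>x. moment M Z r x * chi r N' x)) \<and>
            pos_def_on (arrays r m) (gram r) \<and>
            (\<exists>G_inv. inverse_matrix_on (arrays r m) (gram r) G_inv \<and>
               (\<forall>N\<in>arrays r m.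
                  contr_coeff B f r N = (\<Sum>N'\<in>arrays r m. G_inv N N' * moment_vec M Z r N')))) \<and>
         (\<forall>(M' :: 'v measure) (W' :: real \<Rightarrow> 'k::{real_inner, polish_space} \<Rightarrow> 'v \<Rightarrow> real)
            (g :: 'k packet) (Z' :: 'v \<Rightarrow> real \<Rightarrow> real) (B' :: 'k set).
            canvas_process M' W' m g Z' \<and> orthonormal_basis B' \<and> path_law M Z = path_law M' Z' \<longrightarrow>
              f 0 [] = g 0 [] \<and>
              (\<forall>r\<ge>1. \<forall>N\<in>arrays r m. (\<forall>a<r. 1 \<le> row_sum r N a) \<longrightarrow>
                 contr B r N (\<lambda>a. f (row_sum r N a)) = contr B' r N (\<lambda>a. g (row_sum r N a))))"
proof (rule conjI)
  interpret F: canvas_with_process M W B m f Z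
    using assms by unfold_locales
  have inverse: "\<exists>H. inverse_matrix_on (arrays r m) (gram r) H" if "r \<ge> 1" for r
    by (rule pos_def_inverse[OF finite_arrays pos_def_gram[OF that]])
  show "\<forall>r\<ge>1.
            (\<forall>x\<in>centered_space r.
               integrable M (\<lambda>w. \<Prod>a<r. Z w (x a)) \<and>
               moment M Z r x = (\<Sum>N\<in>arrays r m. contr_coeff B f r N * chi r N x)) \<and>
            finite (arrays r m) \<and>
            (\<forall>N\<in>arrays r m. \<forall>N'\<in>arrays r m.
               integrable (centered_gauss r) (\<lambda>x. chi r N x * chi r N' x) \<and>
               gram r N N' =
                 1 / sqrt (centered_det r
                   (\<lambda>a b. (if a = b then 1 else 0) + laplacian r N a b + laplacian r N' a b))) \<and>
            (\<forall>N'\<in>arrays r m.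
               integrable (centered_gauss r) (\<lambda>x. moment M Z r x * chi r N' x)) \<and>
            pos_def_on (arrays r m) (gram r) \<and>
            (\<exists>G_inv. inverse_matrix_on (arrays r m) (gram r) G_inv \<and>
               (\<forall>N\<in>arrays r m.
                  contr_coeff B f r N = (\<Sum>N'\<in>arrays r m. G_inv N N' * moment_vec M Z r N')))"
  proof (intro allI impI)
    fix r :: nat assume r: "1 \<le> r"
    obtain H where H: "inverse_matrix_on (arrays r m) (gram r) H" using inverse[OF r] by blast
    show "(\<forall>x\<in>centered_space r.
               integrable M (\<lambda>w. \<Prod>a<r. Z w (x a)) \<and>
               moment M Z r x = (\<Sum>N\<in>arrays r m. contr_coeff B f r N * chi r N x)) \<and>
            finite (arrays r m) \<and>
            (\<forall>N\<in>arrays r m. \<forall>N'\<in>arrays r m.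
               integrable (centered_gauss r) (\<lambda>x. chi r N x * chi r N' x) \<and>
               gram r N N' =
                 1 / sqrt (centered_det r
                   (\<lambda>a b. (if a = b then 1 else 0) + laplacian r N a b + laplacian r N' a b))) \<and>
            (\<forall>N'\<in>arrays r m.
               integrable (centered_gauss r) (\<lambda>x. moment M Z r x * chi r N' x)) \<and>
            pos_def_on (arrays r m) (gram r) \<and>
            (\<exists>G_inv. inverse_matrix_on (arrays r m) (gram r) G_inv \<and>
               (\<forall>N\<in>arrays r m.
                  contr_coeff B f r N = (\<Sum>N'\<in>arrays r m. G_inv N N' * moment_vec M Z r N')))"
      by (intro conjI ballI exI[of _ H] F.moment_expansion finite_arrays gram_integral r pos_def_gram H
          F.moment_vec_integral F.coefficients_from_moments)
  qed
  show "\<forall>(M' :: 'v measure) (W' :: real \<Rightarrow> 'k \<Rightarrow> 'v \<Rightarrow> real)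
            (g :: 'k packet) (Z' :: 'v \<Rightarrow> real \<Rightarrow> real) (B' :: 'k set).
            canvas_process M' W' m g Z' \<and> orthonormal_basis B' \<and> path_law M Z = path_law M' Z' \<longrightarrow>
              f 0 [] = g 0 [] \<and>
              (\<forall>r\<ge>1. \<forall>N\<in>arrays r m. (\<forall>a<r. 1 \<le> row_sum r N a) \<longrightarrow>
                 contr B r N (\<lambda>a. f (row_sum r N a)) = contr B' r N (\<lambda>a. g (row_sum r N a)))"
  proof (intro allI impI, elim conjE)
    fix M' :: "'v measure" and W' :: "real \<Rightarrow> 'k \<Rightarrow> 'v \<Rightarrow> real" and g :: "'k packet"
      and Z' :: "'v \<Rightarrow> real \<Rightarrow> real" and B' :: "'k set"
    assume "canvas_process M' W' m g Z'" "orthonormal_basis B'" and law: "path_law M Z = path_law M' Z'"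
    then interpret F': canvas_with_process M' W' B' m g Z'
      by unfold_locales
    \<comment> \<open>As integrals over path space the moments depend on the law alone, although the
      processes may live on different probability and Hilbert spaces.\<close>
    have "moment M Z r x = moment M' Z' r x" for r x
      using moment_path_law[of Z M r x, OF F.Z_measurable F.Z_continuous]
        moment_path_law[of Z' M' r x, OF F'.Z_measurable F'.Z_continuous] law by simp
    then have same_vec: "moment_vec M Z r N = moment_vec M' Z' r N" for r N
      by (simp add: moment_vec_def)
    have coeff: "contr_coeff B f r N = contr_coeff B' g r N" if r: "r \<ge> 1" and N: "N \<in> arrays r m" for r N
    proof -
      \<comment> \<open>The Gram matrix does not involve the process, so one inverse serves
        both.\<close>
      obtain H where "inverse_matrix_on (arrays r m) (gram r) H" using inverse[OF r] by blast
      then show ?thesis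
        using F.coefficients_from_moments[OF r _ N] F'.coefficients_from_moments[OF r _ N] by (simp add: same_vec)
    qed
    have "f 0 [] = g 0 []"
      using coeff[of 1, OF _ zero_array] by (simp only: contr_coeff_zero_array order_refl)
    then show "f 0 [] = g 0 [] \<and>
        (\<forall>r\<ge>1. \<forall>N\<in>arrays r m. (\<forall>a<r. 1 \<le> row_sum r N a) \<longrightarrow>
           contr B r N (\<lambda>a. f (row_sum r N a)) = contr B' r N (\<lambda>a. g (row_sum r N a)))"
      using coeff contr_coeff_cancel by blast
  qed
qed

end
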